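(* Let $\Sigma$ be a complete properly immersed self-expander hypersurface in $\mathbb{R}^{n+1}$. Assume that its mean curvature $H$ satisfies $|H|(x)\le a|x|+b$ for all $x\in\Sigma$, for some constants $0\le a<\frac{1}{2\sqrt2}$ and $b>0$. Then the bottom $\mu_1$ of the spectrum of the $L$-stability operator $L=\Delta+\frac12\langle x,\nabla\cdot\rangle+|A|^2-\frac12$ satisfies $$\mu_1\le\frac{n+1}{2}+\frac{\int_\Sigma Scal_\Sigma\,e^{-\frac{|x|^2}{4}}\,d\sigma}{\int_\Sigma e^{-\frac{|x|^2}{4}}\,d\sigma}.$$ If $\mu_1>-\infty$, then $\int_\Sigma Scal_\Sigma\,e^{-\frac{|x|^2}{4}}\,d\sigma<\infty$, and the equality $$\mu_1=\frac{n+1}{2}+\frac{\int_\Sigma Scal_\Sigma\,e^{-\frac{|x|^2}{4}}\,d\sigma}{\int_\Sigma e^{-\frac{|x|^2}{4}}\,d\sigma}$$ holds if and only if the scalar curvature $Scal_\Sigma$ of $\Sigma$ is constant.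
   Context: $x$ denotes the position vector. For an immersed hypersurface $\Sigma$ with induced metric, volume form $d\sigma$, gradient $\nabla$ and Laplacian $\Delta$, the second fundamental form is $A(X,Y)=(\overline\nabla_XY)^\perp$ ($\overline\nabla$ the Euclidean connection), the mean curvature vector $\mathbf{H}$ is its trace, and $\Sigma$ is a self-expander if $\mathbf{H}=\frac12x^\perp$ ($x^\perp$ the normal component of $x$). The mean curvature $H$ is defined by $\mathbf{H}=-H\mathbf{n}$, $\mathbf{n}$ the unit normal, and $Scal_\Sigma=H^2-|A|^2$ is the scalar curvature. $\Sigma$ is properly immersed if the preimage under the immersion of every compact subset of $\mathbb{R}^{n+1}$ is compact. The bottom of the (weighted $L^2$) spectrum of $L$ is $$\mu_1=\inf\left\{\frac{\int_\Sigma\left(|\nabla\varphi|^2-(|A|^2-\frac12)\varphi^2\right)e^{\frac{|x|^2}{4}}d\sigma}{\int_\Sigma\varphi^2e^{\frac{|x|^2}{4}}d\sigma}:\ \varphi\in C_0^\infty(\Sigma),\ \int_\Sigma\varphi^2e^{\frac{|x|^2}{4}}d\sigma\ne0\right\}\in[-\infty,\infty),$$ and inequalities are understood in the extended reals; in particular the upper bound is trivially true when $\mu_1=-\infty$. *)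

theory Defs
  imports "HOL-Analysis.Analysis"
begin

subsection \<open>Smooth maps on open subsets of Euclidean space\<close>

definition dir_deriv :: "('a::euclidean_space \<Rightarrow> 'b::euclidean_space) \<Rightarrow> 'a \<Rightarrow> 'a \<Rightarrow> 'b" where
  "dir_deriv f v x = frechet_derivative f (at x) v"

primrec Ck_on :: "nat \<Rightarrow> 'a set \<Rightarrow> ('a::euclidean_space \<Rightarrow> 'b::euclidean_space) \<Rightarrow> bool" where
  "Ck_on 0 S f \<longleftrightarrow> continuous_on S f"
| "Ck_on (Suc k) S f \<longleftrightarrow> (\<forall>x\<in>S. f differentiable (at x)) \<and> (\<forall>v. Ck_on k S (dir_deriv f v))"

definition smooth_on :: "'a set \<Rightarrow> ('a::euclidean_space \<Rightarrow> 'b::euclidean_space) \<Rightarrow> bool" where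
  "smooth_on S f \<longleftrightarrow> (\<forall>k. Ck_on k S f)"


subsection \<open>Smooth manifolds\<close>

text \<open>
  The underlying space of the manifold is a whole type \<open>'m\<close> carrying a Hausdorff second countable
  topology. A chart is a pair \<open>(U, \<phi>)\<close>; only the values of \<open>\<phi>\<close> on \<open>U\<close> matter.
\<close>

type_synonym ('m, 'n) chart = "'m set \<times> ('m \<Rightarrow> real ^ 'n)"

definition chart_inv :: "('m, 'n::finite) chart \<Rightarrow> real ^ 'n \<Rightarrow> 'm" where
  "chart_inv c = inv_into (fst c) (snd c)"

definition chart_image :: "('m, 'n::finite) chart \<Rightarrow> (real ^ 'n) set" where
  "chart_image c = snd c ` fst c"

definition smooth_atlas ::
  "('m::{t2_space, second_countable_topology}, 'n::finite) chart set \<Rightarrow> bool" where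
  "smooth_atlas A \<longleftrightarrow>
     (\<Union>c\<in>A. fst c) = UNIV \<and>
     (\<forall>c\<in>A. open (fst c) \<and> open (chart_image c) \<and>
        homeomorphism (fst c) (chart_image c) (snd c) (chart_inv c)) \<and>
     (\<forall>c\<in>A. \<forall>d\<in>A. smooth_on (snd c ` (fst c \<inter> fst d)) (snd d \<circ> chart_inv c))"

definition smooth_map ::
  "('m::{t2_space, second_countable_topology}, 'n::finite) chart set
     \<Rightarrow> ('m \<Rightarrow> 'b::euclidean_space) \<Rightarrow> bool" where
  "smooth_map A f \<longleftrightarrow> (\<forall>c\<in>A. smooth_on (chart_image c) (f \<circ> chart_inv c))"

text \<open>
  The pointwise geometric quantities below are computed in some chart around the point;
  they do not depend on which one.
\<close>

definition chart_at :: "('m, 'n::finite) chart set \<Rightarrow> 'm \<Rightarrow> ('m, 'n) chart" where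
  "chart_at A p = (SOME c. c \<in> A \<and> p \<in> fst c)"


subsection \<open>Local geometry of a parametrized hypersurface\<close>

text \<open>
  \<open>X\<close> is a local parametrization and \<open>y\<close> a point of its domain.
\<close>

definition coord_deriv :: "(real ^ 'n \<Rightarrow> 'b::euclidean_space) \<Rightarrow> 'n::finite \<Rightarrow> real ^ 'n \<Rightarrow> 'b" where
  "coord_deriv X i = dir_deriv X (axis i 1)"

definition metric_matrix :: "(real ^ 'n::finite \<Rightarrow> 'b::euclidean_space) \<Rightarrow> real ^ 'n \<Rightarrow> real ^ 'n ^ 'n" where
  "metric_matrix X y = (\<chi> i j. coord_deriv X i y \<bullet> coord_deriv X j y)"

definition inv_metric :: "(real ^ 'n::finite \<Rightarrow> 'b::euclidean_space) \<Rightarrow> real ^ 'n \<Rightarrow> real ^ 'n ^ 'n" where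
  "inv_metric X y = matrix_inv (metric_matrix X y)"

definition tangent_space :: "(real ^ 'n::finite \<Rightarrow> 'b::euclidean_space) \<Rightarrow> real ^ 'n \<Rightarrow> 'b set" where
  "tangent_space X y = range (frechet_derivative X (at y))"

definition normal_part :: "'b::euclidean_space set \<Rightarrow> 'b \<Rightarrow> 'b" where
  "normal_part T v = (THE w. w \<in> T\<^sup>\<bottom> \<and> v - w \<in> T)"

text \<open>
  \<open>A(\<partial>\<^sub>i, \<partial>\<^sub>j)\<close>: the Euclidean derivative of the coordinate field \<open>\<partial>\<^sub>j X\<close> in the direction
  \<open>\<partial>\<^sub>i X\<close> is the second partial derivative of \<open>X\<close>.
\<close>

definition second_ff ::
  "(real ^ 'n::finite \<Rightarrow> 'b::euclidean_space) \<Rightarrow> real ^ 'n \<Rightarrow> 'n \<Rightarrow> 'n \<Rightarrow> 'b" where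
  "second_ff X y i j = normal_part (tangent_space X y) (coord_deriv (coord_deriv X j) i y)"


subsection \<open>Immersed hypersurfaces\<close>

definition local_param ::
  "('m \<Rightarrow> 'b) \<Rightarrow> ('m, 'n::finite) chart \<Rightarrow> real ^ 'n \<Rightarrow> 'b::euclidean_space" where
  "local_param F c = F \<circ> chart_inv c"

definition immersed_hypersurface ::
  "('m::{t2_space, second_countable_topology}, 'n::finite) chart set \<Rightarrow> ('m \<Rightarrow> real ^ 'k::finite) \<Rightarrow> bool" where
  "immersed_hypersurface A F \<longleftrightarrow>
     CARD('k) = CARD('n) + 1 \<and> smooth_atlas A \<and> smooth_map A F \<and>
     (\<forall>c\<in>A. \<forall>y\<in>chart_image c. inj (frechet_derivative (local_param F c) (at y)))"

definition properly_immersed :: "('m::topological_space \<Rightarrow> 'b::euclidean_space) \<Rightarrow> bool" where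
  "properly_immersed F \<longleftrightarrow> (\<forall>K. compact K \<longrightarrow> compact (F -` K))"

definition tangent_at ::
  "('m, 'n::finite) chart set \<Rightarrow> ('m \<Rightarrow> 'b::euclidean_space) \<Rightarrow> 'm \<Rightarrow> 'b set" where
  "tangent_at A F p = (let c = chart_at A p in tangent_space (local_param F c) (snd c p))"

definition mean_curvature_vector ::
  "('m, 'n::finite) chart set \<Rightarrow> ('m \<Rightarrow> 'b::euclidean_space) \<Rightarrow> 'm \<Rightarrow> 'b" where
  "mean_curvature_vector A F p =
     (let c = chart_at A p; X = local_param F c; y = snd c p in
      \<Sum>i\<in>UNIV. \<Sum>j\<in>UNIV. inv_metric X y $ i $ j *\<^sub>R second_ff X y i j)"

definition second_ff_norm_sq ::
  "('m, 'n::finite) chart set \<Rightarrow> ('m \<Rightarrow> 'b::euclidean_space) \<Rightarrow> 'm \<Rightarrow> real" where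
  "second_ff_norm_sq A F p =
     (let c = chart_at A p; X = local_param F c; y = snd c p in
      \<Sum>i\<in>UNIV. \<Sum>j\<in>UNIV. \<Sum>k\<in>UNIV. \<Sum>l\<in>UNIV.
        inv_metric X y $ i $ k * inv_metric X y $ j $ l * (second_ff X y i j \<bullet> second_ff X y k l))"

definition grad_norm_sq ::
  "('m, 'n::finite) chart set \<Rightarrow> ('m \<Rightarrow> 'b::euclidean_space) \<Rightarrow> ('m \<Rightarrow> real) \<Rightarrow> 'm \<Rightarrow> real" where
  "grad_norm_sq A F f p =
     (let c = chart_at A p; X = local_param F c; y = snd c p; u = f \<circ> chart_inv c in
      \<Sum>i\<in>UNIV. \<Sum>j\<in>UNIV. inv_metric X y $ i $ j * coord_deriv u i y * coord_deriv u j y)"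

definition self_expander ::
  "('m, 'n::finite) chart set \<Rightarrow> ('m \<Rightarrow> 'b::euclidean_space) \<Rightarrow> bool" where
  "self_expander A F \<longleftrightarrow>
     (\<forall>p. mean_curvature_vector A F p = (1 / 2) *\<^sub>R normal_part (tangent_at A F p) (F p))"

text \<open>
  A pointwise choice of unit normal. Continuity is not required, so non-orientable immersed
  hypersurfaces are included: changing \<open>N p\<close> to \<open>- N p\<close> only changes the sign of the mean
  curvature at \<open>p\<close>.
\<close>

definition unit_normal ::
  "('m, 'n::finite) chart set \<Rightarrow> ('m \<Rightarrow> 'b::euclidean_space) \<Rightarrow> ('m \<Rightarrow> 'b) \<Rightarrow> bool" where
  "unit_normal A F N \<longleftrightarrow> (\<forall>p. norm (N p) = 1 \<and> N p \<in> (tangent_at A F p)\<^sup>\<bottom>)"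

text \<open>
  The solution \<open>h\<close> of \<open>mean_curvature_vector A F p = - h *\<^sub>R N p\<close>.
\<close>

definition mean_curvature ::
  "('m, 'n::finite) chart set \<Rightarrow> ('m \<Rightarrow> 'b::euclidean_space) \<Rightarrow> ('m \<Rightarrow> 'b) \<Rightarrow> 'm \<Rightarrow> real" where
  "mean_curvature A F N p = - (mean_curvature_vector A F p \<bullet> N p)"

definition scal ::
  "('m, 'n::finite) chart set \<Rightarrow> ('m \<Rightarrow> 'b::euclidean_space) \<Rightarrow> ('m \<Rightarrow> 'b) \<Rightarrow> 'm \<Rightarrow> real" where
  "scal A F N p = (mean_curvature A F N p)\<^sup>2 - second_ff_norm_sq A F p"


subsection \<open>Completeness of the induced metric\<close>

text \<open>
  Lengths are measured in the induced metric, so the speed of \<open>\<gamma>\<close> is the Euclidean speed of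
  \<open>F \<circ> \<gamma>\<close>. As \<open>F\<close> is locally an embedding, a continuous \<open>\<gamma>\<close> is piecewise \<open>C\<^sup>1\<close> exactly when
  \<open>F \<circ> \<gamma>\<close> is. The library's notion of piecewise \<open>C\<^sup>1\<close> allows the derivative to blow up at the break
  points; the length is therefore an extended nonnegative integral. Points in different components
  have distance \<open>\<infinity>\<close>.
\<close>

definition curve_length :: "('m \<Rightarrow> 'b::euclidean_space) \<Rightarrow> (real \<Rightarrow> 'm) \<Rightarrow> ennreal" where
  "curve_length F \<gamma> = (\<integral>\<^sup>+t\<in>{0..1}. ennreal (norm (vector_derivative (F \<circ> \<gamma>) (at t))) \<partial>lborel)"

definition intrinsic_dist ::
  "('m::topological_space \<Rightarrow> 'b::euclidean_space) \<Rightarrow> 'm \<Rightarrow> 'm \<Rightarrow> ennreal" where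
  "intrinsic_dist F p q =
     Inf {curve_length F \<gamma> |\<gamma>. path \<gamma> \<and> F \<circ> \<gamma> piecewise_C1_differentiable_on {0..1} \<and>
        pathstart \<gamma> = p \<and> pathfinish \<gamma> = q}"

definition complete_induced_metric :: "('m::topological_space \<Rightarrow> 'b::euclidean_space) \<Rightarrow> bool" where
  "complete_induced_metric F \<longleftrightarrow>
     (\<forall>s :: nat \<Rightarrow> 'm.
        (\<forall>e>0. \<exists>K. \<forall>i\<ge>K. \<forall>j\<ge>K. intrinsic_dist F (s i) (s j) < ennreal e) \<longrightarrow>
        (\<exists>p. s \<longlonglongrightarrow> p))"


subsection \<open>Volume, spectrum\<close>

text \<open>
  The Riemannian measure \<open>d\<sigma>\<close> is the unique Borel measure that in each chart has density
  \<open>\<surd>det g\<close> with respect to Lebesgue measure.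
\<close>

definition volume_measure ::
  "('m::topological_space, 'n::finite) chart set \<Rightarrow> ('m \<Rightarrow> 'b::euclidean_space) \<Rightarrow> 'm measure \<Rightarrow> bool" where
  "volume_measure A F \<sigma> \<longleftrightarrow>
     sets \<sigma> = sets borel \<and>
     (\<forall>c\<in>A. \<forall>E\<in>sets borel. E \<subseteq> fst c \<longrightarrow>
        emeasure \<sigma> E =
          (\<integral>\<^sup>+y\<in>snd c ` E. ennreal (sqrt (det (metric_matrix (local_param F c) y))) \<partial>lborel))"

definition test_function ::
  "('m::{t2_space, second_countable_topology}, 'n::finite) chart set \<Rightarrow> ('m \<Rightarrow> real) \<Rightarrow> bool" where
  "test_function A \<phi> \<longleftrightarrow> smooth_map A \<phi> \<and> compact (closure {p. \<phi> p \<noteq> 0})"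

definition bottom_spectrum ::
  "('m::{t2_space, second_countable_topology}, 'n::finite) chart set
     \<Rightarrow> ('m \<Rightarrow> 'b::euclidean_space) \<Rightarrow> 'm measure \<Rightarrow> ereal" where
  "bottom_spectrum A F \<sigma> =
     Inf {ereal
            ((LINT p|\<sigma>. (grad_norm_sq A F \<phi> p - (second_ff_norm_sq A F p - 1 / 2) * (\<phi> p)\<^sup>2)
                 * exp ((norm (F p))\<^sup>2 / 4))
             / (LINT p|\<sigma>. (\<phi> p)\<^sup>2 * exp ((norm (F p))\<^sup>2 / 4)))
          |\<phi>. test_function A \<phi> \<and> (LINT p|\<sigma>. (\<phi> p)\<^sup>2 * exp ((norm (F p))\<^sup>2 / 4)) \<noteq> 0}"

text \<open>
  The integral as an extended real number; meaningful when the positive or the negative part of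
  \<open>f\<close> has finite integral.
\<close>

definition ext_integral :: "'a measure \<Rightarrow> ('a \<Rightarrow> real) \<Rightarrow> ereal" where
  "ext_integral M f =
     enn2ereal (\<integral>\<^sup>+x. ennreal (f x) \<partial>M) - enn2ereal (\<integral>\<^sup>+x. ennreal (- f x) \<partial>M)"

end

theory Submission
  imports Defs
begin

text \<open>
  Write \<open>\<rho> = |x|\<^sup>2 / 4\<close>. On a self-expander \<open>\<Delta>\<rho> = n/2 + H\<^sup>2\<close> and \<open>|\<nabla>\<rho>|\<^sup>2 = \<rho> - H\<^sup>2\<close>, so \<open>e\<^sup>-\<^sup>\<rho>\<close> is a positive
  function with \<open>- L e\<^sup>-\<^sup>\<rho> = ((n+1)/2 + Scal) e\<^sup>-\<^sup>\<rho>\<close>. Substituting \<open>\<phi> = u e\<^sup>-\<^sup>\<rho>\<close> turns the Rayleigh quotient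
  of \<open>L\<close> into that of \<open>\<integral> (|\<nabla>u|\<^sup>2 + ((n+1)/2 + Scal) u\<^sup>2) e\<^sup>-\<^sup>\<rho>\<close> with respect to \<open>\<integral> u\<^sup>2 e\<^sup>-\<^sup>\<rho>\<close>. Cut-off
  functions \<open>u\<close> tending to a constant give the upper bound; the bound on \<open>H\<close> is what makes \<open>\<rho> e\<^sup>-\<^sup>\<rho>\<close>
  integrable. Equality is the Euler-Lagrange equation of the constant, and if \<open>Scal\<close> is constant then
  the transformed quotient is bounded below by \<open>(n+1)/2 + Scal\<close> at once. The only global input is the
  divergence theorem for \<open>u \<nabla>\<rho>\<close>, obtained in charts and glued by a partition of unity.
\<close>

subsection \<open>Calculus of smooth maps\<close>

text \<open>The threshold \<open>1 / (2 * sqrt 2)\<close> comes from a single coefficient. Testing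
  the divergence identity with cut-offs times \<open>wt\<close> controls the integral of
  \<open>rho - 2 * H2\<close> against \<open>wt\<close>. Squaring the bound on the mean curvature
  gives \<open>H2 p \<le> \<theta> * rho p + C\<close> for any \<open>\<theta>\<close> above
  \<open>4 * a\<^sup>2\<close>, and \<open>1 - 2 * \<theta>\<close> can be kept positive exactly
  when \<open>a\<^sup>2 < 1 / 8\<close>. The obstacle is the second fundamental form, which the
  hypotheses do not bound. Its square becomes integrable against \<open>wt\<close> only through the
  spectrum: if \<open>\<mu>\<^sub>1\<close> is finite, a lower bound
  \<open>m * mass u u \<le> form u u\<close> on the cut-offs bounds their integrals of
  \<open>A2\<close>. Hence the split according to \<open>\<mu>\<^sub>1\<close>; when it is
  \<open>- \<infinity>\<close>, only the positive part of the scalar curvature has to have a finite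
  integral. The operator \<open>L\<close> is never formed. The identity for the ground state enters
  in integrated form, through the divergence of \<open>u\<^sup>2 * wt\<close> times the gradient of
  \<open>rho\<close>, so continuity of the curvature suffices and it is never
  differentiated.\<close>

lemma dir_deriv_eqI:
  assumes "(f has_derivative f') (at x)"
  shows "dir_deriv f v x = f' v"
  using frechet_derivative_at[OF assms] by (simp add: dir_deriv_def)

lemma dir_deriv_cong_open:
  assumes "open S" "x \<in> S" "\<And>y. y \<in> S \<Longrightarrow> f y = g y"
  shows "dir_deriv f v x = dir_deriv g v x"
proof -
  have "(f has_derivative D) (at x) \<longleftrightarrow> (g has_derivative D) (at x)" for D
    using has_derivative_transform_within_open[of f D x UNIV S g]
      has_derivative_transform_within_open[of g D x UNIV S f] assms by auto
  then show ?thesis by (simp add: dir_deriv_def frechet_derivative_def)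
qed

lemma differentiable_cong_open:
  assumes "open S" "x \<in> S" "\<And>y. y \<in> S \<Longrightarrow> f y = g y" "f differentiable (at x)"
  shows "g differentiable (at x)"
  using has_derivative_transform_within_open[of f _ x UNIV S g] assms
  unfolding differentiable_def by blast

lemma has_derivative_dir_deriv:
  assumes "f differentiable (at x)"
  shows "(f has_derivative (\<lambda>v. dir_deriv f v x)) (at x)"
  using assms frechet_derivative_works[of f "at x"] by (simp add: dir_deriv_def[abs_def] del: frechet_derivative_works)

text \<open>\<open>Ck_on\<close> takes derivatives \<open>at x\<close>, not within \<open>S\<close>;
  on an open set equality of values therefore passes to all derivatives.\<close>

lemma Ck_on_cong:
  assumes "open S" "\<And>x. x \<in> S \<Longrightarrow> f x = g x" "Ck_on k S f"
  shows "Ck_on k S g"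
  using assms(2,3)
proof (induction k arbitrary: f g)
  case 0
  then show ?case using continuous_on_cong[of S S f g] by simp
next
  case (Suc k)
  have "\<And>x v. x \<in> S \<Longrightarrow> dir_deriv f v x = dir_deriv g v x"
    using dir_deriv_cong_open[OF assms(1)] Suc.prems(1) by blast
  then have "Ck_on k S (dir_deriv g v)" for v
    using Suc.IH[of "dir_deriv f v" "dir_deriv g v"] Suc.prems by auto
  moreover have "g differentiable (at x)" if "x \<in> S" for x
    using differentiable_cong_open[OF assms(1) that, of f g] Suc.prems that by auto
  ultimately show ?case by auto
qed

lemma Ck_on_subset: "Ck_on k S f \<Longrightarrow> T \<subseteq> S \<Longrightarrow> Ck_on k T f"
  by (induction k arbitrary: f) (auto intro: continuous_on_subset)

lemma Ck_on_SucD: "Ck_on (Suc k) S f \<Longrightarrow> Ck_on k S f"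
proof (induction k arbitrary: f)
  case 0
  then show ?case
    by (auto intro!: continuous_at_imp_continuous_on differentiable_imp_continuous_within)
next
  case (Suc k)
  then have "Ck_on k S (dir_deriv f v)" for v by auto
  then show ?case using Suc.prems by auto
qed

lemma Ck_on_local:
  assumes "\<And>x. x \<in> S \<Longrightarrow> \<exists>T. open T \<and> x \<in> T \<and> Ck_on k T f"
  shows "Ck_on k S f"
  using assms
proof (induction k arbitrary: f)
  case 0
  have "isCont f x" if "x \<in> S" for x
    using 0[OF that] continuous_on_eq_continuous_at by auto
  then show ?case by (simp add: continuous_at_imp_continuous_on)
next
  case (Suc k)
  have "Ck_on k S (dir_deriv f v)" for v
    using Suc.prems by (intro Suc.IH) fastforce
  moreover have "f differentiable (at x)" if "x \<in> S" for x
    using Suc.prems[OF that] by auto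
  ultimately show ?case by auto
qed

lemma Ck_on_const: "Ck_on k S (\<lambda>x. c)"
proof (induction k arbitrary: c)
  case (Suc k)
  have "dir_deriv (\<lambda>x. c) v = (\<lambda>x. 0)" for v :: 'a
    by (rule ext, rule dir_deriv_eqI) (rule has_derivative_const)
  then show ?case using Suc by simp
qed simp

lemma Ck_on_bounded_linear:
  assumes "bounded_linear f"
  shows "Ck_on k S f"
proof (cases k)
  case 0
  then show ?thesis using assms by (simp add: linear_continuous_on)
next
  case (Suc m)
  have "dir_deriv f v = (\<lambda>x. f v)" for v
    by (rule ext, rule dir_deriv_eqI) (rule bounded_linear_imp_has_derivative[OF assms])
  then show ?thesis
    using Suc Ck_on_const bounded_linear_imp_differentiable[OF assms] by auto
qed

lemma Ck_on_add:
  assumes "open S" "Ck_on k S f" "Ck_on k S g"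
  shows "Ck_on k S (\<lambda>x. f x + g x)"
  using assms(2,3)
proof (induction k arbitrary: f g)
  case 0
  then show ?case by (simp add: continuous_on_add)
next
  case (Suc k)
  have d: "dir_deriv f v x + dir_deriv g v x = dir_deriv (\<lambda>x. f x + g x) v x" if "x \<in> S" for v x
    using Suc.prems that
    by (intro dir_deriv_eqI[symmetric] has_derivative_add has_derivative_dir_deriv) auto
  have "Ck_on k S (dir_deriv (\<lambda>x. f x + g x) v)" for v
    by (rule Ck_on_cong[OF assms(1) d]) (use Suc in auto)
  then show ?case using Suc.prems by auto
qed

text \<open>The Leibniz rule writes the derivative as a sum of two instances of the same
  \<open>B\<close>, so the induction varies \<open>f\<close> and \<open>g\<close> together.
  Products, scalings and inner products are all instances.\<close>

lemma Ck_on_bilinear: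
  assumes "bounded_bilinear B" "open S" "Ck_on k S f" "Ck_on k S g"
  shows "Ck_on k S (\<lambda>x. B (f x) (g x))"
  using assms(3,4)
proof (induction k arbitrary: f g)
  case 0
  then show ?case using bounded_bilinear.continuous_on[OF assms(1)] by simp
next
  case (Suc k)
  have D: "((\<lambda>x. B (f x) (g x)) has_derivative
      (\<lambda>v. B (f x) (dir_deriv g v x) + B (dir_deriv f v x) (g x))) (at x)" if "x \<in> S" for x
    using Suc.prems that
    by (intro bounded_bilinear.FDERIV[OF assms(1)] has_derivative_dir_deriv) auto
  have d: "B (f x) (dir_deriv g v x) + B (dir_deriv f v x) (g x) = dir_deriv (\<lambda>x. B (f x) (g x)) v x"
    if "x \<in> S" for v x
    using dir_deriv_eqI[OF D[OF that]] by simp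
  have "Ck_on k S (dir_deriv (\<lambda>x. B (f x) (g x)) v)" for v
    by (rule Ck_on_cong[OF assms(2) d], assumption, rule Ck_on_add[OF assms(2)])
      (use Suc.IH Ck_on_SucD[OF Suc.prems(1)] Ck_on_SucD[OF Suc.prems(2)] Suc.prems in \<open>simp_all\<close>)
  then show ?case using D unfolding Ck_on.simps(2) differentiable_def by blast
qed

lemma Ck_on_sum:
  assumes "open S" "\<And>i. i \<in> I \<Longrightarrow> Ck_on k S (f i)"
  shows "Ck_on k S (\<lambda>x. \<Sum>i\<in>I. f i x)"
  using assms(2)
  by (induction I rule: infinite_finite_induct) (auto intro: Ck_on_add[OF assms(1)] Ck_on_const)

text \<open>The chain rule differentiates \<open>g\<close> in the direction
  \<open>dir_deriv f v x\<close>, which moves with \<open>x\<close>, whereas \<open>Ck_on\<close>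
  speaks of fixed directions. Expanding this direction in \<open>Basis\<close> leaves only the fixed
  derivatives \<open>dir_deriv g b\<close>, to which the induction hypothesis applies.\<close>

lemma Ck_on_compose:
  fixes f :: "'a::euclidean_space \<Rightarrow> 'b::euclidean_space" and g :: "'b \<Rightarrow> 'c::euclidean_space"
  assumes "open S" "Ck_on k S f" "Ck_on k T g" "f ` S \<subseteq> T"
  shows "Ck_on k S (g \<circ> f)"
  using assms(2,3)
proof (induction k arbitrary: g)
  case 0
  then show ?case
    using assms(4) continuous_on_compose[of S f g] continuous_on_subset[of T g "f ` S"] by simp
next
  case (Suc k)
  have D: "((g \<circ> f) has_derivative ((\<lambda>w. dir_deriv g w (f x)) \<circ> (\<lambda>v. dir_deriv f v x))) (at x)"
    if "x \<in> S" for x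
    using Suc.prems that assms(4) by (intro diff_chain_at has_derivative_dir_deriv) auto
  have d: "(\<Sum>b\<in>Basis. (dir_deriv f v x \<bullet> b) *\<^sub>R (dir_deriv g b \<circ> f) x) = dir_deriv (g \<circ> f) v x"
    if "x \<in> S" for v x
  proof -
    have "linear (\<lambda>w. dir_deriv g w (f x))"
      using Suc.prems that assms(4)
      by (intro has_derivative_linear[OF has_derivative_dir_deriv]) auto
    moreover have "dir_deriv (g \<circ> f) v x
        = dir_deriv g (\<Sum>b\<in>Basis. (dir_deriv f v x \<bullet> b) *\<^sub>R b) (f x)"
      using dir_deriv_eqI[OF D[OF that]] by (simp add: euclidean_representation)
    ultimately show ?thesis
      by (simp add: linear_sum[of "\<lambda>w. dir_deriv g w (f x)"] linear_cmul[of "\<lambda>w. dir_deriv g w (f x)"])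
  qed
  have "Ck_on k S (dir_deriv (g \<circ> f) v)" for v
  proof (rule Ck_on_cong[OF assms(1) d])
    have "Ck_on k S (dir_deriv g b \<circ> f)" for b
      by (rule Suc.IH) (use Suc.prems Ck_on_SucD[OF Suc.prems(1)] in simp_all)
    moreover have "Ck_on k S (\<lambda>x. dir_deriv f v x \<bullet> b)" for b
      by (rule Ck_on_bilinear[OF bounded_bilinear_inner assms(1)]) (use Suc.prems Ck_on_const in auto)
    ultimately show "Ck_on k S (\<lambda>x. \<Sum>b\<in>Basis. (dir_deriv f v x \<bullet> b) *\<^sub>R (dir_deriv g b \<circ> f) x)"
      by (intro Ck_on_sum[OF assms(1)] Ck_on_bilinear[OF bounded_bilinear_scaleR assms(1)])
  qed
  then show ?case using D unfolding Ck_on.simps(2) differentiable_def by blast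
qed

lemma Ck_on_real_deriv:
  fixes f :: "real \<Rightarrow> real"
  assumes "open S" "\<And>x. x \<in> S \<Longrightarrow> (f has_real_derivative f' x) (at x)" "Ck_on k S f'"
  shows "Ck_on (Suc k) S f"
proof -
  have d: "f' x * v = dir_deriv f v x" if "x \<in> S" for x v
    using assms(2)[OF that] by (intro dir_deriv_eqI[symmetric]) (simp add: has_field_derivative_def)
  have "Ck_on k S (dir_deriv f v)" for v
    by (rule Ck_on_cong[OF assms(1) d])
      (assumption, rule Ck_on_bilinear[OF bounded_bilinear_mult assms(1,3) Ck_on_const])
  then show ?thesis
    using assms(2) by (auto simp: has_field_derivative_def differentiable_def)
qed

lemma smooth_onI: "(\<And>k. Ck_on k S f) \<Longrightarrow> smooth_on S f"
  by (simp add: smooth_on_def)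

lemma smooth_onD: "smooth_on S f \<Longrightarrow> Ck_on k S f"
  by (simp add: smooth_on_def)

lemma smooth_on_dir_deriv: "smooth_on S f \<Longrightarrow> smooth_on S (dir_deriv f v)"
  unfolding smooth_on_def by (rule allI, drule_tac x = "Suc k" in spec) simp

lemma smooth_on_coord_deriv: "smooth_on S f \<Longrightarrow> smooth_on S (coord_deriv f i)"
  by (simp add: coord_deriv_def smooth_on_dir_deriv)

lemma smooth_on_differentiable: "smooth_on S f \<Longrightarrow> x \<in> S \<Longrightarrow> f differentiable (at x)"
  using smooth_onD[of S f 1] by simp

lemma smooth_on_has_derivative:
  "smooth_on S f \<Longrightarrow> x \<in> S \<Longrightarrow> (f has_derivative (\<lambda>v. dir_deriv f v x)) (at x)"
  by (simp add: has_derivative_dir_deriv smooth_on_differentiable)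

lemma smooth_on_continuous_on: "smooth_on S f \<Longrightarrow> continuous_on S f"
  using smooth_onD[of S f 0] by simp

lemma smooth_on_cong:
  "open S \<Longrightarrow> (\<And>x. x \<in> S \<Longrightarrow> f x = g x) \<Longrightarrow> smooth_on S f \<Longrightarrow> smooth_on S g"
  unfolding smooth_on_def using Ck_on_cong by blast

lemma smooth_on_subset: "smooth_on S f \<Longrightarrow> T \<subseteq> S \<Longrightarrow> smooth_on T f"
  unfolding smooth_on_def using Ck_on_subset by blast

lemma smooth_on_local:
  "(\<And>x. x \<in> S \<Longrightarrow> \<exists>T. open T \<and> x \<in> T \<and> smooth_on T f) \<Longrightarrow> smooth_on S f"
  by (rule smooth_onI, rule Ck_on_local) (meson smooth_onD)

lemma smooth_on_const: "smooth_on S (\<lambda>x. c)"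
  by (simp add: smooth_on_def Ck_on_const)

lemma smooth_on_bounded_linear: "bounded_linear f \<Longrightarrow> smooth_on S f"
  by (simp add: smooth_on_def Ck_on_bounded_linear)

lemma smooth_on_add:
  "open S \<Longrightarrow> smooth_on S f \<Longrightarrow> smooth_on S g \<Longrightarrow> smooth_on S (\<lambda>x. f x + g x)"
  by (simp add: smooth_on_def Ck_on_add)

lemma smooth_on_sum:
  "open S \<Longrightarrow> (\<And>i. i \<in> I \<Longrightarrow> smooth_on S (f i)) \<Longrightarrow> smooth_on S (\<lambda>x. \<Sum>i\<in>I. f i x)"
  by (simp add: smooth_on_def Ck_on_sum)

lemma smooth_on_bilinear:
  assumes "bounded_bilinear B" "open S" "smooth_on S f" "smooth_on S g"
  shows "smooth_on S (\<lambda>x. B (f x) (g x))"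
  using assms by (simp add: smooth_on_def Ck_on_bilinear)

lemma smooth_on_mult:
  fixes f g :: "'a::euclidean_space \<Rightarrow> real"
  shows "open S \<Longrightarrow> smooth_on S f \<Longrightarrow> smooth_on S g \<Longrightarrow> smooth_on S (\<lambda>x. f x * g x)"
  by (rule smooth_on_bilinear[OF bounded_bilinear_mult])

lemma smooth_on_scaleR:
  "open S \<Longrightarrow> smooth_on S f \<Longrightarrow> smooth_on S g \<Longrightarrow> smooth_on S (\<lambda>x. f x *\<^sub>R g x)"
  by (rule smooth_on_bilinear[OF bounded_bilinear_scaleR])

lemma smooth_on_inner:
  "open S \<Longrightarrow> smooth_on S f \<Longrightarrow> smooth_on S g \<Longrightarrow> smooth_on S (\<lambda>x. f x \<bullet> g x)"
  by (rule smooth_on_bilinear[OF bounded_bilinear_inner])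

lemma smooth_on_diff:
  assumes "open S" "smooth_on S f" "smooth_on S g"
  shows "smooth_on S (\<lambda>x. f x - g x)"
  using smooth_on_add[OF assms(1,2) smooth_on_scaleR[OF assms(1) smooth_on_const[of S "-1"] assms(3)]]
  by simp

lemma smooth_on_compose:
  assumes "open S" "smooth_on S f" "smooth_on T g" "f ` S \<subseteq> T"
  shows "smooth_on S (g \<circ> f)"
  using assms by (auto simp: smooth_on_def intro: Ck_on_compose)

lemma smooth_on_prod:
  fixes f :: "'i \<Rightarrow> 'a::euclidean_space \<Rightarrow> real"
  shows "open S \<Longrightarrow> (\<And>i. i \<in> I \<Longrightarrow> smooth_on S (f i)) \<Longrightarrow> smooth_on S (\<lambda>x. \<Prod>i\<in>I. f i x)"
  by (induction I rule: infinite_finite_induct) (auto intro: smooth_on_mult smooth_on_const)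

text \<open>The functions \<open>exp\<close>, \<open>inverse\<close> and \<open>sqrt\<close> are all
  treated alike: each derivative is an expression in the function itself, so regularity of order
  \<open>k\<close> improves to \<open>Suc k\<close>.\<close>

lemma smooth_on_exp: "smooth_on S (exp :: real \<Rightarrow> real)"
proof -
  have "Ck_on k UNIV (exp :: real \<Rightarrow> real)" for k
  proof (induction k)
    case (Suc k)
    then show ?case by (intro Ck_on_real_deriv[where f' = exp] DERIV_exp) auto
  qed (auto intro!: continuous_intros)
  then show ?thesis using smooth_onI smooth_on_subset by blast
qed

lemma smooth_on_inverse_real: "smooth_on (- {0}) (inverse :: real \<Rightarrow> real)"
proof -
  have "Ck_on k (- {0}) (inverse :: real \<Rightarrow> real)" for k
  proof (induction k)
    case (Suc k)
    have "Ck_on k (- {0}) (\<lambda>x::real. (- 1) * (inverse x * inverse x))"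
      by (intro Ck_on_bilinear[OF bounded_bilinear_mult] Suc Ck_on_const) auto
    moreover have "(inverse has_real_derivative (- 1) * (inverse x * inverse x)) (at x)"
      if "x \<in> - {0}" for x :: real
      using that by (auto intro!: derivative_eq_intros)
    ultimately show ?case by (intro Ck_on_real_deriv) (simp_all add: open_Compl)
  qed (auto intro!: continuous_intros)
  then show ?thesis using smooth_onI by blast
qed

lemma smooth_on_sqrt: "smooth_on {0<..} sqrt"
proof -
  have "Ck_on k {0<..} sqrt" for k
  proof (induction k)
    case (Suc k)
    have "Ck_on k {0<..} (inverse \<circ> sqrt)"
      by (rule Ck_on_compose[OF _ Suc smooth_onD[OF smooth_on_inverse_real]]) auto
    then have "Ck_on k {0<..} (\<lambda>x. (inverse \<circ> sqrt) x * (1/2))"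
      by (rule Ck_on_bilinear[OF bounded_bilinear_mult open_greaterThan _ Ck_on_const])
    moreover have "(sqrt has_real_derivative (inverse \<circ> sqrt) x * (1/2)) (at x)"
      if "x \<in> {0<..}" for x
      using DERIV_real_sqrt[of x] that by (simp add: field_simps)
    ultimately show ?case by (intro Ck_on_real_deriv) simp_all
  qed (auto intro!: continuous_intros)
  then show ?thesis using smooth_onI by blast
qed

lemma smooth_on_inverse:
  fixes f :: "'a::euclidean_space \<Rightarrow> real"
  assumes "open S" "smooth_on S f" "\<And>x. x \<in> S \<Longrightarrow> f x \<noteq> 0"
  shows "smooth_on S (\<lambda>x. inverse (f x))"
proof -
  have "f ` S \<subseteq> - {0}" using assms(3) by auto
  from smooth_on_compose[OF assms(1,2) smooth_on_inverse_real this] show ?thesis by (simp add: o_def)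
qed

lemma smooth_on_divide:
  fixes f g :: "'a::euclidean_space \<Rightarrow> real"
  assumes "open S" "smooth_on S f" "smooth_on S g" "\<And>x. x \<in> S \<Longrightarrow> g x \<noteq> 0"
  shows "smooth_on S (\<lambda>x. f x / g x)"
  using smooth_on_mult[OF assms(1,2) smooth_on_inverse[OF assms(1,3,4)]] by (simp add: divide_inverse)

lemma smooth_on_real_compose:
  fixes f :: "'a::euclidean_space \<Rightarrow> real"
  assumes "open S" "smooth_on S f" "smooth_on UNIV g"
  shows "smooth_on S (\<lambda>x. g (f x))"
  using smooth_on_compose[OF assms] by (simp add: o_def)

lemma coord_deriv_eqI:
  "(f has_derivative f') (at x) \<Longrightarrow> coord_deriv f i x = f' (axis i 1)"
  by (simp add: coord_deriv_def dir_deriv_eqI)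

lemma dir_deriv_eq_sum_coord_deriv:
  assumes "f differentiable (at x)"
  shows "dir_deriv f v x = (\<Sum>i\<in>UNIV. (v $ i) *\<^sub>R coord_deriv f i x)"
proof -
  have "linear (\<lambda>w. dir_deriv f w x)"
    using has_derivative_linear[OF has_derivative_dir_deriv[OF assms]] .
  moreover have "dir_deriv f v x = dir_deriv f (\<Sum>i\<in>UNIV. (v $ i) *\<^sub>R axis i 1) x"
    using basis_expansion[of v] by (simp only: scalar_mult_eq_scaleR)
  ultimately show ?thesis
    by (simp add: linear_sum[of "\<lambda>w. dir_deriv f w x"] linear_cmul[of "\<lambda>w. dir_deriv f w x"] coord_deriv_def)
qed

lemma coord_deriv_bilinear:
  assumes "bounded_bilinear B" "f differentiable (at x)" "g differentiable (at x)"
  shows "coord_deriv (\<lambda>x. B (f x) (g x)) i x = B (f x) (coord_deriv g i x) + B (coord_deriv f i x) (g x)"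
  unfolding coord_deriv_def
  by (rule dir_deriv_eqI[OF bounded_bilinear.FDERIV[OF assms(1) has_derivative_dir_deriv[OF assms(2)]
        has_derivative_dir_deriv[OF assms(3)]]])


subsection \<open>Cut-off profile, integration by parts, second derivatives, determinants\<close>

text \<open>The family \<open>flat_exp m\<close> is closed under differentiation up to linear combinations, which gives smoothness.\<close>

definition flat_exp :: "nat \<Rightarrow> real \<Rightarrow> real" where
  "flat_exp m s = (if s > 0 then inverse s ^ m * exp (- inverse s) else 0)"

text \<open>With \<open>x = inverse s\<close> and \<open>M = m + 2\<close> this says
  \<open>x ^ M * exp (- x) \<le> M ^ M\<close>, which is \<open>y \<le> exp y\<close> at
  \<open>y = x / M\<close> raised to the power \<open>M\<close>. Quadratic decay is what makes the
  difference quotient at 0 vanish.\<close>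

lemma flat_exp_le_square:
  assumes "s > 0"
  shows "flat_exp m s \<le> real (m + 2) ^ (m + 2) * s\<^sup>2"
proof -
  define x M where "x = inverse s" and "M = m + 2"
  have x: "x > 0" using assms by (simp add: x_def)
  have "x / real M \<le> exp (x / real M)"
    using exp_ge_add_one_self[of "x / real M"] by linarith
  then have "(x / real M) ^ M \<le> exp (x / real M) ^ M"
    using x by (intro power_mono) auto
  also have "\<dots> = exp x" by (rule exp_divide_power_eq) (simp add: M_def)
  finally have "x ^ M \<le> real M ^ M * exp x"
    by (simp only: power_divide) (simp add: pos_divide_le_eq M_def mult.commute)
  then have "x ^ M * exp (- x) \<le> real M ^ M"
    by (simp add: exp_minus field_simps)
  then have "x ^ m * exp (- x) * x\<^sup>2 \<le> real M ^ M"
    by (simp add: M_def power_add mult_ac power2_eq_square)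
  then have "x ^ m * exp (- x) \<le> real M ^ M * (inverse x)\<^sup>2"
    using x by (simp add: power_inverse field_simps)
  then show ?thesis using assms by (simp add: flat_exp_def x_def M_def)
qed

lemma flat_exp_nonneg: "flat_exp m s \<ge> 0"
  by (simp add: flat_exp_def)

lemma flat_exp_deriv:
  "(flat_exp m has_real_derivative - real m * flat_exp (m + 1) s + flat_exp (m + 2) s) (at s)"
proof -
  consider "s > 0" | "s < 0" | "s = 0" by linarith
  then show ?thesis
  proof cases
    case 1
    have "((\<lambda>s. inverse s ^ m * exp (- inverse s)) has_real_derivative
        - real m * flat_exp (m + 1) s + flat_exp (m + 2) s) (at s)"
    proof -
      define x where "x = inverse s"
      have "((\<lambda>x. x ^ m * exp (- x)) has_real_derivative
          real m * x ^ (m - 1) * exp (- x) - x ^ m * exp (- x)) (at x)"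
        by (auto intro!: derivative_eq_intros)
      moreover have "(inverse has_real_derivative - (x\<^sup>2)) (at s)"
        using DERIV_inverse[of s UNIV] 1 by (simp add: x_def numeral_2_eq_2)
      ultimately have "((\<lambda>s. inverse s ^ m * exp (- inverse s)) has_real_derivative
          (real m * x ^ (m - 1) * exp (- x) - x ^ m * exp (- x)) * - (x\<^sup>2)) (at s)"
        unfolding x_def by (rule DERIV_chain2)
      \<comment> \<open>The case distinction on \<open>m\<close> is due to the truncated exponent
        \<open>m - 1\<close>; for \<open>m = 0\<close> the factor \<open>real m\<close> removes that
        term.\<close>
      moreover have "(real m * x ^ (m - 1) * exp (- x) - x ^ m * exp (- x)) * - (x\<^sup>2)
          = - real m * flat_exp (m + 1) s + flat_exp (m + 2) s"
        using 1 by (cases m) (simp_all add: flat_exp_def x_def[symmetric] algebra_simps power2_eq_square)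
      ultimately show ?thesis by simp
    qed
    then show ?thesis
      by (rule has_field_derivative_transform_within_open[where S = "{0<..}"])
        (use 1 in \<open>auto simp: flat_exp_def\<close>)
  next
    case 2
    have "((\<lambda>s. 0) has_real_derivative 0) (at s)" by simp
    then have "(flat_exp m has_real_derivative 0) (at s)"
      by (rule has_field_derivative_transform_within_open[where S = "{..<0}"])
        (use 2 in \<open>auto simp: flat_exp_def\<close>)
    then show ?thesis using 2 by (simp add: flat_exp_def)
  next
    \<comment> \<open>At the gluing point the difference quotient is
      \<open>flat_exp m h / h\<close>, of size at most \<open>C * \<bar>h\<bar>\<close> by the
      quadratic bound.\<close>
    case 3
    define C where "C = real (m + 2) ^ (m + 2)"
    have bound: "\<bar>flat_exp m h / h\<bar> \<le> C * \<bar>h\<bar>" for h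
    proof (cases "h > 0")
      case True
      then have "flat_exp m h \<le> (C * \<bar>h\<bar>) * h"
        using flat_exp_le_square[of h m] by (simp add: C_def power2_eq_square mult.assoc)
      then show ?thesis
        using True flat_exp_nonneg[of m h] by (simp add: pos_divide_le_eq)
    next
      case False
      have "0 \<le> C * \<bar>h\<bar>" by (intro mult_nonneg_nonneg) (simp_all add: C_def)
      then show ?thesis using False by (simp add: flat_exp_def)
    qed
    have "\<forall>\<^sub>F h in at 0. norm (flat_exp m h / h) \<le> C * \<bar>h\<bar>"
      unfolding real_norm_def by (rule always_eventually, rule allI, rule bound)
    moreover have "((\<lambda>h. C * \<bar>h\<bar>) \<longlongrightarrow> 0) (at 0)"
      by (rule tendsto_mult_right_zero[OF tendsto_rabs_zero[OF tendsto_ident_at]])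
    ultimately have "((\<lambda>h. flat_exp m h / h) \<longlongrightarrow> 0) (at 0)"
      by (rule Lim_null_comparison)
    then show ?thesis
      using 3 by (simp add: has_field_derivative_iff flat_exp_def)
  qed
qed

lemma smooth_on_flat_exp: "smooth_on UNIV (flat_exp m)"
proof (rule smooth_onI)
  show "Ck_on k UNIV (flat_exp m)" for k
  proof (induction k arbitrary: m)
    case 0
    have "isCont (flat_exp m) s" for s using DERIV_isCont[OF flat_exp_deriv] .
    then show ?case by (simp add: continuous_at_imp_continuous_on)
  next
    case (Suc k)
    have "Ck_on k UNIV (\<lambda>s. - real m * flat_exp (m + 1) s + flat_exp (m + 2) s)"
      by (intro Ck_on_add[OF open_UNIV] Ck_on_bilinear[OF bounded_bilinear_mult open_UNIV Ck_on_const] Suc.IH)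
    then show ?case by (rule Ck_on_real_deriv[OF open_UNIV flat_exp_deriv])
  qed
qed

text \<open>The classical flat function \<open>exp (- 1 / s)\<close>, without normalisation:
  cut-offs built from it rise to its value at 1 and not to 1, whence the constant \<open>s1\<close>
  in the limits.\<close>

definition smooth_step :: "real \<Rightarrow> real" where
  "smooth_step = flat_exp 0"

lemma smooth_step_pos_iff: "smooth_step s > 0 \<longleftrightarrow> s > 0"
  by (simp add: smooth_step_def flat_exp_def)

lemma smooth_step_nonneg: "smooth_step s \<ge> 0"
  by (simp add: smooth_step_def flat_exp_def)

lemma smooth_step_eq_0: "s \<le> 0 \<Longrightarrow> smooth_step s = 0"
  by (simp add: smooth_step_def flat_exp_def)

lemma smooth_step_deriv: "(smooth_step has_real_derivative flat_exp 2 s) (at s)"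
  using flat_exp_deriv[of 0 s] by (simp add: smooth_step_def numeral_2_eq_2)

lemma smooth_on_smooth_step: "smooth_on S smooth_step"
  using smooth_on_flat_exp smooth_on_subset unfolding smooth_step_def by blast

lemma smooth_step_mono: "s \<le> t \<Longrightarrow> smooth_step s \<le> smooth_step t"
  by (rule DERIV_nonneg_imp_nondecreasing) (use smooth_step_deriv flat_exp_nonneg in blast)+

text \<open>The constant is \<open>4 ^ 4\<close>, from \<open>flat_exp_le_square\<close> with
  \<open>m = 2\<close>.\<close>

lemma flat_exp_2_bounded: "s \<le> 1 \<Longrightarrow> flat_exp 2 s \<le> 256"
  using flat_exp_le_square[of s 2] power_le_one[of s 2]
  by (cases "s > 0") (auto simp: flat_exp_def)

section \<open>Directional derivatives with compact support integrate to zero\<close>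

lemma has_real_derivative_along_line:
  fixes h :: "'a::euclidean_space \<Rightarrow> real"
  assumes "h differentiable (at (y + s *\<^sub>R v))"
  shows "((\<lambda>s. h (y + s *\<^sub>R v)) has_real_derivative dir_deriv h v (y + s *\<^sub>R v)) (at s)"
proof -
  note dh = has_derivative_dir_deriv[OF assms]
  have "((\<lambda>s. y + s *\<^sub>R v) has_derivative (\<lambda>s. s *\<^sub>R v)) (at s)"
    by (auto intro!: derivative_eq_intros)
  from diff_chain_at[OF this dh]
  have "((\<lambda>s. h (y + s *\<^sub>R v)) has_derivative (\<lambda>t. dir_deriv h (t *\<^sub>R v) (y + s *\<^sub>R v))) (at s)"
    by (simp add: o_def)
  moreover have "dir_deriv h (t *\<^sub>R v) (y + s *\<^sub>R v) = dir_deriv h v (y + s *\<^sub>R v) * t" for t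
    using linear_cmul[OF has_derivative_linear[OF dh]] by simp
  ultimately show ?thesis by (simp add: has_field_derivative_def)
qed

text \<open>By translation invariance of Lebesgue measure every difference quotient along
  \<open>v\<close> has integral zero. Dominated convergence carries this to the derivative; the mean
  value theorem supplies both the uniform bound and the pointwise limit.\<close>

lemma integral_dir_deriv_compact_support:
  fixes h :: "'a::euclidean_space \<Rightarrow> real"
  assumes C1: "Ck_on 1 UNIV h" and K: "compact K" and supp: "\<And>y. y \<notin> K \<Longrightarrow> h y = 0"
  shows "integral\<^sup>L lborel (dir_deriv h v) = 0"
proof -
  have dh: "(h has_derivative (\<lambda>v. dir_deriv h v y)) (at y)" for y
    using C1 by (intro has_derivative_dir_deriv) simp
  have cont_d: "continuous_on UNIV (dir_deriv h v)" using C1 by simp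
  have cont_h: "continuous_on UNIV h"
    using C1 by (auto intro!: continuous_at_imp_continuous_on differentiable_imp_continuous_within)
  have d0: "dir_deriv h v y = 0" if "y \<notin> K" for y
  proof -
    have "dir_deriv h v y = dir_deriv (\<lambda>_. 0) v y"
      by (rule dir_deriv_cong_open[of "- K"]) (use that supp K compact_imp_closed in \<open>auto simp: open_Compl\<close>)
    then show ?thesis by (simp add: dir_deriv_eqI[OF has_derivative_const])
  qed
  have "compact ((\<lambda>y. \<bar>dir_deriv h v y\<bar>) ` K)"
    by (intro compact_continuous_image K continuous_on_rabs continuous_on_subset[OF cont_d]) auto
  from compact_imp_bounded[OF this, unfolded bounded_iff]
  obtain B where B0: "\<And>y. y \<in> K \<Longrightarrow> \<bar>dir_deriv h v y\<bar> \<le> B"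
    by (auto simp del: abs_idempotent)
  have B: "\<bar>dir_deriv h v y\<bar> \<le> max B 0" for y
  proof (cases "y \<in> K")
    case True
    then show ?thesis using B0[OF True] by linarith
  next
    case False
    show ?thesis unfolding d0[OF False] by simp
  qed
  obtain r where r: "\<And>y. y \<in> K \<Longrightarrow> norm y \<le> r"
    using compact_imp_bounded[OF K] unfolding bounded_iff by auto
  \<comment> \<open>The steps \<open>inverse (real (Suc n))\<close> are at most 1, so all quotients
    vanish outside one ball: the radius of \<open>K\<close> enlarged by
    \<open>norm v\<close>.\<close>
  define K' where "K' = cball (0::'a) (r + norm v)"
  define q where "q n y = (h (y + inverse (real (Suc n)) *\<^sub>R v) - h y) * real (Suc n)" for n y
  have line: "((\<lambda>s. h (y + s *\<^sub>R v)) has_real_derivative dir_deriv h v (y + s *\<^sub>R v)) (at s)" for y s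
    by (rule has_real_derivative_along_line) (use C1 in simp)
  have q_eq: "\<exists>s. 0 < s \<and> s < inverse (real (Suc n)) \<and> q n y = dir_deriv h v (y + s *\<^sub>R v)" for n y
    using MVT2[OF _ line, of 0 "inverse (real (Suc n))" y] by (auto simp: q_def field_simps)
  have q_bound: "\<bar>q n y\<bar> \<le> max B 0 * indicator K' y" for n y
  proof (cases "y \<in> K'")
    case True
    then show ?thesis using q_eq[of n y] B by auto
  next
    case False
    have "y + s *\<^sub>R v \<notin> K" if "0 < s" "s < inverse (real (Suc n))" for s
    proof
      assume "y + s *\<^sub>R v \<in> K"
      then have "norm (y + s *\<^sub>R v) \<le> r" by (rule r)
      moreover have "inverse (real (Suc n)) \<le> 1" by (simp add: inverse_eq_divide)
      then have "norm (s *\<^sub>R v) \<le> norm v"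
        using that by (simp add: mult_left_le_one_le)
      moreover have "norm y \<le> norm (y + s *\<^sub>R v) + norm (s *\<^sub>R v)"
        using norm_triangle_ineq4[of "y + s *\<^sub>R v" "s *\<^sub>R v"] by simp
      ultimately show False using False by (simp add: K'_def)
    qed
    then show ?thesis using q_eq[of n y] d0 False by auto
  qed
  have meas_h: "h \<in> borel_measurable lborel"
    using borel_measurable_continuous_onI[OF cont_h] by simp
  have int_h: "integrable lborel h"
  proof -
    have "integrable lborel (\<lambda>y. indicator K y *\<^sub>R h y)"
      by (rule borel_integrable_compact[OF K continuous_on_subset[OF cont_h]]) auto
    moreover have "(\<lambda>y. indicator K y *\<^sub>R h y) = h" using supp by (auto simp: indicator_def fun_eq_iff)
    ultimately show ?thesis by simp
  qed
  have q0: "integral\<^sup>L lborel (q n) = 0" for n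
  proof -
    let ?c = "inverse (real (Suc n)) *\<^sub>R v"
    have d: "lborel = distr lborel borel ((+) ?c)" by (simp add: lborel_distr_plus)
    have "integrable lborel (\<lambda>y. h (?c + y)) \<and> integral\<^sup>L lborel (\<lambda>y. h (?c + y)) = integral\<^sup>L lborel h"
      using integrable_distr_eq[of "(+) ?c" lborel borel h] integral_distr[of "(+) ?c" lborel borel h]
        meas_h int_h d by simp
    then show ?thesis using int_h unfolding q_def[abs_def] by (simp add: add.commute)
  qed
  have "(\<lambda>n. integral\<^sup>L lborel (q n)) \<longlonglongrightarrow> integral\<^sup>L lborel (dir_deriv h v)"
  proof (rule integral_dominated_convergence[where w = "\<lambda>y. max B 0 * indicator K' y"])
    show "dir_deriv h v \<in> borel_measurable lborel"
      using borel_measurable_continuous_onI[OF cont_d] by simp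
    have q_cont: "continuous_on UNIV (q n)" for n
      unfolding q_def by (intro continuous_intros continuous_on_compose2[OF cont_h]) auto
    show "q n \<in> borel_measurable lborel" for n
      using borel_measurable_continuous_onI[OF q_cont] by simp
    show "integrable lborel (\<lambda>y. max B 0 * indicator K' y)"
      using emeasure_lborel_cball_finite[of "0::'a" "r + norm v"] by (simp add: K'_def)
    show "AE y in lborel. norm (q n y) \<le> max B 0 * indicator K' y" for n
      using q_bound by simp
    show "AE y in lborel. (\<lambda>n. q n y) \<longlonglongrightarrow> dir_deriv h v y"
    proof (rule AE_I2)
      fix y
      obtain s where s: "\<And>n. 0 < s n \<and> s n < inverse (real (Suc n)) \<and> q n y = dir_deriv h v (y + s n *\<^sub>R v)"
        using q_eq[of _ y] by metis
      have "s \<longlonglongrightarrow> 0"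
        by (rule tendsto_sandwich[OF _ _ tendsto_const LIMSEQ_inverse_real_of_nat])
          (use s less_imp_le in \<open>auto intro!: always_eventually\<close>)
      then have "(\<lambda>n. y + s n *\<^sub>R v) \<longlonglongrightarrow> y"
        by (auto intro!: tendsto_eq_intros)
      then have "(\<lambda>n. dir_deriv h v (y + s n *\<^sub>R v)) \<longlonglongrightarrow> dir_deriv h v y"
        using cont_d continuous_on_tendsto_compose by fastforce
      then show "(\<lambda>n. q n y) \<longlonglongrightarrow> dir_deriv h v y" using s by simp
    qed
  qed
  then have "(\<lambda>n. 0) \<longlonglongrightarrow> integral\<^sup>L lborel (dir_deriv h v)" by (simp only: q0)
  then show ?thesis by (simp add: LIMSEQ_const_iff)
qed


section \<open>Symmetry of second derivatives\<close>

text \<open>Two uses of the mean value theorem: along \<open>u\<close> for the difference of two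
  parallel lines, then along \<open>v\<close> for \<open>dir_deriv f u\<close>. The left side of the
  identity is symmetric in \<open>u\<close> and \<open>v\<close>, the right side is not.\<close>

lemma second_difference_mvt:
  fixes f :: "'a::euclidean_space \<Rightarrow> real"
  assumes C2: "Ck_on 2 S f" and "s > 0" and sub: "cball x (s * (norm u + norm v)) \<subseteq> S"
  obtains y where "y \<in> cball x (s * (norm u + norm v))"
    "f (x + s *\<^sub>R u + s *\<^sub>R v) - f (x + s *\<^sub>R u) - f (x + s *\<^sub>R v) + f x
      = s\<^sup>2 * dir_deriv (dir_deriv f u) v y"
proof -
  have in_S: "x + (a *\<^sub>R u + b *\<^sub>R v) \<in> cball x (s * (norm u + norm v))"
    if "0 \<le> a" "a \<le> s" "0 \<le> b" "b \<le> s" for a b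
  proof -
    have "norm (a *\<^sub>R u + b *\<^sub>R v) \<le> a * norm u + b * norm v"
      using norm_triangle_ineq[of "a *\<^sub>R u" "b *\<^sub>R v"] that by simp
    also have "\<dots> \<le> s * norm u + s * norm v"
      using that by (intro add_mono mult_right_mono) auto
    finally have "norm (a *\<^sub>R u + b *\<^sub>R v) \<le> s * (norm u + norm v)" by (simp add: distrib_left)
    moreover have "dist x (x + w) = norm w" for w
      by (metis add_diff_cancel_left' dist_commute dist_norm)
    ultimately show ?thesis by simp
  qed
  have d1: "f differentiable (at y)" and d2: "dir_deriv f u differentiable (at y)" if "y \<in> S" for y
    using C2 that by (auto simp: numeral_2_eq_2)
  define \<phi> where "\<phi> \<sigma> = f ((x + s *\<^sub>R v) + \<sigma> *\<^sub>R u) - f (x + \<sigma> *\<^sub>R u)" for \<sigma>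
  have "(\<phi> has_real_derivative dir_deriv f u ((x + s *\<^sub>R v) + \<sigma> *\<^sub>R u) - dir_deriv f u (x + \<sigma> *\<^sub>R u)) (at \<sigma>)"
    if "0 \<le> \<sigma>" "\<sigma> \<le> s" for \<sigma>
    unfolding \<phi>_def
    by (intro DERIV_diff has_real_derivative_along_line d1)
      (use in_S[of \<sigma> s] in_S[of \<sigma> 0] that \<open>s > 0\<close> sub in \<open>auto simp: algebra_simps\<close>)
  from MVT2[OF \<open>s > 0\<close> this] obtain \<sigma> where \<sigma>: "0 < \<sigma>" "\<sigma> < s"
    "\<phi> s - \<phi> 0 = s * (dir_deriv f u ((x + s *\<^sub>R v) + \<sigma> *\<^sub>R u) - dir_deriv f u (x + \<sigma> *\<^sub>R u))"
    by auto
  have "((\<lambda>\<tau>. dir_deriv f u ((x + \<sigma> *\<^sub>R u) + \<tau> *\<^sub>R v)) has_real_derivative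
      dir_deriv (dir_deriv f u) v ((x + \<sigma> *\<^sub>R u) + \<tau> *\<^sub>R v)) (at \<tau>)"
    if "0 \<le> \<tau>" "\<tau> \<le> s" for \<tau>
    by (intro has_real_derivative_along_line d2)
      (use in_S[of \<sigma> \<tau>] that \<sigma> sub in \<open>auto simp: algebra_simps\<close>)
  from MVT2[OF \<open>s > 0\<close> this] obtain \<tau> where \<tau>: "0 < \<tau>" "\<tau> < s"
    "dir_deriv f u ((x + \<sigma> *\<^sub>R u) + s *\<^sub>R v) - dir_deriv f u (x + \<sigma> *\<^sub>R u)
      = s * dir_deriv (dir_deriv f u) v ((x + \<sigma> *\<^sub>R u) + \<tau> *\<^sub>R v)"
    by auto
  show ?thesis
  proof (rule that)
    show "(x + \<sigma> *\<^sub>R u) + \<tau> *\<^sub>R v \<in> cball x (s * (norm u + norm v))"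
      using in_S[of \<sigma> \<tau>] \<sigma> \<tau> by (simp add: add.assoc)
    have comm: "(x + s *\<^sub>R v) + \<rho> *\<^sub>R u = (x + \<rho> *\<^sub>R u) + s *\<^sub>R v" for \<rho> by simp
    have "\<phi> s - \<phi> 0 = s * (s * dir_deriv (dir_deriv f u) v ((x + \<sigma> *\<^sub>R u) + \<tau> *\<^sub>R v))"
      unfolding \<sigma>(3) comm \<tau>(3) ..
    then show "f (x + s *\<^sub>R u + s *\<^sub>R v) - f (x + s *\<^sub>R u) - f (x + s *\<^sub>R v) + f x
      = s\<^sup>2 * dir_deriv (dir_deriv f u) v ((x + \<sigma> *\<^sub>R u) + \<tau> *\<^sub>R v)"
      unfolding \<phi>_def comm by (simp add: power2_eq_square)
  qed
qed

text \<open>The symmetric second difference gives the two mixed derivatives equal values at two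
  points \<open>y\<close> and \<open>z\<close> close to \<open>x\<close>; continuity transfers this
  to \<open>x\<close>.\<close>

lemma dir_deriv_commute_real:
  fixes f :: "'a::euclidean_space \<Rightarrow> real"
  assumes "open S" "x \<in> S" and C2: "Ck_on 2 S f"
  shows "dir_deriv (dir_deriv f u) v x = dir_deriv (dir_deriv f v) u x"
proof (rule ccontr)
  assume ne: "\<not> ?thesis"
  \<comment> \<open>Half the supposed gap, so that two errors, each strictly below \<open>e\<close>,
    cannot bridge it.\<close>
  define e where "e = \<bar>dir_deriv (dir_deriv f u) v x - dir_deriv (dir_deriv f v) u x\<bar> / 2"
  have e: "e > 0" using ne by (simp add: e_def)
  have "isCont (dir_deriv (dir_deriv f u) v) x" for u v
  proof -
    have "continuous_on S (dir_deriv (dir_deriv f u) v)"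
      using C2 by (simp add: numeral_2_eq_2)
    then show ?thesis using continuous_on_eq_continuous_at[OF assms(1)] assms(2) by blast
  qed
  then obtain d1 d2 where d: "d1 > 0" "d2 > 0"
    "\<And>y. dist y x < d1 \<Longrightarrow> dist (dir_deriv (dir_deriv f u) v y) (dir_deriv (dir_deriv f u) v x) < e"
    "\<And>y. dist y x < d2 \<Longrightarrow> dist (dir_deriv (dir_deriv f v) u y) (dir_deriv (dir_deriv f v) u x) < e"
    using e unfolding continuous_at_eps_delta by meson
  obtain d3 where d3: "d3 > 0" "cball x d3 \<subseteq> S"
    using assms(1,2) open_contains_cball by blast
  \<comment> \<open>The summand 1 keeps \<open>L\<close> positive when both directions are
    zero.\<close>
  define L where "L = norm u + norm v + 1"
  have L: "L > 0" unfolding L_def by (simp add: add_nonneg_pos)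
  define s where "s = min d1 (min d2 d3) / (2 * L)"
  have s: "s > 0" using d d3 L by (simp add: s_def)
  have "s * (norm u + norm v) \<le> s * L" using s by (simp add: L_def)
  also have "\<dots> = min d1 (min d2 d3) / 2" using L by (simp add: s_def)
  finally have bound: "s * (norm u + norm v) < d1" "s * (norm u + norm v) < d2" "s * (norm u + norm v) \<le> d3"
    using d d3 by (auto simp: min_def split: if_splits)
  then have sub: "cball x (s * (norm u + norm v)) \<subseteq> S" "cball x (s * (norm v + norm u)) \<subseteq> S"
    using d3 by (auto simp: add.commute)
  obtain y where y: "y \<in> cball x (s * (norm u + norm v))"
    "f (x + s *\<^sub>R u + s *\<^sub>R v) - f (x + s *\<^sub>R u) - f (x + s *\<^sub>R v) + f x
      = s\<^sup>2 * dir_deriv (dir_deriv f u) v y"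
    using second_difference_mvt[OF C2 s sub(1)] by blast
  obtain z where z: "z \<in> cball x (s * (norm v + norm u))"
    "f (x + s *\<^sub>R v + s *\<^sub>R u) - f (x + s *\<^sub>R v) - f (x + s *\<^sub>R u) + f x
      = s\<^sup>2 * dir_deriv (dir_deriv f v) u z"
    using second_difference_mvt[OF C2 s sub(2)] by blast
  have comm: "x + s *\<^sub>R v + s *\<^sub>R u = x + s *\<^sub>R u + s *\<^sub>R v" by simp
  have "s\<^sup>2 * dir_deriv (dir_deriv f u) v y = s\<^sup>2 * dir_deriv (dir_deriv f v) u z"
    using y(2) z(2)[unfolded comm] by linarith
  then have "dir_deriv (dir_deriv f u) v y = dir_deriv (dir_deriv f v) u z" using s by simp
  moreover have "dist y x < d1" "dist z x < d2"
    using y(1) z(1) bound by (auto simp: dist_commute add.commute)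
  ultimately show False using d(3)[of y] d(4)[of z] by (simp add: e_def dist_real_def abs_if split: if_splits)
qed

lemma dir_deriv_inner_const:
  fixes f :: "'a::euclidean_space \<Rightarrow> 'b::euclidean_space"
  assumes "f differentiable (at x)"
  shows "dir_deriv (\<lambda>y. f y \<bullet> c) v x = dir_deriv f v x \<bullet> c"
  by (rule dir_deriv_eqI) (intro has_derivative_inner_left has_derivative_dir_deriv assms)

lemma dir_deriv_commute:
  fixes f :: "'a::euclidean_space \<Rightarrow> 'b::euclidean_space"
  assumes "open S" "x \<in> S" "smooth_on S f"
  shows "dir_deriv (dir_deriv f u) v x = dir_deriv (dir_deriv f v) u x"
proof (rule euclidean_eqI)
  fix b :: 'b
  have *: "dir_deriv (dir_deriv (\<lambda>y. f y \<bullet> b) u) v x = dir_deriv (dir_deriv f u) v x \<bullet> b" for u v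
  proof -
    have "dir_deriv (\<lambda>y. f y \<bullet> b) u y = dir_deriv f u y \<bullet> b" if "y \<in> S" for y
      by (rule dir_deriv_inner_const[OF smooth_on_differentiable[OF assms(3) that]])
    then have "dir_deriv (dir_deriv (\<lambda>y. f y \<bullet> b) u) v x = dir_deriv (\<lambda>y. dir_deriv f u y \<bullet> b) v x"
      by (rule dir_deriv_cong_open[OF assms(1,2)])
    also have "\<dots> = dir_deriv (dir_deriv f u) v x \<bullet> b"
      by (rule dir_deriv_inner_const[OF smooth_on_differentiable[OF smooth_on_dir_deriv[OF assms(3)] assms(2)]])
    finally show ?thesis .
  qed
  have "Ck_on 2 S (\<lambda>y. f y \<bullet> b)"
    by (rule smooth_onD[OF smooth_on_inner[OF assms(1,3) smooth_on_const]])
  from dir_deriv_commute_real[OF assms(1,2) this, of u v]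
  show "dir_deriv (dir_deriv f u) v x \<bullet> b = dir_deriv (dir_deriv f v) u x \<bullet> b"
    by (simp only: *)
qed

section \<open>Derivatives of determinants\<close>

text \<open>The product rule in the permutation expansion, regrouped by the row that is
  differentiated.\<close>

lemma has_derivative_det:
  fixes M :: "'a::real_normed_vector \<Rightarrow> real ^ 'n ^ 'n"
  assumes "\<And>i j. ((\<lambda>y. M y $ i $ j) has_derivative (\<lambda>h. M' h $ i $ j)) (at x)"
  shows "((\<lambda>y. det (M y)) has_derivative
    (\<lambda>h. \<Sum>i\<in>UNIV. det (\<chi> k. if k = i then M' h $ i else M x $ k))) (at x)"
proof -
  let ?P = "{p. p permutes (UNIV :: 'n set)}"
  have D: "((\<lambda>y. \<Sum>p\<in>?P. of_int (sign p) * (\<Prod>i\<in>UNIV. M y $ i $ p i)) has_derivative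
    (\<lambda>h. \<Sum>p\<in>?P. of_int (sign p) * (\<Sum>i\<in>UNIV. M' h $ i $ p i * (\<Prod>j\<in>UNIV - {i}. M x $ j $ p j)))) (at x)"
    by (intro has_derivative_sum has_derivative_mult_right has_derivative_prod assms)
  have P: "(\<Prod>k\<in>UNIV. (\<chi> k. if k = i then M' h $ i else M x $ k) $ k $ p k)
      = M' h $ i $ p i * (\<Prod>j\<in>UNIV - {i}. M x $ j $ p j)" for h i and p :: "'n \<Rightarrow> 'n"
    by (subst prod.remove[of UNIV i]) auto
  have "(\<Sum>p\<in>?P. of_int (sign p) * (\<Sum>i\<in>UNIV. M' h $ i $ p i * (\<Prod>j\<in>UNIV - {i}. M x $ j $ p j)))
     = (\<Sum>i\<in>UNIV. det (\<chi> k. if k = i then M' h $ i else M x $ k))" for h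
    unfolding det_def P sum_distrib_left by (rule sum.swap)
  then show ?thesis using D by (simp only: det_def[of "M _"])
qed

lemma matrix_inv_inverse:
  assumes "invertible M"
  shows "M ** matrix_inv M = mat 1 \<and> matrix_inv M ** M = mat 1"
  using someI_ex[OF assms[unfolded invertible_def]] by (simp add: matrix_inv_def)

text \<open>The new row is a combination of the rows of \<open>G\<close> with coefficients
  \<open>r v* matrix_inv G\<close>, and Cramer's lemma for rows reads off the one with index
  \<open>i\<close>. Combined with \<open>has_derivative_det\<close> this is Jacobi's
  formula.\<close>

lemma det_row_replace:
  fixes G :: "real ^ 'n ^ 'n"
  assumes "invertible G"
  shows "det (\<chi> k. if k = i then r else G $ k) = (\<Sum>k\<in>UNIV. r $ k * matrix_inv G $ k $ i) * det G"
proof -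
  define x where "x = r v* matrix_inv G"
  have inv: "matrix_inv G ** G = mat 1"
    using matrix_inv_inverse[OF assms] by blast
  have "x v* G = r v* (matrix_inv G ** G)"
    unfolding x_def by (rule vector_matrix_mul_assoc)
  then have r: "x v* G = r" by (simp add: inv)
  have rows: "row k G = G $ k" for k by (simp add: row_def)
  have "x v* G = (\<Sum>l\<in>UNIV. x $ l *s row l G)"
    by (simp add: vector_matrix_mult_def vec_eq_iff row_def mult.commute)
  then have "det (\<chi> k. if k = i then r else G $ k)
    = det (\<chi> k. if k = i then (\<Sum>l\<in>UNIV. x $ l *s row l G) else row k G)"
    unfolding r rows by (rule arg_cong[where f = "\<lambda>z. det (\<chi> k. if k = i then z else G $ k)"])
  also have "\<dots> = x $ i * det G" by (rule cramer_lemma_transpose)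
  also have "x $ i = (\<Sum>k\<in>UNIV. r $ k * matrix_inv G $ k $ i)"
    by (simp add: x_def vector_matrix_mult_def mult.commute)
  finally show ?thesis .
qed


subsection \<open>Local hypersurface geometry\<close>

text \<open>The segment from the identity to \<open>G\<close> consists of positive definite, hence
  invertible matrices, so the determinant cannot change sign along it.\<close>

lemma det_pos_of_positive_definite:
  fixes G :: "real ^ 'n ^ 'n"
  assumes pd: "\<And>v. v \<noteq> 0 \<Longrightarrow> (G *v v) \<bullet> v > 0"
  shows "det G > 0"
proof (rule ccontr)
  assume "\<not> det G > 0"
  define M where "M t = (1 - t) *\<^sub>R (mat 1 :: real ^ 'n ^ 'n) + t *\<^sub>R G" for t :: real
  have "continuous_on {0..1} (\<lambda>t. det (M t))"
    unfolding det_def M_def by (intro continuous_intros)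
  moreover have "det (M 1) \<le> 0" "0 \<le> det (M 0)"
    using \<open>\<not> det G > 0\<close> by (simp_all add: M_def)
  ultimately obtain t where t: "0 \<le> t" "t \<le> 1" "det (M t) = 0"
    using IVT2'[of "\<lambda>t. det (M t)" 1 0 0] by auto
  then have "\<not> invertible (M t)" by (simp add: invertible_det_nz)
  then obtain v where v: "M t *v v = 0" "v \<noteq> 0"
    by (meson invertible_left_inverse matrix_left_invertible_ker)
  have "(M t *v v) \<bullet> v = (1 - t) * (v \<bullet> v) + t * ((G *v v) \<bullet> v)"
    by (simp add: M_def matrix_vector_mult_add_rdistrib scaleR_matrix_vector_assoc[symmetric] inner_add_left)
  moreover have "\<dots> > 0"
  proof (cases "t = 0")
    case True
    then show ?thesis using v by simp
  next
    case False
    then have "t * ((G *v v) \<bullet> v) > 0" using t pd[OF v(2)] by simp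
    moreover have "(1 - t) * (v \<bullet> v) \<ge> 0" using t by simp
    ultimately show ?thesis by linarith
  qed
  ultimately show False using v(1) by simp
qed

lemma smooth_on_det:
  fixes M :: "'a::euclidean_space \<Rightarrow> real ^ 'n ^ 'n"
  assumes "open S" "\<And>i j. smooth_on S (\<lambda>y. M y $ i $ j)"
  shows "smooth_on S (\<lambda>y. det (M y))"
  unfolding det_def
  by (intro smooth_on_sum smooth_on_mult smooth_on_prod smooth_on_const assms)

text \<open>Entries of the inverse as quotients of determinants: this form makes the inverse metric
  visibly smooth.\<close>

lemma matrix_inv_entry_cramer:
  fixes G :: "real ^ 'n ^ 'n"
  assumes "det G \<noteq> 0"
  shows "matrix_inv G $ i $ j = det (\<chi> k l. if l = i then axis j 1 $ k else G $ k $ l) / det G"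
proof -
  have "invertible G" using assms by (simp add: invertible_det_nz)
  then have "G *v (matrix_inv G *v axis j 1) = axis j 1"
    using matrix_inv_inverse[of G] by (simp add: matrix_vector_mul_assoc)
  then have "matrix_inv G *v axis j 1
      = (\<chi> i. det (\<chi> k l. if l = i then axis j 1 $ k else G $ k $ l) / det G)"
    using cramer[OF assms] by blast
  moreover have "(matrix_inv G *v axis j 1) $ i = matrix_inv G $ i $ j"
    by (simp add: matrix_vector_mult_basis column_def)
  ultimately show ?thesis by simp
qed

lemma normal_part_eqI:
  assumes T: "subspace T" and "w \<in> T\<^sup>\<bottom>" "v - w \<in> T"
  shows "normal_part T v = w"
  unfolding normal_part_def
proof (rule the_equality)
  fix w' assume w': "w' \<in> T\<^sup>\<bottom> \<and> v - w' \<in> T"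
  have "(v - w') - (v - w) \<in> T" using T w' assms(3) subspace_diff by blast
  then have "w - w' \<in> T" by simp
  moreover have "w - w' \<in> T\<^sup>\<bottom>"
    using w' assms(2) subspace_diff[OF subspace_orthogonal_comp] by blast
  ultimately have "(w - w') \<bullet> (w - w') = 0"
    by (auto simp: orthogonal_comp_def orthogonal_def)
  then show "w' = w" by simp
qed (use assms in auto)

lemma coord_deriv_sum:
  assumes "\<And>k. k \<in> K \<Longrightarrow> f k differentiable (at x)"
  shows "coord_deriv (\<lambda>x. \<Sum>k\<in>K. f k x) i x = (\<Sum>k\<in>K. coord_deriv (f k) i x)"
  unfolding coord_deriv_def
  by (rule dir_deriv_eqI, rule has_derivative_sum, rule has_derivative_dir_deriv) (rule assms)

lemma coord_deriv_diff:
  assumes "f differentiable (at x)" "g differentiable (at x)"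
  shows "coord_deriv (\<lambda>x. f x - g x) i x = coord_deriv f i x - coord_deriv g i x"
  unfolding coord_deriv_def
  by (rule dir_deriv_eqI, rule has_derivative_diff) (rule has_derivative_dir_deriv, rule assms)+

lemma coord_deriv_cong_open:
  assumes "open S" "x \<in> S" "\<And>y. y \<in> S \<Longrightarrow> f y = g y"
  shows "coord_deriv f i x = coord_deriv g i x"
  unfolding coord_deriv_def by (rule dir_deriv_cong_open[OF assms])

lemma coord_deriv_real_compose:
  fixes u :: "real ^ 'n \<Rightarrow> real"
  assumes "u differentiable (at x)" "(g has_real_derivative g') (at (u x))"
  shows "coord_deriv (\<lambda>x. g (u x)) i x = g' * coord_deriv u i x"
proof -
  have "(g has_derivative (*) g') (at (u x))" using assms(2) by (simp add: has_field_derivative_def)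
  from diff_chain_at[OF has_derivative_dir_deriv[OF assms(1)] this]
  show ?thesis unfolding coord_deriv_def o_def by (rule dir_deriv_eqI)
qed

lemmas coord_deriv_mult = coord_deriv_bilinear[OF bounded_bilinear_mult]
  and coord_deriv_scaleR = coord_deriv_bilinear[OF bounded_bilinear_scaleR]
  and coord_deriv_inner = coord_deriv_bilinear[OF bounded_bilinear_inner]

text \<open>Models one chart. The dimension of the target is left free; codimension one enters only
  in \<open>inner_unit_normal_sq\<close>.\<close>

locale local_immersion =
  fixes S :: "(real ^ 'n::finite) set" and X :: "real ^ 'n \<Rightarrow> 'b::euclidean_space"
  assumes open_dom: "open S"
    and smooth: "smooth_on S X"
    and immersive: "\<And>y. y \<in> S \<Longrightarrow> inj (frechet_derivative X (at y))"
begin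

abbreviation "D i \<equiv> coord_deriv X i"
abbreviation "g y i j \<equiv> metric_matrix X y $ i $ j"
abbreviation "gi y i j \<equiv> inv_metric X y $ i $ j"

lemma g_eq: "g y i j = D i y \<bullet> D j y"
  by (simp add: metric_matrix_def)

lemma frechet_eq_sum:
  assumes "y \<in> S"
  shows "frechet_derivative X (at y) v = (\<Sum>i\<in>UNIV. v $ i *\<^sub>R D i y)"
  using dir_deriv_eq_sum_coord_deriv[OF smooth_on_differentiable[OF smooth assms]]
  by (simp add: dir_deriv_def)

lemma metric_quadratic:
  assumes "y \<in> S"
  shows "(metric_matrix X y *v v) \<bullet> v = (norm (frechet_derivative X (at y) v))\<^sup>2"
proof -
  have "(metric_matrix X y *v v) \<bullet> v = (\<Sum>i\<in>UNIV. \<Sum>j\<in>UNIV. v $ i * v $ j * (D i y \<bullet> D j y))"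
    by (simp add: inner_vec_def matrix_vector_mult_def g_eq sum_distrib_left mult_ac)
  also have "\<dots> = (\<Sum>i\<in>UNIV. v $ i *\<^sub>R D i y) \<bullet> (\<Sum>j\<in>UNIV. v $ j *\<^sub>R D j y)"
    by (simp add: inner_sum_left inner_sum_right sum_distrib_left mult.assoc, subst sum.swap, simp add: mult_ac)
  finally show ?thesis by (simp add: frechet_eq_sum[OF assms] dot_square_norm)
qed

lemma det_metric_pos:
  assumes "y \<in> S"
  shows "det (metric_matrix X y) > 0"
proof (rule det_pos_of_positive_definite)
  fix v :: "real ^ 'n" assume "v \<noteq> 0"
  moreover have "frechet_derivative X (at y) 0 = 0" by (simp add: frechet_eq_sum[OF assms])
  ultimately have "frechet_derivative X (at y) v \<noteq> 0"
    using immersive[OF assms] by (metis injD)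
  then show "(metric_matrix X y *v v) \<bullet> v > 0" by (simp add: metric_quadratic[OF assms])
qed

lemma invertible_metric: "y \<in> S \<Longrightarrow> invertible (metric_matrix X y)"
  using det_metric_pos[of y] by (simp add: invertible_det_nz)

lemma inv_metric_inverse:
  assumes "y \<in> S"
  shows "metric_matrix X y ** inv_metric X y = mat 1" "inv_metric X y ** metric_matrix X y = mat 1"
  using matrix_inv_inverse[OF invertible_metric[OF assms]] by (simp_all add: inv_metric_def)

lemma transpose_inv_metric:
  assumes "y \<in> S"
  shows "transpose (inv_metric X y) = inv_metric X y"
proof -
  have "transpose (metric_matrix X y) = metric_matrix X y"
    by (simp add: transpose_def metric_matrix_def vec_eq_iff inner_commute)
  then have "transpose (inv_metric X y) ** metric_matrix X y = mat 1"
    using arg_cong[OF inv_metric_inverse(1)[OF assms], of transpose]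
    by (simp add: matrix_transpose_mul transpose_mat)
  then have "(transpose (inv_metric X y) ** metric_matrix X y) ** inv_metric X y = inv_metric X y"
    by simp
  then show ?thesis by (simp add: matrix_mul_assoc[symmetric] inv_metric_inverse[OF assms])
qed

lemma gi_sym: "y \<in> S \<Longrightarrow> gi y i j = gi y j i"
  using arg_cong[OF transpose_inv_metric[of y], of "\<lambda>M. M $ j $ i"] by (simp add: transpose_def)

lemma sum_gi_g:
  assumes "y \<in> S"
  shows "(\<Sum>k\<in>UNIV. gi y i k * g y k j) = (if i = j then 1 else 0)"
proof -
  have "(inv_metric X y ** metric_matrix X y) $ i $ j = mat 1 $ i $ j"
    by (simp add: inv_metric_inverse[OF assms])
  then show ?thesis by (simp add: matrix_matrix_mult_def mat_def)
qed

lemma sum_gi_g':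
  assumes "y \<in> S"
  shows "(\<Sum>k\<in>UNIV. gi y i k * g y j k) = (if i = j then 1 else 0)"
  using sum_gi_g[OF assms, of i j] by (simp add: g_eq inner_commute)

lemma tangent_space_eq:
  assumes "y \<in> S"
  shows "tangent_space X y = {\<Sum>i\<in>UNIV. v $ i *\<^sub>R D i y |v. True}"
  by (auto simp: tangent_space_def frechet_eq_sum[OF assms])

lemma subspace_tangent_space:
  assumes "y \<in> S"
  shows "subspace (tangent_space X y)"
proof -
  have "linear (frechet_derivative X (at y))"
    using has_derivative_linear smooth_on_differentiable[OF smooth assms] frechet_derivative_works by blast
  then show ?thesis unfolding tangent_space_def by (simp add: linear_subspace_image)
qed

lemma D_in_tangent_space:
  assumes "y \<in> S"
  shows "D i y \<in> tangent_space X y"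
proof -
  have "D i y = frechet_derivative X (at y) (axis i 1)" by (simp add: coord_deriv_def dir_deriv_def)
  then show ?thesis by (simp add: tangent_space_def)
qed

lemma mem_orthogonal_iff:
  assumes "y \<in> S"
  shows "w \<in> (tangent_space X y)\<^sup>\<bottom> \<longleftrightarrow> (\<forall>i. w \<bullet> D i y = 0)"
proof
  assume "w \<in> (tangent_space X y)\<^sup>\<bottom>"
  then show "\<forall>i. w \<bullet> D i y = 0"
    using D_in_tangent_space[OF assms]
    by (auto simp: orthogonal_comp_def orthogonal_def inner_commute[of w])
next
  assume "\<forall>i. w \<bullet> D i y = 0"
  then show "w \<in> (tangent_space X y)\<^sup>\<bottom>"
    by (auto simp: orthogonal_comp_def orthogonal_def tangent_space_eq[OF assms] inner_sum_left inner_commute[of _ w] inner_sum_right)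
qed

text \<open>The subtracted term is the tangential projection, with coefficients raised by the
  inverse metric. The formula replaces the definite description by an expression that is linear in
  \<open>v\<close> and smooth in \<open>y\<close>.\<close>

lemma normal_part_eq:
  assumes "y \<in> S"
  shows "normal_part (tangent_space X y) v
    = v - (\<Sum>j\<in>UNIV. (\<Sum>i\<in>UNIV. gi y i j * (v \<bullet> D i y)) *\<^sub>R D j y)" (is "_ = v - ?p")
proof (rule normal_part_eqI[OF subspace_tangent_space[OF assms]])
  have "?p \<bullet> D k y = v \<bullet> D k y" for k
  proof -
    have "?p \<bullet> D k y = (\<Sum>j\<in>UNIV. \<Sum>i\<in>UNIV. gi y i j * g y j k * (v \<bullet> D i y))"
      by (simp add: inner_sum_left sum_distrib_left g_eq mult_ac)
    also have "\<dots> = (\<Sum>i\<in>UNIV. (\<Sum>j\<in>UNIV. gi y i j * g y j k) * (v \<bullet> D i y))"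
      by (subst sum.swap) (simp add: sum_distrib_right)
    also have "\<dots> = v \<bullet> D k y"
      by (simp add: sum_gi_g[OF assms] if_distrib[of "\<lambda>x. x * _"] cong: if_cong)
    finally show ?thesis .
  qed
  then show "v - ?p \<in> (tangent_space X y)\<^sup>\<bottom>"
    by (simp add: mem_orthogonal_iff[OF assms] inner_diff_left)
  show "v - (v - ?p) \<in> tangent_space X y"
    unfolding diff_diff_eq2 add_diff_cancel_left'
    by (intro subspace_sum subspace_scale subspace_tangent_space D_in_tangent_space assms)
qed

lemma normal_part_orthogonal:
  assumes "y \<in> S"
  shows "normal_part (tangent_space X y) v \<bullet> D i y = 0"
proof -
  have "\<exists>p\<in>tangent_space X y. \<exists>w\<in>(tangent_space X y)\<^sup>\<bottom>. v = p + w"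
    using subspace_sum_orthogonal_comp[OF subspace_tangent_space[OF assms]]
    by (metis UNIV_I set_plus_elim)
  then obtain w where "w \<in> (tangent_space X y)\<^sup>\<bottom>" "v - w \<in> tangent_space X y" by auto
  then show ?thesis
    using normal_part_eqI[OF subspace_tangent_space[OF assms]] mem_orthogonal_iff[OF assms] by metis
qed

lemma inner_normal_part:
  assumes "y \<in> S" "\<And>i. w \<bullet> D i y = 0"
  shows "w \<bullet> normal_part (tangent_space X y) v = w \<bullet> v"
  by (simp add: normal_part_eq[OF assms(1)] inner_diff_right inner_sum_right assms(2))

lemma smooth_D: "smooth_on S (D i)"
  by (rule smooth_on_coord_deriv[OF smooth])

lemma smooth_DD: "smooth_on S (coord_deriv (D j) i)"
  by (rule smooth_on_coord_deriv[OF smooth_D])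

lemma smooth_g: "smooth_on S (\<lambda>y. g y i j)"
  unfolding g_eq by (rule smooth_on_inner[OF open_dom smooth_D smooth_D])

lemma smooth_gi: "smooth_on S (\<lambda>y. gi y i j)"
proof (rule smooth_on_cong[OF open_dom])
  show "det (\<chi> k l. if l = i then axis j 1 $ k else g y k l) / det (metric_matrix X y) = gi y i j"
    if "y \<in> S" for y
    using matrix_inv_entry_cramer[of "metric_matrix X y" i j] det_metric_pos[OF that]
    by (simp add: inv_metric_def)
  have "smooth_on S (\<lambda>y. (\<chi> k l. if l = i then axis j 1 $ k else g y k l) $ a $ b)" for a b
    by (cases "b = i") (simp_all add: smooth_on_const smooth_g)
  then show "smooth_on S (\<lambda>y. det (\<chi> k l. if l = i then axis j 1 $ k else g y k l) / det (metric_matrix X y))"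
    using det_metric_pos by (intro smooth_on_divide smooth_on_det open_dom smooth_g) force+
qed

definition W :: "real ^ 'n \<Rightarrow> real" where
  "W y = sqrt (det (metric_matrix X y))"

lemma smooth_W: "smooth_on S W"
proof -
  have "smooth_on S (sqrt \<circ> (\<lambda>y. det (metric_matrix X y)))"
    by (rule smooth_on_compose[OF open_dom smooth_on_det[OF open_dom smooth_g] smooth_on_sqrt])
      (use det_metric_pos in auto)
  then show ?thesis by (simp add: W_def[abs_def] o_def)
qed

text \<open>Jacobi's formula for the metric. Symmetry of the inverse metric merges the two product
  rule terms, and the resulting factor 2 cancels the 1/2 from the square root.\<close>

lemma coord_deriv_W:
  assumes "y \<in> S"
  shows "coord_deriv W l y = W y * (\<Sum>i\<in>UNIV. \<Sum>k\<in>UNIV. gi y i k * (coord_deriv (D i) l y \<bullet> D k y))"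
proof -
  let ?G = "metric_matrix X y" and ?e = "axis l 1 :: real ^ 'n"
  define M' where "M' h = (\<chi> i j. dir_deriv (\<lambda>y. g y i j) h y)" for h
  have entry: "M' ?e $ i $ k = D i y \<bullet> coord_deriv (D k) l y + coord_deriv (D i) l y \<bullet> D k y" for i k
  proof -
    have "M' ?e $ i $ k = coord_deriv (\<lambda>y. D i y \<bullet> D k y) l y"
      by (simp add: M'_def coord_deriv_def g_eq)
    then show ?thesis
      by (simp add: coord_deriv_inner smooth_on_differentiable[OF smooth_D assms])
  qed
  have "((\<lambda>y. det (metric_matrix X y)) has_derivative
      (\<lambda>h. \<Sum>i\<in>UNIV. det (\<chi> k. if k = i then M' h $ i else ?G $ k))) (at y)"
    by (rule has_derivative_det)
      (simp add: M'_def smooth_on_has_derivative[OF smooth_g assms])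
  then have "coord_deriv (\<lambda>y. det (metric_matrix X y)) l y
      = (\<Sum>i\<in>UNIV. (\<Sum>k\<in>UNIV. M' ?e $ i $ k * gi y k i) * det ?G)"
    by (simp add: coord_deriv_eqI det_row_replace[OF invertible_metric[OF assms]] inv_metric_def)
  also have "\<dots> = det ?G * (\<Sum>i\<in>UNIV. \<Sum>k\<in>UNIV. gi y i k * (D i y \<bullet> coord_deriv (D k) l y)
      + gi y i k * (coord_deriv (D i) l y \<bullet> D k y))"
    by (simp add: entry sum_distrib_left sum_distrib_right gi_sym[OF assms, of _ "_"] algebra_simps)
  also have "\<dots> = det ?G * (2 * (\<Sum>i\<in>UNIV. \<Sum>k\<in>UNIV. gi y i k * (coord_deriv (D i) l y \<bullet> D k y)))"
  proof -
    have "(\<Sum>i\<in>UNIV. \<Sum>k\<in>UNIV. gi y i k * (D i y \<bullet> coord_deriv (D k) l y))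
        = (\<Sum>i\<in>UNIV. \<Sum>k\<in>UNIV. gi y i k * (coord_deriv (D i) l y \<bullet> D k y))"
      by (subst sum.swap) (simp add: gi_sym[OF assms] inner_commute)
    then show ?thesis by (simp add: sum.distrib)
  qed
  finally have dd: "coord_deriv (\<lambda>y. det (metric_matrix X y)) l y
      = det ?G * (2 * (\<Sum>i\<in>UNIV. \<Sum>k\<in>UNIV. gi y i k * (coord_deriv (D i) l y \<bullet> D k y)))" .
  have "coord_deriv W l y = (inverse (sqrt (det ?G)) / 2) * coord_deriv (\<lambda>y. det (metric_matrix X y)) l y"
    unfolding W_def[abs_def]
    by (rule coord_deriv_real_compose[OF smooth_on_differentiable[OF smooth_on_det[OF open_dom smooth_g] assms]
          DERIV_real_sqrt[OF det_metric_pos[OF assms]]])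
  also have "\<dots> = (inverse (sqrt (det ?G)) * det ?G) * (\<Sum>i\<in>UNIV. \<Sum>k\<in>UNIV. gi y i k * (coord_deriv (D i) l y \<bullet> D k y))"
    unfolding dd by simp
  also have "inverse (sqrt (det ?G)) * det ?G = W y"
    using det_metric_pos[OF assms] by (simp add: W_def field_simps)
  finally show ?thesis .
qed

section \<open>Divergence of the tangential part of half the position vector\<close>

text \<open>Coordinates of the tangential part of \<open>X / 2\<close>, which is the gradient of
  \<open>(norm (X y))\<^sup>2 / 4\<close>.\<close>

definition V :: "'n \<Rightarrow> real ^ 'n \<Rightarrow> real" where
  "V j y = (\<Sum>i\<in>UNIV. gi y i j * (X y \<bullet> D i y)) / 2"

text \<open>The normal part of \<open>X / 2\<close>, written without \<open>normal_part\<close> so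
  that it can be differentiated. On a self-expander it is the mean curvature vector.\<close>

definition nu :: "real ^ 'n \<Rightarrow> 'b" where
  "nu y = (1/2) *\<^sub>R X y - (\<Sum>j\<in>UNIV. V j y *\<^sub>R D j y)"

lemma nu_eq_normal_part:
  assumes "y \<in> S"
  shows "nu y = (1/2) *\<^sub>R normal_part (tangent_space X y) (X y)"
  by (simp add: nu_def V_def normal_part_eq[OF assms] scaleR_diff_right scaleR_sum_right)

lemma nu_orthogonal: "y \<in> S \<Longrightarrow> nu y \<bullet> D k y = 0"
  by (simp add: nu_eq_normal_part normal_part_orthogonal)

lemma smooth_V: "smooth_on S (V j)"
proof -
  have "smooth_on S (\<lambda>y. (\<Sum>i\<in>UNIV. gi y i j * (X y \<bullet> D i y)) * (1/2))"
    by (intro smooth_on_mult smooth_on_sum smooth_on_inner smooth_on_const smooth_gi smooth smooth_D open_dom)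
  then show ?thesis by (simp add: V_def[abs_def])
qed

lemma smooth_nu: "smooth_on S nu"
  unfolding nu_def[abs_def]
  by (intro smooth_on_diff smooth_on_sum smooth_on_scaleR smooth_on_const smooth_V smooth smooth_D open_dom)

definition H_vec :: "real ^ 'n \<Rightarrow> 'b" where
  "H_vec y = (\<Sum>i\<in>UNIV. \<Sum>j\<in>UNIV. gi y i j *\<^sub>R second_ff X y i j)"

lemma DD_commute: "y \<in> S \<Longrightarrow> coord_deriv (D j) i y = coord_deriv (D i) j y"
  unfolding coord_deriv_def by (rule dir_deriv_commute[OF open_dom _ smooth])

text \<open>
  Differentiating \<open>X / 2 = \<Sum>\<^sub>j V\<^sup>j X\<^sub>j + \<nu>\<close> and taking the trace of the tangential part expresses
  the divergence of \<open>V\<close> without differentiating the inverse metric.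
\<close>

lemma divergence_V:
  assumes y: "y \<in> S"
  shows "(\<Sum>j\<in>UNIV. coord_deriv (\<lambda>y. W y * V j y) j y) = W y * (real CARD('n) / 2 + nu y \<bullet> H_vec y)"
proof -
  note diff = smooth_on_differentiable[OF _ y]
  have X_split: "coord_deriv nu i y = (1/2) *\<^sub>R D i y
      - (\<Sum>j\<in>UNIV. V j y *\<^sub>R coord_deriv (D j) i y + coord_deriv (V j) i y *\<^sub>R D j y)" for i
  proof -
    have dV: "(\<lambda>y. V j y *\<^sub>R D j y) differentiable (at y)" for j
      by (rule diff, rule smooth_on_scaleR[OF open_dom smooth_V smooth_D])
    have "coord_deriv (\<lambda>y. (1/2) *\<^sub>R X y) i y = (1/2) *\<^sub>R D i y"
      unfolding coord_deriv_def
      by (rule dir_deriv_eqI, rule has_derivative_scaleR_right, rule has_derivative_dir_deriv, rule diff, rule smooth)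
    moreover have "(\<lambda>y. (1/2) *\<^sub>R X y) differentiable (at y)"
      by (rule diff, rule smooth_on_scaleR[OF open_dom smooth_on_const smooth])
    ultimately show ?thesis
      unfolding nu_def[abs_def]
      by (simp add: coord_deriv_diff coord_deriv_sum dV differentiable_sum
          coord_deriv_scaleR diff[OF smooth_V] diff[OF smooth_D])
  qed
  \<comment> \<open>The Weingarten relation: differentiating \<open>nu y \<bullet> D k y = 0\<close>
    moves the derivative from the normal field to the frame.\<close>
  have nu_D: "coord_deriv nu i y \<bullet> D k y = - (nu y \<bullet> coord_deriv (D k) i y)" for i k
  proof -
    have "coord_deriv (\<lambda>y. nu y \<bullet> D k y) i y = coord_deriv (\<lambda>y. 0) i y"
      by (rule coord_deriv_cong_open[OF open_dom y]) (rule nu_orthogonal)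
    also have "\<dots> = 0" by (rule coord_deriv_eqI[OF has_derivative_const])
    finally show ?thesis
      by (simp add: coord_deriv_inner diff[OF smooth_nu] diff[OF smooth_D])
  qed
  define divV where "divV = (\<Sum>i\<in>UNIV. coord_deriv (V i) i y)"
  define Q where "Q j = (\<Sum>i\<in>UNIV. \<Sum>k\<in>UNIV. gi y i k * (coord_deriv (D i) j y \<bullet> D k y))" for j
  have "(\<Sum>i\<in>UNIV. \<Sum>k\<in>UNIV. gi y i k * (nu y \<bullet> coord_deriv (D k) i y)) = nu y \<bullet> H_vec y"
    unfolding H_vec_def second_ff_def
    by (simp add: inner_sum_right inner_normal_part[OF y nu_orthogonal[OF y]])
  then have "- (nu y \<bullet> H_vec y) = (\<Sum>i\<in>UNIV. \<Sum>k\<in>UNIV. gi y i k * (coord_deriv nu i y \<bullet> D k y))"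
    by (simp add: nu_D sum_negf)
  also have "\<dots> = (\<Sum>i\<in>UNIV. \<Sum>k\<in>UNIV. gi y i k * g y i k) / 2
      - (\<Sum>i\<in>UNIV. \<Sum>k\<in>UNIV. \<Sum>j\<in>UNIV. gi y i k * (V j y * (coord_deriv (D j) i y \<bullet> D k y)))
      - (\<Sum>i\<in>UNIV. \<Sum>k\<in>UNIV. \<Sum>j\<in>UNIV. gi y i k * (coord_deriv (V j) i y * g y j k))"
    unfolding X_split
    by (simp add: inner_diff_left inner_sum_left inner_add_left g_eq sum_subtractf sum.distrib
        sum_distrib_left sum_divide_distrib right_diff_distrib distrib_left diff_diff_eq)
  also have "(\<Sum>i\<in>UNIV. \<Sum>k\<in>UNIV. gi y i k * g y i k) = real CARD('n)"
    by (simp add: sum_gi_g'[OF y])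
  \<comment> \<open>Commuting the second derivatives of \<open>X\<close> turns this Christoffel term
    into \<open>Q j\<close>, the logarithmic derivative of \<open>W\<close> by
    \<open>coord_deriv_W\<close>. It is exactly what the divergence weighted by \<open>W\<close>
    requires besides \<open>divV\<close>.\<close>
  also have "(\<Sum>i\<in>UNIV. \<Sum>k\<in>UNIV. \<Sum>j\<in>UNIV. gi y i k * (V j y * (coord_deriv (D j) i y \<bullet> D k y)))
      = (\<Sum>j\<in>UNIV. V j y * Q j)"
  proof -
    have "(\<Sum>i\<in>UNIV. \<Sum>k\<in>UNIV. \<Sum>j\<in>UNIV. gi y i k * (V j y * (coord_deriv (D j) i y \<bullet> D k y)))
        = (\<Sum>i\<in>UNIV. \<Sum>j\<in>UNIV. \<Sum>k\<in>UNIV. V j y * (gi y i k * (coord_deriv (D i) j y \<bullet> D k y)))"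
      by (rule sum.cong[OF refl], subst sum.swap) (simp add: DD_commute[OF y] mult_ac)
    also have "\<dots> = (\<Sum>j\<in>UNIV. V j y * Q j)"
      by (subst sum.swap) (simp add: Q_def sum_distrib_left)
    finally show ?thesis .
  qed
  also have "(\<Sum>i\<in>UNIV. \<Sum>k\<in>UNIV. \<Sum>j\<in>UNIV. gi y i k * (coord_deriv (V j) i y * g y j k)) = divV"
  proof -
    have "(\<Sum>k\<in>UNIV. \<Sum>j\<in>UNIV. gi y i k * (coord_deriv (V j) i y * g y j k))
        = (\<Sum>j\<in>UNIV. coord_deriv (V j) i y * (\<Sum>k\<in>UNIV. gi y i k * g y j k))" for i
      by (subst sum.swap) (simp add: sum_distrib_left mult_ac)
    then show ?thesis
      by (simp add: sum_gi_g'[OF y] divV_def if_distrib[of "\<lambda>x. _ * x"] cong: if_cong)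
  qed
  finally have key: "divV + (\<Sum>j\<in>UNIV. V j y * Q j) = real CARD('n) / 2 + nu y \<bullet> H_vec y" by simp
  have "coord_deriv (\<lambda>y. W y * V j y) j y = W y * (coord_deriv (V j) j y + V j y * Q j)" for j
    by (simp add: coord_deriv_mult diff[OF smooth_W] diff[OF smooth_V] coord_deriv_W[OF y] Q_def[symmetric] algebra_simps)
  then have "(\<Sum>j\<in>UNIV. coord_deriv (\<lambda>y. W y * V j y) j y) = W y * (divV + (\<Sum>j\<in>UNIV. V j y * Q j))"
    by (simp add: divV_def sum_distrib_left[symmetric] sum.distrib)
  then show ?thesis by (simp add: key)
qed

lemma linear_normal_part:
  assumes "y \<in> S"
  shows "linear (normal_part (tangent_space X y))"
  by (rule linearI)
    (simp_all add: normal_part_eq[OF assms] inner_add_left distrib_left sum.distrib scaleR_add_left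
      scaleR_diff_right scaleR_sum_right sum_distrib_left mult_ac)

lemma normal_part_tangent:
  assumes "y \<in> S" "v \<in> tangent_space X y"
  shows "normal_part (tangent_space X y) v = 0"
  by (rule normal_part_eqI[OF subspace_tangent_space[OF assms(1)]])
    (use assms(2) subspace_0[OF subspace_orthogonal_comp] in auto)

lemma smooth_second_ff: "smooth_on S (\<lambda>y. second_ff X y i j)"
proof (rule smooth_on_cong[OF open_dom])
  show "coord_deriv (D j) i y
      - (\<Sum>l\<in>UNIV. (\<Sum>k\<in>UNIV. gi y k l * (coord_deriv (D j) i y \<bullet> D k y)) *\<^sub>R D l y) = second_ff X y i j"
    if "y \<in> S" for y
    by (simp add: second_ff_def normal_part_eq[OF that])
  show "smooth_on S (\<lambda>y. coord_deriv (D j) i y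
      - (\<Sum>l\<in>UNIV. (\<Sum>k\<in>UNIV. gi y k l * (coord_deriv (D j) i y \<bullet> D k y)) *\<^sub>R D l y))"
    by (intro smooth_on_diff smooth_on_sum smooth_on_scaleR smooth_on_mult smooth_on_inner
        smooth_D smooth_DD smooth_gi open_dom)
qed

lemma coord_deriv_norm_sq:
  assumes "y \<in> S"
  shows "coord_deriv (\<lambda>y. (norm (X y))\<^sup>2 / 4) j y = (X y \<bullet> D j y) / 2"
proof -
  have "coord_deriv (\<lambda>y. (X y \<bullet> X y) * (1/4)) j y = (X y \<bullet> X y) * coord_deriv (\<lambda>y. 1/4) j y + coord_deriv (\<lambda>y. X y \<bullet> X y) j y * (1/4)"
    by (rule coord_deriv_mult) (auto intro!: smooth_on_differentiable[OF _ assms] smooth_on_inner open_dom smooth)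
  then show ?thesis
    by (simp add: coord_deriv_inner smooth_on_differentiable[OF smooth assms] dot_square_norm[symmetric]
        coord_deriv_eqI[OF has_derivative_const] inner_commute)
qed

text \<open>Pythagoras for the splitting of \<open>X / 2\<close> into the normal vector
  \<open>nu\<close> and the tangent vector with coordinates \<open>V\<close>.\<close>

lemma grad_norm_sq_quarter:
  assumes "y \<in> S"
  shows "(\<Sum>j\<in>UNIV. coord_deriv (\<lambda>y. (norm (X y))\<^sup>2 / 4) j y * V j y) = (norm (X y))\<^sup>2 / 4 - nu y \<bullet> nu y"
proof -
  define t where "t = (\<Sum>j\<in>UNIV. V j y *\<^sub>R D j y)"
  have nu: "nu y = (1/2) *\<^sub>R X y - t" by (simp add: nu_def t_def)
  have "nu y \<bullet> t = 0" by (simp add: t_def inner_sum_right nu_orthogonal[OF assms])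
  moreover have "(\<Sum>j\<in>UNIV. coord_deriv (\<lambda>y. (norm (X y))\<^sup>2 / 4) j y * V j y) = ((1/2) *\<^sub>R X y) \<bullet> t"
    by (simp add: coord_deriv_norm_sq[OF assms] t_def inner_sum_right sum_divide_distrib mult.commute)
  moreover have "(norm (X y))\<^sup>2 / 4 = ((1/2) *\<^sub>R X y) \<bullet> ((1/2) *\<^sub>R X y)"
    by (simp add: dot_square_norm power2_norm_eq_inner[symmetric] power_divide)
  moreover have "(1/2) *\<^sub>R X y = nu y + t" by (simp add: nu)
  ultimately show ?thesis by (simp add: inner_add_left inner_add_right inner_commute add_divide_distrib)
qed

text \<open>The fields \<open>u * W * V j\<close> extend by zero to smooth functions on the whole
  space, because their support stays in a compact subset of \<open>S\<close>. Each coordinate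
  derivative then integrates to zero, and \<open>divergence_V\<close> evaluates their sum.\<close>

lemma integral_divergence_V:
  assumes u: "smooth_on S u" and K: "compact K" "K \<subseteq> S" and supp: "\<And>y. y \<in> S - K \<Longrightarrow> u y = 0"
  shows "(LINT y|lborel. indicator S y *
    (((\<Sum>j\<in>UNIV. coord_deriv u j y * V j y) + u y * (real CARD('n) / 2 + nu y \<bullet> H_vec y)) * W y)) = 0"
proof -
  define h where "h j y = (if y \<in> S then u y * (W y * V j y) else 0)" for j y
  have smooth_WV: "smooth_on S (\<lambda>y. W y * V j y)" for j
    by (rule smooth_on_mult[OF open_dom smooth_W smooth_V])
  have h0: "h j y = 0" if "y \<notin> K" for j y
    using that supp by (simp add: h_def)
  have smooth_h: "smooth_on UNIV (h j)" for j
  proof (rule smooth_on_local)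
    fix y
    show "\<exists>T. open T \<and> y \<in> T \<and> smooth_on T (h j)"
    proof (cases "y \<in> S")
      case True
      have "smooth_on S (h j)"
        by (rule smooth_on_cong[OF open_dom _ smooth_on_mult[OF open_dom u smooth_WV[of j]]]) (simp add: h_def)
      then show ?thesis using True open_dom by blast
    next
      case False
      have "open (- K)" using K(1) by (simp add: compact_imp_closed open_Compl)
      moreover from this have "smooth_on (- K) (h j)"
        by (rule smooth_on_cong[OF _ _ smooth_on_const[of _ 0]]) (simp add: h0)
      ultimately show ?thesis using False K(2) by blast
    qed
  qed
  have dh0: "coord_deriv (h j) j y = 0" if "y \<notin> K" for j y
  proof -
    have "coord_deriv (h j) j y = coord_deriv (\<lambda>_. 0) j y"
      by (rule coord_deriv_cong_open[of "- K"])
        (use that K(1) h0 in \<open>auto simp: compact_imp_closed open_Compl\<close>)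
    then show ?thesis by (simp add: coord_deriv_eqI[OF has_derivative_const])
  qed
  have int_dh: "integrable lborel (coord_deriv (h j) j)" for j
  proof -
    have "continuous_on K (coord_deriv (h j) j)"
      by (rule smooth_on_continuous_on[OF smooth_on_subset[OF smooth_on_coord_deriv[OF smooth_h]]]) simp
    from borel_integrable_compact[OF K(1) this]
    have "integrable lborel (\<lambda>y. indicator K y *\<^sub>R coord_deriv (h j) j y)" .
    moreover have "(\<lambda>y. indicator K y *\<^sub>R coord_deriv (h j) j y) = coord_deriv (h j) j"
      using dh0 by (auto simp: indicator_def fun_eq_iff)
    ultimately show ?thesis by simp
  qed
  have "integral\<^sup>L lborel (coord_deriv (h j) j) = 0" for j
    unfolding coord_deriv_def
    by (rule integral_dir_deriv_compact_support[OF smooth_onD[OF smooth_h] K(1) h0])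
  then have "(LINT y|lborel. (\<Sum>j\<in>UNIV. coord_deriv (h j) j y)) = 0"
    using int_dh by simp
  moreover have "(\<Sum>j\<in>UNIV. coord_deriv (h j) j y) = indicator S y *
    (((\<Sum>j\<in>UNIV. coord_deriv u j y * V j y) + u y * (real CARD('n) / 2 + nu y \<bullet> H_vec y)) * W y)" for y
  proof (cases "y \<in> S")
    case True
    have "coord_deriv (h j) j y = coord_deriv (\<lambda>y. u y * (W y * V j y)) j y" for j
      by (rule coord_deriv_cong_open[OF open_dom True]) (simp add: h_def)
    also have "\<dots> j = u y * coord_deriv (\<lambda>y. W y * V j y) j y + coord_deriv u j y * (W y * V j y)" for j
      by (rule coord_deriv_mult[OF smooth_on_differentiable[OF u True] smooth_on_differentiable[OF smooth_WV True]])
    finally have "(\<Sum>j\<in>UNIV. coord_deriv (h j) j y)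
        = u y * (\<Sum>j\<in>UNIV. coord_deriv (\<lambda>y. W y * V j y) j y) + (\<Sum>j\<in>UNIV. coord_deriv u j y * V j y) * W y"
      by (simp add: sum.distrib sum_distrib_left sum_distrib_right mult_ac)
    then show ?thesis by (simp add: divergence_V[OF True] True algebra_simps)
  next
    case False
    then have "y \<notin> K" using K(2) by blast
    then show ?thesis using dh0 False by simp
  qed
  ultimately show ?thesis by simp
qed

end


subsection \<open>Change of charts\<close>

definition contract :: "real ^ 'n ^ 'n \<Rightarrow> real ^ 'n ^ 'n \<Rightarrow> real" where
  "contract P B = (\<Sum>i\<in>UNIV. \<Sum>j\<in>UNIV. P $ i $ j * B $ i $ j)"

text \<open>For \<open>P\<close> an inverse metric this is the squared norm of the bilinear form
  \<open>B\<close>.\<close>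

definition contract2 :: "real ^ 'n ^ 'n \<Rightarrow> real ^ 'n ^ 'n \<Rightarrow> real" where
  "contract2 P B = (\<Sum>i\<in>UNIV. \<Sum>j\<in>UNIV. \<Sum>k\<in>UNIV. \<Sum>l\<in>UNIV. P $ i $ k * P $ j $ l * (B $ i $ j * B $ k $ l))"

lemma contract_eq_trace: "contract P B = trace (P ** transpose B)"
  by (simp add: contract_def trace_def matrix_matrix_mult_def transpose_def)

lemma contract2_eq_trace: "contract2 P B = trace (P ** B ** transpose P ** transpose B)"
proof -
  have "trace (P ** B ** transpose P ** transpose B)
      = (\<Sum>i\<in>UNIV. \<Sum>j\<in>UNIV. (\<Sum>l\<in>UNIV. (\<Sum>k\<in>UNIV. P $ i $ k * B $ k $ l) * P $ j $ l) * B $ i $ j)"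
    by (simp add: trace_def matrix_matrix_mult_def transpose_def)
  also have "\<dots> = (\<Sum>i\<in>UNIV. \<Sum>j\<in>UNIV. \<Sum>l\<in>UNIV. \<Sum>k\<in>UNIV. P $ i $ k * P $ j $ l * (B $ i $ j * B $ k $ l))"
    by (simp add: sum_distrib_left sum_distrib_right mult_ac)
  also have "\<dots> = contract2 P B"
    unfolding contract2_def by (intro sum.cong refl sum.swap)
  finally show ?thesis ..
qed

lemma matrix_inv_eqI:
  fixes M :: "real ^ 'n ^ 'n"
  assumes "P ** M = mat 1"
  shows "matrix_inv M = P"
proof -
  have "invertible M" using assms invertible_left_inverse by blast
  then have "M ** matrix_inv M = mat 1" by (simp add: matrix_inv_inverse)
  then have "P ** (M ** matrix_inv M) = P" by simp
  then show ?thesis by (simp add: matrix_mul_assoc assms)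
qed

text \<open>A change of chart acts on metric and form by congruence with the same \<open>J\<close>.
  In trace form the inner factors \<open>J\<close> and \<open>J'\<close> cancel in pairs and
  cyclicity of the trace removes the outer pair.\<close>

lemma contract_congruence:
  fixes G B J J' :: "real ^ 'n ^ 'n"
  assumes J: "J ** J' = mat 1" and G: "invertible G"
  shows "contract (matrix_inv (J ** G ** transpose J)) (J ** B ** transpose J) = contract (matrix_inv G) B"
    and "contract2 (matrix_inv (J ** G ** transpose J)) (J ** B ** transpose J) = contract2 (matrix_inv G) B"
proof -
  let ?P = "matrix_inv G"
  have J': "J' ** J = mat 1" using J matrix_left_right_inverse by blast
  have tJ: "transpose J' ** transpose J = mat 1" "transpose J ** transpose J' = mat 1"
    using arg_cong[OF J, of transpose] arg_cong[OF J', of transpose]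
    by (simp_all add: matrix_transpose_mul transpose_mat)
  have c: "M ** J' ** J = M" "M ** transpose J ** transpose J' = M" "M ** transpose J' ** transpose J = M"
    "M ** matrix_inv G ** G = M" for M :: "real ^ 'n ^ 'n"
    using J' tJ matrix_inv_inverse[OF G] by (simp_all add: matrix_mul_assoc[symmetric])
  have inv: "matrix_inv (J ** G ** transpose J) = transpose J' ** ?P ** J'"
    by (rule matrix_inv_eqI) (simp add: matrix_mul_assoc c tJ)
  have "transpose J' ** ?P ** J' ** transpose (J ** B ** transpose J)
      = transpose J' ** (?P ** transpose B ** transpose J)"
    by (simp add: matrix_transpose_mul matrix_mul_assoc c)
  then have "contract (matrix_inv (J ** G ** transpose J)) (J ** B ** transpose J)
      = trace (transpose J' ** (?P ** transpose B ** transpose J))"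
    by (simp only: contract_eq_trace inv)
  also have "\<dots> = trace ((?P ** transpose B ** transpose J) ** transpose J')"
    by (rule trace_mul_sym)
  finally show "contract (matrix_inv (J ** G ** transpose J)) (J ** B ** transpose J) = contract ?P B"
    by (simp add: contract_eq_trace matrix_mul_assoc c)
  have "transpose J' ** ?P ** J' ** (J ** B ** transpose J) ** transpose (transpose J' ** ?P ** J')
        ** transpose (J ** B ** transpose J)
      = transpose J' ** (?P ** B ** transpose ?P ** transpose B ** transpose J)"
    by (simp add: matrix_transpose_mul matrix_mul_assoc c)
  then have "contract2 (matrix_inv (J ** G ** transpose J)) (J ** B ** transpose J)
      = trace (transpose J' ** (?P ** B ** transpose ?P ** transpose B ** transpose J))"
    by (simp only: contract2_eq_trace inv)
  also have "\<dots> = trace ((?P ** B ** transpose ?P ** transpose B ** transpose J) ** transpose J')"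
    by (rule trace_mul_sym)
  finally show "contract2 (matrix_inv (J ** G ** transpose J)) (J ** B ** transpose J) = contract2 ?P B"
    by (simp add: contract2_eq_trace matrix_mul_assoc c)
qed

lemma congruence_entry:
  "(J ** B ** transpose J) $ i $ j = (\<Sum>k\<in>UNIV. \<Sum>l\<in>UNIV. J $ i $ k * J $ j $ l * B $ k $ l)"
  for J B :: "real ^ 'n ^ 'n"
proof -
  have "(J ** B ** transpose J) $ i $ j = (\<Sum>l\<in>UNIV. \<Sum>k\<in>UNIV. J $ i $ k * J $ j $ l * B $ k $ l)"
    by (simp add: matrix_matrix_mult_def transpose_def sum_distrib_left mult_ac)
  then show ?thesis by (subst sum.swap)
qed

lemma coord_deriv_compose:
  assumes "t differentiable (at y)" "f differentiable (at (t y))"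
  shows "coord_deriv (f \<circ> t) i y = (\<Sum>k\<in>UNIV. (coord_deriv t i y $ k) *\<^sub>R coord_deriv f k (t y))"
proof -
  have "coord_deriv (f \<circ> t) i y = dir_deriv f (coord_deriv t i y) (t y)"
    using coord_deriv_eqI[OF diff_chain_at[OF has_derivative_dir_deriv[OF assms(1)] has_derivative_dir_deriv[OF assms(2)]]]
    by (simp add: coord_deriv_def)
  then show ?thesis by (simp only: dir_deriv_eq_sum_coord_deriv[OF assms(2)])
qed

text \<open>The transposed Jacobian matrix: row \<open>i\<close> is the derivative in coordinate
  direction \<open>i\<close>. With this convention metrics transform as
  \<open>J ** G ** transpose J\<close>.\<close>

definition jac :: "(real ^ 'n \<Rightarrow> real ^ 'n) \<Rightarrow> real ^ 'n \<Rightarrow> real ^ 'n ^ 'n" where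
  "jac t y = (\<chi> i. coord_deriv t i y)"

definition transition :: "('m, 'n::finite) chart \<Rightarrow> ('m, 'n) chart \<Rightarrow> real ^ 'n \<Rightarrow> real ^ 'n" where
  "transition c d = snd d \<circ> chart_inv c"

definition overlap :: "('m, 'n::finite) chart \<Rightarrow> ('m, 'n) chart \<Rightarrow> (real ^ 'n) set" where
  "overlap c d = snd c ` (fst c \<inter> fst d)"

locale smooth_manifold =
  fixes A :: "('m::{t2_space, second_countable_topology}, 'n::finite) chart set"
  assumes atlas: "smooth_atlas A"
begin

lemma chart_homeomorphism:
  "c \<in> A \<Longrightarrow> homeomorphism (fst c) (chart_image c) (snd c) (chart_inv c)"
  using atlas by (auto simp: smooth_atlas_def)

lemma open_chart: "c \<in> A \<Longrightarrow> open (fst c)" "c \<in> A \<Longrightarrow> open (chart_image c)"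
  using atlas by (auto simp: smooth_atlas_def)

lemma chart_inv_chart: "c \<in> A \<Longrightarrow> p \<in> fst c \<Longrightarrow> chart_inv c (snd c p) = p"
  and chart_chart_inv: "c \<in> A \<Longrightarrow> y \<in> chart_image c \<Longrightarrow> snd c (chart_inv c y) = y"
  and chart_in_image: "p \<in> fst c \<Longrightarrow> snd c p \<in> chart_image c"
  and chart_inv_in: "c \<in> A \<Longrightarrow> y \<in> chart_image c \<Longrightarrow> chart_inv c y \<in> fst c"
  and continuous_chart: "c \<in> A \<Longrightarrow> continuous_on (fst c) (snd c)"
  and continuous_chart_inv: "c \<in> A \<Longrightarrow> continuous_on (chart_image c) (chart_inv c)"
  using chart_homeomorphism[of c] by (auto simp: homeomorphism_def chart_image_def)

lemma chart_at: "chart_at A p \<in> A" "p \<in> fst (chart_at A p)"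
proof -
  have "p \<in> (\<Union>c\<in>A. fst c)" using atlas by (simp add: smooth_atlas_def)
  then have "\<exists>c. c \<in> A \<and> p \<in> fst c" by blast
  from someI_ex[OF this] show "chart_at A p \<in> A" "p \<in> fst (chart_at A p)"
    by (simp_all add: chart_at_def)
qed

lemma open_overlap:
  assumes "c \<in> A" "d \<in> A"
  shows "open (overlap c d)"
proof -
  have "overlap c d = chart_image c \<inter> chart_inv c -` fst d"
    using chart_inv_chart[OF assms(1)] chart_inv_in[OF assms(1)] chart_chart_inv[OF assms(1)]
    by (auto simp: overlap_def chart_image_def)
  then show ?thesis
    using continuous_open_preimage[OF continuous_chart_inv[OF assms(1)] open_chart(2)[OF assms(1)] open_chart(1)[OF assms(2)]]
    by simp
qed

lemma overlap_subset: "overlap c d \<subseteq> chart_image c"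
  by (auto simp: overlap_def chart_image_def)

lemma smooth_transition: "c \<in> A \<Longrightarrow> d \<in> A \<Longrightarrow> smooth_on (overlap c d) (transition c d)"
  using atlas by (auto simp: smooth_atlas_def overlap_def transition_def)

lemma transition_maps: "c \<in> A \<Longrightarrow> y \<in> overlap c d \<Longrightarrow> transition c d y \<in> overlap d c"
  by (auto simp: overlap_def transition_def chart_inv_chart)

lemma transition_transition: "c \<in> A \<Longrightarrow> d \<in> A \<Longrightarrow> y \<in> overlap c d \<Longrightarrow> transition d c (transition c d y) = y"
  by (auto simp: overlap_def transition_def chart_inv_chart)

lemma change_chart: "c \<in> A \<Longrightarrow> d \<in> A \<Longrightarrow> y \<in> overlap c d \<Longrightarrow> chart_inv d (transition c d y) = chart_inv c y"
  by (auto simp: overlap_def transition_def chart_inv_chart)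

lemma jac_inverse:
  assumes "c \<in> A" "d \<in> A" "y \<in> overlap c d"
  shows "jac (transition c d) y ** jac (transition d c) (transition c d y) = mat 1"
proof -
  have "coord_deriv (transition d c \<circ> transition c d) i y = coord_deriv (\<lambda>y. y) i y" for i
    by (rule coord_deriv_cong_open[OF open_overlap[OF assms(1,2)] assms(3)])
      (simp add: transition_transition[OF assms(1,2)])
  also have "coord_deriv (\<lambda>y. y) i y = axis i 1" for i :: 'n
    by (rule coord_deriv_eqI[OF has_derivative_ident])
  finally have "(\<Sum>k\<in>UNIV. (coord_deriv (transition c d) i y $ k) *\<^sub>R
      coord_deriv (transition d c) k (transition c d y)) = axis i 1" for i
    using coord_deriv_compose[OF smooth_on_differentiable[OF smooth_transition[OF assms(1,2)] assms(3)]
      smooth_on_differentiable[OF smooth_transition[OF assms(2,1)] transition_maps[OF assms(1,3)]]] by simp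
  from arg_cong[OF this, of "\<lambda>v. v $ _"] show ?thesis
    by (simp add: vec_eq_iff matrix_matrix_mult_def jac_def mat_def axis_def eq_commute)
qed

lemma coord_deriv_change_chart:
  assumes cd: "c \<in> A" "d \<in> A" "y \<in> overlap c d" and f: "smooth_on (chart_image d) (f \<circ> chart_inv d)"
  shows "coord_deriv (f \<circ> chart_inv c) i y
    = (\<Sum>k\<in>UNIV. (jac (transition c d) y $ i $ k) *\<^sub>R coord_deriv (f \<circ> chart_inv d) k (transition c d y))"
proof -
  have "coord_deriv (f \<circ> chart_inv c) i y = coord_deriv ((f \<circ> chart_inv d) \<circ> transition c d) i y"
    by (rule coord_deriv_cong_open[OF open_overlap[OF cd(1,2)] cd(3)])
      (simp add: change_chart[OF cd(1,2)])
  also have "\<dots> = (\<Sum>k\<in>UNIV. (coord_deriv (transition c d) i y $ k) *\<^sub>R coord_deriv (f \<circ> chart_inv d) k (transition c d y))"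
    by (rule coord_deriv_compose)
      (use smooth_on_differentiable[OF smooth_transition[OF cd(1,2)] cd(3)]
        smooth_on_differentiable[OF f] transition_maps[OF cd(1,3)] overlap_subset[of d c] in auto)
  finally show ?thesis by (simp add: jac_def)
qed

lemma smooth_map_chart: "smooth_map A f \<Longrightarrow> c \<in> A \<Longrightarrow> smooth_on (chart_image c) (f \<circ> chart_inv c)"
  by (simp add: smooth_map_def)

lemma continuous_onI_charts:
  assumes "\<And>c. c \<in> A \<Longrightarrow> continuous_on (chart_image c) (q \<circ> chart_inv c)"
  shows "continuous_on UNIV q"
proof -
  have "isCont q p" for p
  proof -
    note c = chart_at[of p]
    have "continuous_on (fst (chart_at A p)) ((q \<circ> chart_inv (chart_at A p)) \<circ> snd (chart_at A p))"
      using continuous_on_compose[OF continuous_chart[OF c(1)]] assms[OF c(1)]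
      unfolding chart_image_def by blast
    then have "continuous_on (fst (chart_at A p)) q"
      by (subst continuous_on_cong[OF refl, of _ q "(q \<circ> chart_inv (chart_at A p)) \<circ> snd (chart_at A p)"])
        (simp_all add: chart_inv_chart[OF c(1)])
    then show ?thesis using c open_chart(1)[OF c(1)] continuous_on_eq_continuous_at by blast
  qed
  then show ?thesis by (simp add: continuous_at_imp_continuous_on)
qed

lemma smooth_map_continuous: "smooth_map A f \<Longrightarrow> continuous_on UNIV f"
  by (rule continuous_onI_charts) (rule smooth_on_continuous_on[OF smooth_map_chart])

end

locale immersion = smooth_manifold A
  for A :: "('m::{t2_space, second_countable_topology}, 'n::finite) chart set" +
  fixes F :: "'m \<Rightarrow> 'b::euclidean_space"
  assumes smooth_F: "smooth_map A F"
    and immersive_F: "\<And>c y. c \<in> A \<Longrightarrow> y \<in> chart_image c \<Longrightarrow> inj (frechet_derivative (local_param F c) (at y))"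
begin

lemma local_immersion_chart: "c \<in> A \<Longrightarrow> local_immersion (chart_image c) (local_param F c)"
  using open_chart smooth_map_chart[OF smooth_F] immersive_F
  by unfold_locales (auto simp: local_param_def)

lemma coord_deriv_local_param:
  assumes cd: "c \<in> A" "d \<in> A" "y \<in> overlap c d"
  shows "coord_deriv (local_param F c) i y
    = (\<Sum>k\<in>UNIV. (jac (transition c d) y $ i $ k) *\<^sub>R coord_deriv (local_param F d) k (transition c d y))"
  unfolding local_param_def by (rule coord_deriv_change_chart[OF cd smooth_map_chart[OF smooth_F cd(2)]])

lemma metric_change_chart:
  assumes cd: "c \<in> A" "d \<in> A" "y \<in> overlap c d"
  shows "metric_matrix (local_param F c) y = jac (transition c d) y
    ** metric_matrix (local_param F d) (transition c d y) ** transpose (jac (transition c d) y)"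
  unfolding vec_eq_iff congruence_entry
  by (simp add: metric_matrix_def coord_deriv_local_param[OF cd] inner_sum_left inner_sum_right
      sum_distrib_left mult_ac, intro allI, subst sum.swap, simp add: inner_commute)

lemma tangent_space_change_chart_subset:
  assumes cd: "c \<in> A" "d \<in> A" "y \<in> overlap c d"
  shows "tangent_space (local_param F c) y \<subseteq> tangent_space (local_param F d) (transition c d y)"
proof -
  interpret C: local_immersion "chart_image c" "local_param F c" by (rule local_immersion_chart[OF cd(1)])
  interpret D: local_immersion "chart_image d" "local_param F d" by (rule local_immersion_chart[OF cd(2)])
  have y: "y \<in> chart_image c" "transition c d y \<in> chart_image d"
    using cd(3) overlap_subset transition_maps[OF cd(1,3)] by blast+
  show ?thesis
    unfolding C.tangent_space_eq[OF y(1)] coord_deriv_local_param[OF cd]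
    by (auto intro!: subspace_sum subspace_scale D.subspace_tangent_space D.D_in_tangent_space y)
qed

lemma tangent_space_change_chart:
  assumes cd: "c \<in> A" "d \<in> A" "y \<in> overlap c d"
  shows "tangent_space (local_param F c) y = tangent_space (local_param F d) (transition c d y)"
  using tangent_space_change_chart_subset[OF cd]
    tangent_space_change_chart_subset[OF cd(2,1) transition_maps[OF cd(1,3)]]
    transition_transition[OF cd] by auto

text \<open>The second derivatives of the transition map only multiply tangent vectors, which the
  normal projection kills; what remains transforms as a tensor.\<close>

lemma second_ff_change_chart:
  assumes cd: "c \<in> A" "d \<in> A" "y \<in> overlap c d"
  shows "second_ff (local_param F c) y i j = (\<Sum>k\<in>UNIV. \<Sum>l\<in>UNIV.
    (jac (transition c d) y $ i $ k * jac (transition c d) y $ j $ l) *\<^sub>R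
      second_ff (local_param F d) (transition c d y) k l)"
proof -
  interpret D: local_immersion "chart_image d" "local_param F d" by (rule local_immersion_chart[OF cd(2)])
  let ?t = "transition c d" and ?X = "local_param F d"
  let ?T = "tangent_space ?X (?t y)"
  have ty: "?t y \<in> chart_image d"
    using overlap_subset transition_maps[OF cd(1,3)] by blast
  note st = smooth_transition[OF cd(1,2)]
  have sJ: "smooth_on (overlap c d) (\<lambda>y. coord_deriv ?t j y $ l)" for l
    using smooth_on_inner[OF open_overlap[OF cd(1,2)] smooth_on_coord_deriv[OF st] smooth_on_const, of j "axis l 1"]
    by (simp add: inner_axis)
  have sD: "smooth_on (overlap c d) (coord_deriv ?X l \<circ> ?t)" for l
    by (rule smooth_on_compose[OF open_overlap[OF cd(1,2)] st D.smooth_D])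
      (use transition_maps[OF cd(1)] overlap_subset in blast)
  note diff = smooth_on_differentiable[OF _ cd(3)]
  have "coord_deriv (coord_deriv (local_param F c) j) i y
      = coord_deriv (\<lambda>y. \<Sum>l\<in>UNIV. (coord_deriv ?t j y $ l) *\<^sub>R (coord_deriv ?X l \<circ> ?t) y) i y"
    by (rule coord_deriv_cong_open[OF open_overlap[OF cd(1,2)] cd(3)])
      (simp add: coord_deriv_local_param[OF cd(1,2)] jac_def)
  also have "\<dots> = (\<Sum>l\<in>UNIV. coord_deriv (\<lambda>y. (coord_deriv ?t j y $ l) *\<^sub>R (coord_deriv ?X l \<circ> ?t) y) i y)"
    by (rule coord_deriv_sum) (rule diff, rule smooth_on_scaleR[OF open_overlap[OF cd(1,2)] sJ sD])
  also have "\<dots> = (\<Sum>l\<in>UNIV. (coord_deriv ?t j y $ l) *\<^sub>R coord_deriv (coord_deriv ?X l \<circ> ?t) i y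
      + coord_deriv (\<lambda>y. coord_deriv ?t j y $ l) i y *\<^sub>R coord_deriv ?X l (?t y))"
    by (rule sum.cong[OF refl], subst coord_deriv_scaleR[OF diff[OF sJ] diff[OF sD]]) simp
  also have "\<dots> = (\<Sum>l\<in>UNIV. (coord_deriv ?t j y $ l) *\<^sub>R
        (\<Sum>k\<in>UNIV. (coord_deriv ?t i y $ k) *\<^sub>R coord_deriv (coord_deriv ?X l) k (?t y))
      + coord_deriv (\<lambda>y. coord_deriv ?t j y $ l) i y *\<^sub>R coord_deriv ?X l (?t y))"
    by (simp add: coord_deriv_compose[OF diff[OF st] smooth_on_differentiable[OF D.smooth_D ty]])
  finally have "second_ff (local_param F c) y i j = normal_part ?T (\<Sum>l\<in>UNIV. (coord_deriv ?t j y $ l) *\<^sub>R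
        (\<Sum>k\<in>UNIV. (coord_deriv ?t i y $ k) *\<^sub>R coord_deriv (coord_deriv ?X l) k (?t y))
      + coord_deriv (\<lambda>y. coord_deriv ?t j y $ l) i y *\<^sub>R coord_deriv ?X l (?t y))"
    by (simp add: second_ff_def tangent_space_change_chart[OF cd])
  also have "\<dots> = (\<Sum>l\<in>UNIV. \<Sum>k\<in>UNIV. ((coord_deriv ?t j y $ l) * (coord_deriv ?t i y $ k)) *\<^sub>R second_ff ?X (?t y) k l)"
    using D.normal_part_tangent[OF ty D.D_in_tangent_space[OF ty]]
    by (simp add: linear_sum[OF D.linear_normal_part[OF ty]] linear_add[OF D.linear_normal_part[OF ty]]
        linear_cmul[OF D.linear_normal_part[OF ty]] second_ff_def scaleR_sum_right)
  also have "\<dots> = (\<Sum>k\<in>UNIV. \<Sum>l\<in>UNIV. (jac ?t y $ i $ k * jac ?t y $ j $ l) *\<^sub>R second_ff ?X (?t y) k l)"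
    by (subst sum.swap) (simp add: jac_def mult.commute)
  finally show ?thesis .
qed

end


subsection \<open>Global geometric quantities\<close>

text \<open>The polarisation of \<open>grad_norm_sq\<close>, that is, the inner product of two
  gradients; the ground state substitution produces mixed terms.\<close>

definition grad_inner ::
  "('m, 'n::finite) chart set \<Rightarrow> ('m \<Rightarrow> 'b::euclidean_space) \<Rightarrow> ('m \<Rightarrow> real) \<Rightarrow> ('m \<Rightarrow> real) \<Rightarrow> 'm \<Rightarrow> real" where
  "grad_inner A F u v p = (let c = chart_at A p; y = snd c p in
     contract (inv_metric (local_param F c) y)
       (\<chi> i j. coord_deriv (u \<circ> chart_inv c) i y * coord_deriv (v \<circ> chart_inv c) j y))"

lemma grad_norm_sq_eq: "grad_norm_sq A F u p = grad_inner A F u u p"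
  by (simp add: grad_norm_sq_def grad_inner_def contract_def Let_def mult.assoc)

text \<open>Splitting the vector valued form along the ambient basis reduces it to real matrices, to
  which the congruence law of \<open>contract2\<close> applies.\<close>

definition second_ff_norm_sq_local :: "(real ^ 'n::finite \<Rightarrow> 'b::euclidean_space) \<Rightarrow> real ^ 'n \<Rightarrow> real" where
  "second_ff_norm_sq_local X y
    = (\<Sum>e\<in>Basis. contract2 (inv_metric X y) (\<chi> i j. second_ff X y i j \<bullet> e))"

lemma sum_contract2_components:
  fixes B :: "'d::finite \<Rightarrow> 'd \<Rightarrow> 'e::euclidean_space"
  shows "(\<Sum>e\<in>Basis. contract2 P (\<chi> i j. B i j \<bullet> e))
    = (\<Sum>i\<in>UNIV. \<Sum>j\<in>UNIV. \<Sum>k\<in>UNIV. \<Sum>l\<in>UNIV. P $ i $ k * P $ j $ l * (B i j \<bullet> B k l))"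
  unfolding contract2_def
  by (subst euclidean_inner, simp only: vec_lambda_beta sum_distrib_left,
      (subst sum.swap, rule sum.cong[OF refl])+, rule refl)

lemma second_ff_norm_sq_eq:
  "second_ff_norm_sq A F p
    = second_ff_norm_sq_local (local_param F (chart_at A p)) (snd (chart_at A p) p)"
  unfolding second_ff_norm_sq_def second_ff_norm_sq_local_def Let_def sum_contract2_components ..

context smooth_manifold
begin

lemma smooth_mapI: "(\<And>c. c \<in> A \<Longrightarrow> smooth_on (chart_image c) (f \<circ> chart_inv c)) \<Longrightarrow> smooth_map A f"
  by (simp add: smooth_map_def)

lemma smooth_map_const: "smooth_map A (\<lambda>p. c)"
  by (simp add: smooth_map_def o_def smooth_on_const)

lemma smooth_map_add: "smooth_map A u \<Longrightarrow> smooth_map A v \<Longrightarrow> smooth_map A (\<lambda>p. u p + v p)"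
  by (auto simp: smooth_map_def o_def intro!: smooth_on_add open_chart)

lemma smooth_map_mult:
  fixes u v :: "'m \<Rightarrow> real"
  shows "smooth_map A u \<Longrightarrow> smooth_map A v \<Longrightarrow> smooth_map A (\<lambda>p. u p * v p)"
  by (auto simp: smooth_map_def o_def intro!: smooth_on_mult open_chart)

lemma smooth_map_sum: "(\<And>i. i \<in> I \<Longrightarrow> smooth_map A (u i)) \<Longrightarrow> smooth_map A (\<lambda>p. \<Sum>i\<in>I. u i p)"
  by (auto simp: smooth_map_def o_def intro!: smooth_on_sum open_chart)

lemma smooth_map_real_compose:
  fixes u :: "'m \<Rightarrow> real"
  shows "smooth_map A u \<Longrightarrow> smooth_on UNIV g \<Longrightarrow> smooth_map A (\<lambda>p. g (u p))"
  unfolding smooth_map_def o_def using smooth_on_real_compose open_chart(2) by blast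

lemma smooth_map_inner: "smooth_map A u \<Longrightarrow> smooth_map A v \<Longrightarrow> smooth_map A (\<lambda>p. u p \<bullet> v p)"
  by (auto simp: smooth_map_def o_def intro!: smooth_on_inner open_chart)

lemma open_chart_preimage:
  assumes "c \<in> A" "open U"
  shows "open (chart_image c \<inter> chart_inv c -` U)"
  by (rule continuous_open_preimage[OF continuous_chart_inv[OF assms(1)] open_chart(2)[OF assms(1)] assms(2)])

lemma smooth_map_local:
  assumes "\<And>p. \<exists>U. open U \<and> p \<in> U \<and> (\<forall>c\<in>A. smooth_on (chart_image c \<inter> chart_inv c -` U) (f \<circ> chart_inv c))"
  shows "smooth_map A f"
proof (rule smooth_mapI, rule smooth_on_local)
  fix c y assume c: "c \<in> A" "y \<in> chart_image c"
  obtain U where "open U" "chart_inv c y \<in> U" "smooth_on (chart_image c \<inter> chart_inv c -` U) (f \<circ> chart_inv c)"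
    using assms[of "chart_inv c y"] c by blast
  then show "\<exists>T. open T \<and> y \<in> T \<and> smooth_on T (f \<circ> chart_inv c)"
    using open_chart_preimage[OF c(1)] c(2) by blast
qed

lemma coord_deriv_local_zero:
  assumes "c \<in> A" "open U" "p \<in> U" "p \<in> fst c" "\<And>q. q \<in> U \<Longrightarrow> u q = (0::real)"
  shows "coord_deriv (u \<circ> chart_inv c) i (snd c p) = 0"
proof -
  have "coord_deriv (u \<circ> chart_inv c) i (snd c p) = coord_deriv (\<lambda>_. 0) i (snd c p)"
    by (rule coord_deriv_cong_open[OF open_chart_preimage[OF assms(1,2)]])
      (use assms in \<open>auto simp: chart_in_image chart_inv_chart\<close>)
  then show ?thesis by (simp add: coord_deriv_eqI[OF has_derivative_const])
qed

end

text \<open>Raising the index of \<open>a\<close> gives the coordinates \<open>b\<close> of a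
  tangent vector whose squared length is the contraction.\<close>

lemma (in local_immersion) contract_inv_metric_nonneg:
  assumes "y \<in> S"
  shows "contract (inv_metric X y) (\<chi> i j. a i * a j) \<ge> 0"
proof -
  define b where "b j = (\<Sum>i\<in>UNIV. gi y i j * a i)" for j
  have "(\<Sum>l\<in>UNIV. g y j l * b l) = a j" for j
  proof -
    have "(\<Sum>l\<in>UNIV. g y j l * b l) = (\<Sum>i\<in>UNIV. (\<Sum>l\<in>UNIV. gi y i l * g y j l) * a i)"
      unfolding b_def sum_distrib_left by (subst sum.swap) (simp add: sum_distrib_left mult_ac)
    then show ?thesis
      by (simp add: sum_gi_g'[OF assms] if_distrib[of "\<lambda>x. x * _"] cong: if_cong)
  qed
  then have "(\<Sum>j\<in>UNIV. b j * a j) = (\<Sum>j\<in>UNIV. \<Sum>l\<in>UNIV. b j * (g y j l * b l))"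
    by (simp add: sum_distrib_left[symmetric])
  also have "\<dots> = (\<Sum>j\<in>UNIV. b j *\<^sub>R D j y) \<bullet> (\<Sum>l\<in>UNIV. b l *\<^sub>R D l y)"
    by (simp add: inner_sum_left inner_sum_right sum_distrib_left g_eq mult_ac, subst sum.swap, simp add: mult_ac)
  also have "\<dots> \<ge> 0" by simp
  also have "(\<Sum>j\<in>UNIV. b j * a j) = contract (inv_metric X y) (\<chi> i j. a i * a j)"
    unfolding contract_def b_def sum_distrib_right by (subst sum.swap) (simp add: mult_ac)
  finally show ?thesis .
qed

context immersion
begin

abbreviation Gamma :: "('m \<Rightarrow> real) \<Rightarrow> ('m \<Rightarrow> real) \<Rightarrow> 'm \<Rightarrow> real" where
  "Gamma \<equiv> grad_inner A F"

definition rho :: "'m \<Rightarrow> real" where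
  "rho p = (norm (F p))\<^sup>2 / 4"

lemma rho_nonneg: "rho p \<ge> 0"
  by (simp add: rho_def)

lemma smooth_rho: "smooth_map A rho"
proof -
  have "smooth_map A (\<lambda>p. (F p \<bullet> F p) * (1/4))"
    by (intro smooth_map_mult smooth_map_inner smooth_map_const smooth_F)
  then show ?thesis by (simp add: rho_def[abs_def] dot_square_norm)
qed

lemma chart_at_overlap:
  assumes "c \<in> A" "p \<in> fst c"
  shows "snd (chart_at A p) p \<in> overlap (chart_at A p) c"
    "transition (chart_at A p) c (snd (chart_at A p) p) = snd c p"
  using assms chart_at[of p] by (auto simp: overlap_def transition_def chart_inv_chart)

text \<open>\<open>chart_at\<close> picks an unrelated chart at every point. Evaluating in one fixed
  chart is what allows continuity and integration to be discussed; the same purpose is served below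
  for the second fundamental form, the mean curvature and the tangent space.\<close>

lemma Gamma_chart:
  assumes c: "c \<in> A" "p \<in> fst c" and uv: "smooth_map A u" "smooth_map A v"
  shows "Gamma u v p = contract (inv_metric (local_param F c) (snd c p))
       (\<chi> i j. coord_deriv (u \<circ> chart_inv c) i (snd c p) * coord_deriv (v \<circ> chart_inv c) j (snd c p))"
proof -
  interpret C: local_immersion "chart_image c" "local_param F c" by (rule local_immersion_chart[OF c(1)])
  let ?d = "chart_at A p"
  note dc = chart_at(1)[of p] c(1) chart_at_overlap(1)[OF c]
  define J where "J = jac (transition ?d c) (snd ?d p)"
  have "(\<chi> i j. coord_deriv (u \<circ> chart_inv ?d) i (snd ?d p) * coord_deriv (v \<circ> chart_inv ?d) j (snd ?d p))
    = J ** (\<chi> i j. coord_deriv (u \<circ> chart_inv c) i (snd c p) * coord_deriv (v \<circ> chart_inv c) j (snd c p)) ** transpose J"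
    unfolding vec_eq_iff congruence_entry
    by (simp add: coord_deriv_change_chart[OF dc smooth_map_chart[OF uv(1) c(1)]]
        coord_deriv_change_chart[OF dc smooth_map_chart[OF uv(2) c(1)]] chart_at_overlap(2)[OF c] J_def
        sum_product mult_ac)
  then show ?thesis
    unfolding grad_inner_def Let_def inv_metric_def
    using contract_congruence(1)[OF jac_inverse[OF dc] C.invertible_metric[OF chart_in_image[OF c(2)]]]
    by (simp add: metric_change_chart[OF dc] chart_at_overlap(2)[OF c] J_def)
qed

lemma second_ff_component_congruence:
  assumes "c \<in> A" "p \<in> fst c"
  shows "(\<chi> i j. second_ff (local_param F (chart_at A p)) (snd (chart_at A p) p) i j \<bullet> e)
    = jac (transition (chart_at A p) c) (snd (chart_at A p) p)
      ** (\<chi> i j. second_ff (local_param F c) (snd c p) i j \<bullet> e)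
      ** transpose (jac (transition (chart_at A p) c) (snd (chart_at A p) p))"
  unfolding vec_eq_iff congruence_entry
  by (simp add: second_ff_change_chart[OF chart_at(1) assms(1) chart_at_overlap(1)[OF assms]]
      chart_at_overlap(2)[OF assms] inner_sum_left)

lemma second_ff_norm_sq_chart:
  assumes c: "c \<in> A" "p \<in> fst c"
  shows "second_ff_norm_sq A F p = second_ff_norm_sq_local (local_param F c) (snd c p)"
proof -
  interpret C: local_immersion "chart_image c" "local_param F c" by (rule local_immersion_chart[OF c(1)])
  note dc = chart_at(1)[of p] c(1) chart_at_overlap(1)[OF c]
  show ?thesis
    unfolding second_ff_norm_sq_eq second_ff_norm_sq_local_def second_ff_component_congruence[OF c]
      inv_metric_def metric_change_chart[OF dc]
    using contract_congruence(2)[OF jac_inverse[OF dc] C.invertible_metric[OF chart_in_image[OF c(2)]]]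
    by (simp add: chart_at_overlap(2)[OF c])
qed

lemma H_vec_component:
  "local_immersion.H_vec X y \<bullet> e = contract (inv_metric X y) (\<chi> i j. second_ff X y i j \<bullet> e)"
  if "local_immersion S X" for X :: "real ^ 'n \<Rightarrow> 'b"
  using that by (simp add: local_immersion.H_vec_def contract_def inner_sum_left)

lemma mean_curvature_vector_chart:
  assumes c: "c \<in> A" "p \<in> fst c"
  shows "mean_curvature_vector A F p = local_immersion.H_vec (local_param F c) (snd c p)"
proof (rule euclidean_eqI)
  fix e :: 'b
  interpret C: local_immersion "chart_image c" "local_param F c" by (rule local_immersion_chart[OF c(1)])
  interpret E: local_immersion "chart_image (chart_at A p)" "local_param F (chart_at A p)"
    by (rule local_immersion_chart[OF chart_at(1)])
  note dc = chart_at(1)[of p] c(1) chart_at_overlap(1)[OF c]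
  have "mean_curvature_vector A F p \<bullet> e = E.H_vec (snd (chart_at A p) p) \<bullet> e"
    by (simp add: mean_curvature_vector_def Let_def E.H_vec_def)
  also have "\<dots> = contract (inv_metric (local_param F c) (snd c p)) (\<chi> i j. second_ff (local_param F c) (snd c p) i j \<bullet> e)"
    unfolding H_vec_component[OF E.local_immersion_axioms] second_ff_component_congruence[OF c]
      inv_metric_def metric_change_chart[OF dc]
    using contract_congruence(1)[OF jac_inverse[OF dc] C.invertible_metric[OF chart_in_image[OF c(2)]]]
    by (simp add: chart_at_overlap(2)[OF c])
  also have "\<dots> = C.H_vec (snd c p) \<bullet> e"
    by (rule H_vec_component[OF C.local_immersion_axioms, symmetric])
  finally show "mean_curvature_vector A F p \<bullet> e = C.H_vec (snd c p) \<bullet> e" .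
qed

lemma tangent_at_chart:
  assumes c: "c \<in> A" "p \<in> fst c"
  shows "tangent_at A F p = tangent_space (local_param F c) (snd c p)"
  using tangent_space_change_chart[OF chart_at(1)[of p] c(1) chart_at_overlap(1)[OF c]]
  by (simp add: tangent_at_def Let_def chart_at_overlap(2)[OF c])

lemma continuous_second_ff_norm_sq: "continuous_on UNIV (second_ff_norm_sq A F)"
proof (rule continuous_onI_charts)
  fix c assume c: "c \<in> A"
  interpret C: local_immersion "chart_image c" "local_param F c" by (rule local_immersion_chart[OF c])
  have "continuous_on (chart_image c) (second_ff_norm_sq_local (local_param F c))"
    unfolding second_ff_norm_sq_local_def[abs_def] contract2_def vec_lambda_beta
    by (intro continuous_on_sum continuous_on_mult continuous_on_inner continuous_on_const
        smooth_on_continuous_on C.smooth_gi C.smooth_second_ff)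
  then show "continuous_on (chart_image c) (second_ff_norm_sq A F \<circ> chart_inv c)"
    by (rule continuous_on_cong[THEN iffD1, rotated 2])
      (simp_all add: second_ff_norm_sq_chart[OF c] chart_inv_in[OF c] chart_chart_inv[OF c])
qed

lemma continuous_mean_curvature_vector: "continuous_on UNIV (mean_curvature_vector A F)"
proof (rule continuous_onI_charts)
  fix c assume c: "c \<in> A"
  interpret C: local_immersion "chart_image c" "local_param F c" by (rule local_immersion_chart[OF c])
  have "continuous_on (chart_image c) C.H_vec"
    unfolding C.H_vec_def[abs_def]
    by (intro continuous_on_sum continuous_on_scaleR smooth_on_continuous_on C.smooth_gi C.smooth_second_ff)
  then show "continuous_on (chart_image c) (mean_curvature_vector A F \<circ> chart_inv c)"
    by (rule continuous_on_cong[THEN iffD1, rotated 2])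
      (simp_all add: mean_curvature_vector_chart[OF c] chart_inv_in[OF c] chart_chart_inv[OF c])
qed

lemma continuous_Gamma:
  assumes uv: "smooth_map A u" "smooth_map A v"
  shows "continuous_on UNIV (Gamma u v)"
proof (rule continuous_onI_charts)
  fix c assume c: "c \<in> A"
  interpret C: local_immersion "chart_image c" "local_param F c" by (rule local_immersion_chart[OF c])
  have "continuous_on (chart_image c) (\<lambda>y. contract (inv_metric (local_param F c) y)
       (\<chi> i j. coord_deriv (u \<circ> chart_inv c) i y * coord_deriv (v \<circ> chart_inv c) j y))"
    unfolding contract_def vec_lambda_beta
    by (intro continuous_on_sum continuous_on_mult smooth_on_continuous_on C.smooth_gi
        smooth_on_coord_deriv smooth_map_chart uv c)
  then show "continuous_on (chart_image c) (Gamma u v \<circ> chart_inv c)"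
    by (rule continuous_on_cong[THEN iffD1, rotated 2])
      (simp_all add: Gamma_chart[OF c _ uv] chart_inv_in[OF c] chart_chart_inv[OF c])
qed

lemma Gamma_nonneg: "Gamma u u p \<ge> 0"
proof -
  interpret C: local_immersion "chart_image (chart_at A p)" "local_param F (chart_at A p)"
    by (rule local_immersion_chart[OF chart_at(1)])
  show ?thesis
    using C.contract_inv_metric_nonneg[OF chart_in_image[OF chart_at(2)]]
    by (simp add: grad_inner_def Let_def)
qed

lemma Gamma_commute: "Gamma u v p = Gamma v u p"
proof -
  interpret C: local_immersion "chart_image (chart_at A p)" "local_param F (chart_at A p)"
    by (rule local_immersion_chart[OF chart_at(1)])
  show ?thesis
    unfolding grad_inner_def Let_def contract_def
    by (subst sum.swap) (simp add: C.gi_sym[OF chart_in_image[OF chart_at(2)]] mult_ac)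
qed

lemma differentiable_chart_at:
  "smooth_map A u \<Longrightarrow> (u \<circ> chart_inv (chart_at A p)) differentiable (at (snd (chart_at A p) p))"
  by (rule smooth_on_differentiable[OF smooth_map_chart[OF _ chart_at(1)] chart_in_image[OF chart_at(2)]])

lemma Gamma_mult:
  assumes "smooth_map A u" "smooth_map A v"
  shows "Gamma (\<lambda>p. u p * v p) w p = u p * Gamma v w p + v p * Gamma u w p"
proof -
  let ?c = "chart_at A p"
  have "coord_deriv ((\<lambda>p. u p * v p) \<circ> chart_inv ?c) i (snd ?c p)
     = u p * coord_deriv (v \<circ> chart_inv ?c) i (snd ?c p) + coord_deriv (u \<circ> chart_inv ?c) i (snd ?c p) * v p" for i
    using coord_deriv_mult[OF differentiable_chart_at[OF assms(1)] differentiable_chart_at[OF assms(2)], of p i]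
    by (simp add: o_def chart_inv_chart[OF chart_at])
  then show ?thesis
    by (simp add: grad_inner_def Let_def contract_def sum_distrib_left sum.distrib[symmetric] algebra_simps)
qed

lemma Gamma_add:
  assumes "smooth_map A u" "smooth_map A v"
  shows "Gamma (\<lambda>p. u p + v p) w p = Gamma u w p + Gamma v w p"
proof -
  let ?c = "chart_at A p"
  have "coord_deriv ((\<lambda>p. u p + v p) \<circ> chart_inv ?c) i (snd ?c p)
     = coord_deriv (u \<circ> chart_inv ?c) i (snd ?c p) + coord_deriv (v \<circ> chart_inv ?c) i (snd ?c p)" for i
    unfolding coord_deriv_def o_def
    by (rule dir_deriv_eqI, rule has_derivative_add)
      (rule has_derivative_dir_deriv, rule differentiable_chart_at[unfolded o_def], rule assms)+
  then show ?thesis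
    by (simp add: grad_inner_def Let_def contract_def sum.distrib[symmetric] algebra_simps)
qed

lemma Gamma_compose:
  assumes "smooth_map A u" "(g has_real_derivative g') (at (u p))"
  shows "Gamma (\<lambda>p. g (u p)) w p = g' * Gamma u w p"
proof -
  let ?c = "chart_at A p"
  have "coord_deriv ((\<lambda>p. g (u p)) \<circ> chart_inv ?c) i (snd ?c p)
     = g' * coord_deriv (u \<circ> chart_inv ?c) i (snd ?c p)" for i
    using coord_deriv_real_compose[OF differentiable_chart_at[OF assms(1)], of g g' p i] assms(2)
    by (simp add: o_def chart_inv_chart[OF chart_at])
  then show ?thesis
    by (simp add: grad_inner_def Let_def contract_def sum_distrib_left mult_ac)
qed

lemma Gamma_sum:
  assumes "finite I" "\<And>i. i \<in> I \<Longrightarrow> smooth_map A (u i)"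
  shows "Gamma (\<lambda>p. \<Sum>i\<in>I. u i p) w p = (\<Sum>i\<in>I. Gamma (u i) w p)"
  using assms
proof (induction I rule: finite_induct)
  case empty
  \<comment> \<open>The zero function is read as a composition with \<open>rho\<close>, so the chain
    rule yields a vanishing gradient.\<close>
  have "((\<lambda>x::real. 0) has_real_derivative 0) (at (rho p))" by simp
  then show ?case using Gamma_compose[OF smooth_rho, of "\<lambda>x. 0" 0 p w] by simp
next
  case (insert i I)
  then show ?case
    using Gamma_add[of "u i" "\<lambda>p. \<Sum>i\<in>I. u i p" w p] smooth_map_sum[of I u] by simp
qed

lemma Gamma_local_zero:
  assumes "open U" "p \<in> U" "\<And>q. q \<in> U \<Longrightarrow> u q = 0"
  shows "Gamma u w p = 0"
  using coord_deriv_local_zero[OF chart_at(1) assms(1,2) chart_at(2) assms(3)]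
  by (simp add: grad_inner_def Let_def contract_def)

end


subsection \<open>Riemannian measure\<close>

lemma (in smooth_manifold) chart_image_Int:
  assumes c: "c \<in> A"
  shows "snd c ` (fst c \<inter> U) = chart_image c \<inter> chart_inv c -` U"
proof (intro subset_antisym subsetI)
  fix y assume "y \<in> chart_image c \<inter> chart_inv c -` U"
  then have "snd c (chart_inv c y) = y" "chart_inv c y \<in> fst c \<inter> U"
    using chart_chart_inv[OF c] chart_inv_in[OF c] by auto
  then show "y \<in> snd c ` (fst c \<inter> U)" by (metis imageI)
qed (auto simp: chart_in_image chart_inv_chart[OF c])

text \<open>In a chart the bump is \<open>smooth_step\<close> of \<open>r\<^sup>2\<close> minus the
  squared distance to the centre, extended by zero. The extension is smooth because the image
  \<open>K\<close> of the closed ball is compact, hence closed in a Hausdorff space.\<close>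

lemma (in smooth_manifold) exists_bump:
  assumes "open Q" "p \<in> Q"
  obtains b :: "'m \<Rightarrow> real" and K c where "smooth_map A b" "\<And>q. b q \<ge> 0" "b p > 0" "compact K" "K \<subseteq> Q"
    "c \<in> A" "K \<subseteq> fst c" "\<And>q. q \<notin> K \<Longrightarrow> b q = 0"
proof -
  define c where "c = chart_at A p"
  have c: "c \<in> A" "p \<in> fst c" using chart_at by (simp_all add: c_def)
  let ?y = "snd c p"
  have "open (chart_image c \<inter> chart_inv c -` Q)" by (rule open_chart_preimage[OF c(1) assms(1)])
  moreover have "?y \<in> chart_image c \<inter> chart_inv c -` Q"
    using c assms(2) by (simp add: chart_in_image chart_inv_chart)
  ultimately obtain r where r: "r > 0" "cball ?y r \<subseteq> chart_image c \<inter> chart_inv c -` Q"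
    using open_contains_cball by blast
  define K where "K = chart_inv c ` cball ?y r"
  define \<beta> where "\<beta> y = smooth_step (r\<^sup>2 - (y - ?y) \<bullet> (y - ?y))" for y
  define b where "b q = (if q \<in> fst c then \<beta> (snd c q) else 0)" for q
  have \<beta>: "smooth_on S \<beta>" if "open S" for S
    unfolding \<beta>_def[abs_def]
    by (rule smooth_on_real_compose[OF that _ smooth_on_smooth_step])
      (intro smooth_on_diff smooth_on_inner smooth_on_const smooth_on_bounded_linear bounded_linear_ident that)
  have K: "compact K"
    unfolding K_def by (rule compact_continuous_image[OF continuous_on_subset[OF continuous_chart_inv[OF c(1)]]])
      (use r in auto)
  have Kc: "K \<subseteq> fst c" "K \<subseteq> Q" using r chart_inv_in[OF c(1)] by (auto simp: K_def)
  have b0: "b q = 0" if "q \<notin> K" for q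
  proof (cases "q \<in> fst c")
    case True
    have "snd c q \<notin> cball ?y r"
    proof
      assume "snd c q \<in> cball ?y r"
      then have "chart_inv c (snd c q) \<in> K" unfolding K_def by (rule imageI)
      then show False using that by (simp add: chart_inv_chart[OF c(1) True])
    qed
    then have "r < norm (snd c q - ?y)" by (simp add: dist_norm norm_minus_commute)
    then have "r\<^sup>2 < (norm (snd c q - ?y))\<^sup>2" using r(1) by (intro power_strict_mono) auto
    then show ?thesis using True by (simp add: b_def \<beta>_def smooth_step_eq_0 dot_square_norm)
  qed (simp add: b_def)
  have "smooth_map A b"
  proof (rule smooth_map_local)
    fix q
    show "\<exists>U. open U \<and> q \<in> U \<and> (\<forall>d\<in>A. smooth_on (chart_image d \<inter> chart_inv d -` U) (b \<circ> chart_inv d))"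
    proof (cases "q \<in> fst c")
      case True
      have "smooth_on (chart_image d \<inter> chart_inv d -` fst c) (b \<circ> chart_inv d)" if d: "d \<in> A" for d
      proof -
        let ?S = "chart_image d \<inter> chart_inv d -` fst c"
        have S: "?S = overlap d c"
          unfolding overlap_def chart_image_Int[OF d] ..
        have "smooth_on (overlap d c) (\<beta> \<circ> transition d c)"
          by (rule smooth_on_compose[OF open_overlap[OF d c(1)] smooth_transition[OF d c(1)] \<beta>[OF open_UNIV]]) simp
        then show ?thesis
          unfolding S by (rule smooth_on_cong[OF open_overlap[OF d c(1)], rotated])
            (auto simp: b_def overlap_def transition_def chart_inv_chart[OF d])
      qed
      then show ?thesis using True open_chart(1)[OF c(1)] by blast
    next
      case False
      have oK: "open (- K)" using K by (simp add: compact_imp_closed open_Compl)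
      have "smooth_on (chart_image d \<inter> chart_inv d -` (- K)) (b \<circ> chart_inv d)" if d: "d \<in> A" for d
        by (rule smooth_on_cong[OF open_chart_preimage[OF d oK] _ smooth_on_const[of _ 0]]) (simp add: b0)
      then show ?thesis using oK False Kc(1) by (intro exI[of _ "- K"]) auto
    qed
  qed
  moreover have "b q \<ge> 0" for q by (simp add: b_def \<beta>_def smooth_step_nonneg)
  moreover have "b p > 0" using c r(1) by (simp add: b_def \<beta>_def smooth_step_pos_iff)
  ultimately show thesis using that K Kc c(1) b0 by blast
qed

text \<open>A partition of unity before normalisation: the sum is only positive on \<open>K\<close>.
  Integrability uses the sum as it is, the divergence theorem divides by it.\<close>

lemma (in smooth_manifold) finite_bump_cover:
  assumes "compact K"
  obtains I :: "'m set" and b :: "'m \<Rightarrow> 'm \<Rightarrow> real" and L c where "finite I"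
    "\<And>i. smooth_map A (b i)" "\<And>i q. b i q \<ge> 0" "\<And>i. compact (L i)" "\<And>i. c i \<in> A" "\<And>i. L i \<subseteq> fst (c i)"
    "\<And>i q. q \<notin> L i \<Longrightarrow> b i q = 0" "\<And>q. q \<in> K \<Longrightarrow> (\<Sum>i\<in>I. b i q) > 0"
proof -
  have "\<exists>b L c. smooth_map A b \<and> (\<forall>q. b q \<ge> (0::real)) \<and> b p > 0 \<and> compact L \<and> c \<in> A \<and> L \<subseteq> fst c \<and> (\<forall>q. q \<notin> L \<longrightarrow> b q = 0)" for p
    using exists_bump[OF open_UNIV UNIV_I, of p] by metis
  then obtain b :: "'m \<Rightarrow> 'm \<Rightarrow> real" and L c where b: "\<And>p. smooth_map A (b p)" "\<And>p q. b p q \<ge> 0" "\<And>p. b p p > 0"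
      "\<And>p. compact (L p)" "\<And>p. c p \<in> A" "\<And>p. L p \<subseteq> fst (c p)" "\<And>p q. q \<notin> L p \<Longrightarrow> b p q = 0"
    by metis
  have "open {q. b p q > 0}" for p
    by (rule open_Collect_less[OF continuous_on_const smooth_map_continuous[OF b(1)]])
  moreover have "K \<subseteq> (\<Union>p\<in>K. {q. b p q > 0})" using b(3) by blast
  ultimately obtain I where I: "I \<subseteq> K" "finite I" "K \<subseteq> (\<Union>p\<in>I. {q. b p q > 0})"
    using compactE_image[OF assms, of K "\<lambda>p. {q. b p q > 0}"] by metis
  have "(\<Sum>i\<in>I. b i q) > 0" if q: "q \<in> K" for q
  proof -
    obtain p where "p \<in> I" "b p q > 0" using I q by auto
    then show ?thesis using I(2) b(2) by (intro sum_pos2[of I p]) auto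
  qed
  then show thesis using that[of I b L c] I(2) b by blast
qed

lemma (in smooth_manifold) test_functionI:
  assumes "smooth_map A u" "compact K" "\<And>q. q \<notin> K \<Longrightarrow> u q = 0"
  shows "test_function A u"
proof -
  have "closure {p. u p \<noteq> 0} \<subseteq> K"
    by (rule closure_minimal[OF _ compact_imp_closed[OF assms(2)]]) (use assms(3) in auto)
  then have "compact (closure {p. u p \<noteq> 0})"
    using compact_Int_closed[OF assms(2) closed_closure, of "{p. u p \<noteq> 0}"] by (simp add: Int_absorb1)
  then show ?thesis using assms(1) by (simp add: test_function_def)
qed

lemma (in smooth_manifold) test_functionE:
  assumes "test_function A u"
  obtains K where "smooth_map A u" "compact K" "\<And>q. q \<notin> K \<Longrightarrow> u q = 0"
  using assms closure_subset[of "{p. u p \<noteq> 0}"] that unfolding test_function_def by blast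

locale riemannian_immersion = immersion A F
  for A :: "('m::{t2_space, second_countable_topology}, 'n::finite) chart set" and F :: "'m \<Rightarrow> 'b::euclidean_space" +
  fixes \<sigma> :: "'m measure"
  assumes volume: "volume_measure A F \<sigma>"
begin

lemma sets_sigma [measurable_cong]: "sets \<sigma> = sets borel"
  using volume by (simp add: volume_measure_def)

lemma space_sigma: "space \<sigma> = UNIV"
  using sets_eq_imp_space_eq[OF sets_sigma] by simp

lemma borel_measurable_sigma: "f \<in> borel_measurable borel \<Longrightarrow> f \<in> borel_measurable \<sigma>"
  by (simp add: measurable_cong_sets[OF sets_sigma refl])

lemma volume_chart:
  assumes "c \<in> A" "E \<in> sets borel" "E \<subseteq> fst c"
  shows "emeasure \<sigma> E
    = (\<integral>\<^sup>+y\<in>snd c ` E. ennreal (sqrt (det (metric_matrix (local_param F c) y))) \<partial>lborel)"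
  using volume[unfolded volume_measure_def, THEN conjunct2, rule_format, OF assms] .

definition area_density :: "('m, 'n) chart \<Rightarrow> real ^ 'n \<Rightarrow> real" where
  "area_density c y = indicator (chart_image c) y * sqrt (det (metric_matrix (local_param F c) y))"

text \<open>One fixed point as value off the chart image makes the inverse a Borel map on the whole
  coordinate space, so that measures can be pushed forward; \<open>area_density\<close> vanishes
  there.\<close>

definition total_chart_inv :: "('m, 'n) chart \<Rightarrow> real ^ 'n \<Rightarrow> 'm" where
  "total_chart_inv c y = (if y \<in> chart_image c then chart_inv c y else undefined)"

lemma area_density_nonneg: "c \<in> A \<Longrightarrow> area_density c y \<ge> 0"
  using local_immersion.det_metric_pos[OF local_immersion_chart, of c y]
  by (cases "y \<in> chart_image c") (auto simp: area_density_def intro: less_imp_le)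

lemma measurable_area_density: "c \<in> A \<Longrightarrow> area_density c \<in> borel_measurable borel"
  using borel_measurable_continuous_on_indicator[OF borel_open[OF open_chart(2)]
      smooth_on_continuous_on[OF local_immersion.smooth_W[OF local_immersion_chart]]]
  by (simp add: local_immersion.W_def[OF local_immersion_chart] area_density_def[abs_def])

lemma measurable_total_chart_inv: "c \<in> A \<Longrightarrow> total_chart_inv c \<in> borel_measurable borel"
  unfolding total_chart_inv_def[abs_def]
  by (intro borel_measurable_continuous_on_if continuous_chart_inv continuous_on_const borel_open open_chart)

text \<open>Turns the setwise description in \<open>volume_measure\<close> into an equality of
  measures, from which integrals and integrability transfer through \<open>distr\<close> and
  \<open>density\<close>.\<close>

lemma chart_measure:
  assumes c: "c \<in> A"
  shows "density \<sigma> (\<lambda>p. ennreal (indicator (fst c) p))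
    = distr (density lborel (\<lambda>y. ennreal (area_density c y))) borel (total_chart_inv c)"
proof (rule measure_eqI)
  note [measurable] = measurable_area_density[OF c] measurable_total_chart_inv[OF c] borel_open[OF open_chart(1)[OF c]]
  fix E assume "E \<in> sets (density \<sigma> (\<lambda>p. ennreal (indicator (fst c) p)))"
  then have E[measurable]: "E \<in> sets borel" by (simp add: sets_sigma)
  have "emeasure (density \<sigma> (\<lambda>p. ennreal (indicator (fst c) p))) E
      = (\<integral>\<^sup>+p. ennreal (indicator (fst c) p) * indicator E p \<partial>\<sigma>)"
    by (rule emeasure_density) (simp_all add: sets_sigma)
  also have "\<dots> = (\<integral>\<^sup>+p. indicator (fst c \<inter> E) p \<partial>\<sigma>)"
    by (rule nn_integral_cong) (simp split: split_indicator)
  also have "\<dots> = emeasure \<sigma> (fst c \<inter> E)"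
    by (rule nn_integral_indicator) (simp add: sets_sigma)
  also have "\<dots> = (\<integral>\<^sup>+y\<in>snd c ` (fst c \<inter> E). ennreal (sqrt (det (metric_matrix (local_param F c) y))) \<partial>lborel)"
    using volume_chart[OF c, of "fst c \<inter> E"] open_chart(1)[OF c] by simp
  also have "\<dots> = (\<integral>\<^sup>+y. ennreal (area_density c y) * indicator (total_chart_inv c -` E) y \<partial>lborel)"
  proof (rule nn_integral_cong)
    fix y
    have "y \<in> snd c ` (fst c \<inter> E) \<longleftrightarrow> y \<in> chart_image c \<and> chart_inv c y \<in> E"
      unfolding chart_image_Int[OF c] by simp
    then show "ennreal (sqrt (det (metric_matrix (local_param F c) y))) * indicator (snd c ` (fst c \<inter> E)) y
        = ennreal (area_density c y) * indicator (total_chart_inv c -` E) y"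
      by (auto simp: indicator_def area_density_def total_chart_inv_def)
  qed
  also have "\<dots> = emeasure (distr (density lborel (\<lambda>y. ennreal (area_density c y))) borel (total_chart_inv c)) E"
  proof -
    have [measurable]: "total_chart_inv c -` E \<in> sets borel"
      using measurable_sets[OF measurable_total_chart_inv[OF c] E] by simp
    have "emeasure (density lborel (\<lambda>y. ennreal (area_density c y))) (total_chart_inv c -` E)
        = (\<integral>\<^sup>+y. ennreal (area_density c y) * indicator (total_chart_inv c -` E) y \<partial>lborel)"
      by (rule emeasure_density) simp_all
    then show ?thesis by (subst emeasure_distr) simp_all
  qed
  finally show "emeasure (density \<sigma> (\<lambda>p. ennreal (indicator (fst c) p))) E
    = emeasure (distr (density lborel (\<lambda>y. ennreal (area_density c y))) borel (total_chart_inv c)) E" .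
qed (simp add: sets_sigma)

lemma chart_integral:
  fixes q :: "'m \<Rightarrow> real"
  assumes c: "c \<in> A" and q: "q \<in> borel_measurable borel" and supp: "\<And>p. p \<notin> fst c \<Longrightarrow> q p = 0"
  shows "integral\<^sup>L \<sigma> q = (LINT y|lborel. area_density c y * q (chart_inv c y))"
    and "integrable \<sigma> q \<longleftrightarrow> integrable lborel (\<lambda>y. area_density c y * q (chart_inv c y))"
proof -
  note [measurable] = measurable_area_density[OF c] measurable_total_chart_inv[OF c] borel_open[OF open_chart(1)[OF c]] q
  have qs[measurable]: "q \<in> borel_measurable \<sigma>" by (rule borel_measurable_sigma[OF q])
  have e1: "(\<lambda>p. indicator (fst c) p * q p) = q"
    using supp by (auto simp: indicator_def fun_eq_iff)
  have e2: "area_density c y * q (total_chart_inv c y) = area_density c y * q (chart_inv c y)" for y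
    by (simp add: area_density_def total_chart_inv_def indicator_def)
  have i: "(\<lambda>p. indicator (fst c) p :: real) \<in> borel_measurable \<sigma>" by (simp add: sets_sigma)
  have "integral\<^sup>L \<sigma> q = integral\<^sup>L (density \<sigma> (\<lambda>p. ennreal (indicator (fst c) p))) q"
    by (subst integral_real_density) (simp_all add: e1 i qs)
  also have "\<dots> = integral\<^sup>L (density lborel (\<lambda>y. ennreal (area_density c y))) (\<lambda>y. q (total_chart_inv c y))"
    unfolding chart_measure[OF c] by (rule integral_distr) simp_all
  also have "\<dots> = (LINT y|lborel. area_density c y * q (chart_inv c y))"
    by (subst integral_real_density) (simp_all add: area_density_nonneg[OF c] e2)
  finally show "integral\<^sup>L \<sigma> q = (LINT y|lborel. area_density c y * q (chart_inv c y))" .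
  have "integrable \<sigma> q \<longleftrightarrow> integrable (density \<sigma> (\<lambda>p. ennreal (indicator (fst c) p))) q"
    by (subst integrable_real_density) (simp_all add: e1 i qs)
  also have "\<dots> \<longleftrightarrow> integrable (density lborel (\<lambda>y. ennreal (area_density c y))) (\<lambda>y. q (total_chart_inv c y))"
    unfolding chart_measure[OF c] by (rule integrable_distr_eq) simp_all
  also have "\<dots> \<longleftrightarrow> integrable lborel (\<lambda>y. area_density c y * q (chart_inv c y))"
    by (subst integrable_real_density) (simp_all add: area_density_nonneg[OF c] e2)
  finally show "integrable \<sigma> q \<longleftrightarrow> integrable lborel (\<lambda>y. area_density c y * q (chart_inv c y))" .
qed

lemma integrable_chart_support:
  fixes q :: "'m \<Rightarrow> real"
  assumes c: "c \<in> A" and q: "continuous_on UNIV q" and K: "compact K" "K \<subseteq> fst c" and supp: "\<And>p. p \<notin> K \<Longrightarrow> q p = 0"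
  shows "integrable \<sigma> q"
proof -
  interpret C: local_immersion "chart_image c" "local_param F c" by (rule local_immersion_chart[OF c])
  let ?K = "snd c ` K"
  have K': "compact ?K"
    by (rule compact_continuous_image[OF continuous_on_subset[OF continuous_chart[OF c] K(2)] K(1)])
  have sub: "?K \<subseteq> chart_image c" using K(2) by (auto simp: chart_image_def)
  have "continuous_on ?K (\<lambda>y. C.W y * q (chart_inv c y))"
    by (intro continuous_on_mult continuous_on_compose2[OF q continuous_on_subset[OF continuous_chart_inv[OF c] sub]]
        continuous_on_subset[OF smooth_on_continuous_on[OF C.smooth_W] sub]) simp
  from borel_integrable_compact[OF K' this]
  have "integrable lborel (\<lambda>y. indicator ?K y *\<^sub>R (C.W y * q (chart_inv c y)))" .
  moreover have "indicator ?K y *\<^sub>R (C.W y * q (chart_inv c y)) = area_density c y * q (chart_inv c y)" for y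
  proof (cases "y \<in> ?K")
    case True
    then show ?thesis using sub by (auto simp: area_density_def C.W_def)
  next
    case False
    have "area_density c y * q (chart_inv c y) = 0"
    proof (cases "y \<in> chart_image c")
      case True
      have "chart_inv c y \<notin> K"
      proof
        assume "chart_inv c y \<in> K"
        then have "snd c (chart_inv c y) \<in> ?K" by (rule imageI)
        then show False using False by (simp add: chart_chart_inv[OF c True])
      qed
      then show ?thesis by (simp add: supp)
    qed (simp add: area_density_def)
    then show ?thesis using False by simp
  qed
  ultimately have "integrable lborel (\<lambda>y. area_density c y * q (chart_inv c y))" by (simp only:)
  then show ?thesis
    using chart_integral(2)[OF c borel_measurable_continuous_onI[OF q]] supp K(2) by blast
qed

text \<open>The sum of the bumps is integrable chart by chart and has a positive minimum on
  \<open>K\<close>, so a multiple of it dominates \<open>q\<close>.\<close>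

lemma integrable_compact_support:
  fixes q :: "'m \<Rightarrow> real"
  assumes q: "continuous_on UNIV q" and K: "compact K" and supp: "\<And>p. p \<notin> K \<Longrightarrow> q p = 0"
  shows "integrable \<sigma> q"
proof (cases "K = {}")
  case True
  then have "q = (\<lambda>_. 0)" using supp by auto
  then show ?thesis by simp
next
  case False
  obtain I :: "'m set" and b :: "'m \<Rightarrow> 'm \<Rightarrow> real" and L c where b: "finite I"
    "\<And>i. smooth_map A (b i)" "\<And>i q. b i q \<ge> 0" "\<And>i. compact (L i)" "\<And>i. c i \<in> A" "\<And>i. L i \<subseteq> fst (c i)"
    "\<And>i q. q \<notin> L i \<Longrightarrow> b i q = 0" "\<And>q. q \<in> K \<Longrightarrow> (\<Sum>i\<in>I. b i q) > 0"
    using finite_bump_cover[OF K] by blast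
  define B where "B p = (\<Sum>i\<in>I. b i p)" for p
  have intB: "integrable \<sigma> B"
    unfolding B_def
    by (intro Bochner_Integration.integrable_sum integrable_chart_support[OF b(5) smooth_map_continuous[OF b(2)] b(4,6,7)])
  have contB: "continuous_on UNIV B"
    unfolding B_def by (intro continuous_on_sum smooth_map_continuous b)
  obtain p0 where p0: "p0 \<in> K" "\<And>p. p \<in> K \<Longrightarrow> B p0 \<le> B p"
    using continuous_attains_inf[OF K False continuous_on_subset[OF contB]] by auto
  obtain p1 where p1: "p1 \<in> K" "\<And>p. p \<in> K \<Longrightarrow> \<bar>q p\<bar> \<le> \<bar>q p1\<bar>"
    using continuous_attains_sup[OF K False continuous_on_subset[OF continuous_on_rabs[OF q]]] by auto
  have m: "B p0 > 0" using b(8)[OF p0(1)] by (simp add: B_def)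
  have B0: "B p \<ge> 0" for p unfolding B_def by (intro sum_nonneg b)
  show ?thesis
  proof (rule Bochner_Integration.integrable_bound)
    show "integrable \<sigma> (\<lambda>p. (\<bar>q p1\<bar> / B p0) * B p)" using intB by simp
    show "q \<in> borel_measurable \<sigma>" by (rule borel_measurable_sigma[OF borel_measurable_continuous_onI[OF q]])
    have "\<bar>q p\<bar> \<le> (\<bar>q p1\<bar> / B p0) * B p" for p
    proof (cases "p \<in> K")
      case True
      have "\<bar>q p\<bar> \<le> \<bar>q p1\<bar> * 1" using p1(2)[OF True] by simp
      also have "\<dots> \<le> \<bar>q p1\<bar> * (B p / B p0)"
        using p0(2)[OF True] m by (intro mult_left_mono) auto
      finally show ?thesis by simp
    next
      case False
      then show ?thesis using supp B0 m by simp
    qed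
    then show "AE p in \<sigma>. norm (q p) \<le> norm ((\<bar>q p1\<bar> / B p0) * B p)"
      using B0 m by (intro AE_I2) (simp add: abs_mult)
  qed
qed

text \<open>The area density is positive on the chart image, so measure zero would make a nonempty
  open subset of Euclidean space negligible.\<close>

lemma emeasure_open_pos:
  assumes "open U" "U \<noteq> {}"
  shows "emeasure \<sigma> U \<noteq> 0"
proof
  assume zero: "emeasure \<sigma> U = 0"
  obtain p where p: "p \<in> U" using assms by auto
  define c where "c = chart_at A p"
  have c: "c \<in> A" "p \<in> fst c" using chart_at by (simp_all add: c_def)
  interpret C: local_immersion "chart_image c" "local_param F c" by (rule local_immersion_chart[OF c(1)])
  let ?V = "chart_image c \<inter> chart_inv c -` U"
  note [measurable] = measurable_area_density[OF c(1)]
  have oV: "open ?V" by (rule open_chart_preimage[OF c(1) assms(1)])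
  have V[measurable]: "?V \<in> sets borel" using oV by simp
  have "emeasure \<sigma> (fst c \<inter> U) = 0"
    using zero emeasure_mono[of "fst c \<inter> U" U \<sigma>] assms(1) by (simp add: sets_sigma)
  moreover have "fst c \<inter> U \<in> sets borel" "fst c \<inter> U \<subseteq> fst c"
    using assms(1) open_chart(1)[OF c(1)] by auto
  ultimately have "(\<integral>\<^sup>+y\<in>snd c ` (fst c \<inter> U). ennreal (sqrt (det (metric_matrix (local_param F c) y))) \<partial>lborel) = 0"
    using volume_chart[OF c(1), of "fst c \<inter> U"] by simp
  moreover have "snd c ` (fst c \<inter> U) = ?V"
    by (rule chart_image_Int[OF c(1)])
  moreover have "ennreal (sqrt (det (metric_matrix (local_param F c) y))) * indicator ?V y
      = ennreal (area_density c y) * indicator ?V y" for y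
    by (auto simp: indicator_def area_density_def)
  ultimately have "(\<integral>\<^sup>+y. ennreal (area_density c y) * indicator ?V y \<partial>lborel) = 0" by simp
  then have "AE y in lborel. ennreal (area_density c y) * indicator ?V y = 0"
    by (subst (asm) nn_integral_0_iff_AE) auto
  then have "AE y in lborel. y \<notin> ?V"
  proof (rule AE_mp, intro AE_I2 impI)
    fix y assume "ennreal (area_density c y) * indicator ?V y = 0"
    then show "y \<notin> ?V"
      using C.det_metric_pos[of y] by (auto simp: indicator_def area_density_def split: if_splits)
  qed
  then have "?V \<in> null_sets lborel"
    using AE_iff_null_sets[of ?V lborel] by simp
  then have "negligible ?V"
    using null_sets_completionI negligible_iff_null_sets by blast
  moreover have "?V \<noteq> {}" using c p chart_in_image[OF c(2)] by (auto simp: chart_inv_chart)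
  ultimately show False using open_not_negligible[OF oV] by blast
qed

lemma continuous_nonneg_integral_eq_0:
  assumes "continuous_on UNIV q" "integrable \<sigma> q" "\<And>p. q p \<ge> 0" "integral\<^sup>L \<sigma> q = 0"
  shows "q p = (0::real)"
proof -
  have "AE p in \<sigma>. q p = 0"
    using integral_nonneg_eq_0_iff_AE[OF assms(2)] assms(3,4) by simp
  moreover have o: "open {p. q p \<noteq> 0}"
    by (rule open_Collect_neq[OF assms(1) continuous_on_const])
  ultimately have "emeasure \<sigma> {p. q p \<noteq> 0} = 0"
    using AE_iff_measurable[of "{p. q p \<noteq> 0}" \<sigma> "\<lambda>p. q p = 0"] by (simp add: sets_sigma space_sigma)
  then show ?thesis using emeasure_open_pos[OF o] by blast
qed

text \<open>The fundamental lemma of the calculus of variations: a bump supported where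
  \<open>q\<close> is positive would have a positive integral against it. The same applies to
  \<open>- q\<close>.\<close>

lemma test_functions_dense:
  assumes q: "continuous_on UNIV q" and orth: "\<And>u. test_function A u \<Longrightarrow> (LINT p|\<sigma>. u p * q p) = 0"
  shows "q p = (0::real)"
proof -
  have pos: False if r: "continuous_on UNIV r" and orth: "\<And>u. test_function A u \<Longrightarrow> (LINT p|\<sigma>. u p * r p) = 0"
    and p: "r p > 0" for r :: "'m \<Rightarrow> real" and p
  proof -
    have op: "open {q. r q > 0}" by (rule open_Collect_less[OF continuous_on_const r])
    obtain b :: "'m \<Rightarrow> real" and K c where b: "smooth_map A b" "\<And>q. b q \<ge> 0" "b p > 0" "compact K" "K \<subseteq> {q. r q > 0}"
      "c \<in> A" "K \<subseteq> fst c" "\<And>q. q \<notin> K \<Longrightarrow> b q = 0"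
      by (rule exists_bump[OF op, of p]) (use p that in \<open>blast+\<close>)
    have nonneg: "b q * r q \<ge> 0" for q
    proof (cases "q \<in> K")
      case True
      then have "r q > 0" using b(5) by auto
      then show ?thesis using b(2)[of q] by simp
    qed (simp add: b(8))
    have cont: "continuous_on UNIV (\<lambda>q. b q * r q)"
      by (intro continuous_on_mult smooth_map_continuous b r)
    have "b p * r p = 0"
      by (rule continuous_nonneg_integral_eq_0[OF cont integrable_compact_support[OF cont b(4)] nonneg orth])
        (auto simp: b(8) intro: test_functionI[OF b(1,4,8)])
    then show False using b(3) p by simp
  qed
  have "\<not> q p > 0" using pos[OF q orth] by blast
  moreover have "\<not> - q p > 0"
    using pos[of "\<lambda>p. - q p" p] q orth by (auto intro: continuous_on_minus)
  ultimately show ?thesis by linarith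
qed

end


subsection \<open>The divergence theorem\<close>

locale proper_self_expander = riemannian_immersion A F \<sigma>
  for A :: "('m::{t2_space, second_countable_topology}, 'n::finite) chart set" and F :: "'m \<Rightarrow> 'b::euclidean_space"
    and \<sigma> :: "'m measure" +
  assumes expander: "self_expander A F" and proper: "properly_immersed F"
begin

abbreviation "A2 \<equiv> second_ff_norm_sq A F"

text \<open>Taken from the mean curvature vector, so no choice of a normal is involved.\<close>

definition H2 :: "'m \<Rightarrow> real" where
  "H2 p = (norm (mean_curvature_vector A F p))\<^sup>2"

lemma H2_nonneg: "H2 p \<ge> 0"
  by (simp add: H2_def)

lemma continuous_H2: "continuous_on UNIV H2"
  unfolding H2_def[abs_def] by (intro continuous_on_power continuous_on_norm continuous_mean_curvature_vector)

lemma nu_eq_mean_curvature_vector: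
  assumes c: "c \<in> A" "p \<in> fst c"
  shows "local_immersion.nu (local_param F c) (snd c p) = mean_curvature_vector A F p"
proof -
  interpret C: local_immersion "chart_image c" "local_param F c" by (rule local_immersion_chart[OF c(1)])
  have "local_param F c (snd c p) = F p" by (simp add: local_param_def chart_inv_chart[OF c])
  then show ?thesis
    using expander C.nu_eq_normal_part[OF chart_in_image[OF c(2)]]
    by (simp add: self_expander_def tangent_at_chart[OF c])
qed

lemma rho_chart: "rho \<circ> chart_inv c = (\<lambda>y. (norm (local_param F c y))\<^sup>2 / 4)"
  by (simp add: fun_eq_iff rho_def local_param_def)

lemma Gamma_rho_chart:
  assumes c: "c \<in> A" "p \<in> fst c" and u: "smooth_map A u"
  shows "Gamma u rho p = (\<Sum>j\<in>UNIV. coord_deriv (u \<circ> chart_inv c) j (snd c p)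
    * local_immersion.V (local_param F c) j (snd c p))"
proof -
  interpret C: local_immersion "chart_image c" "local_param F c" by (rule local_immersion_chart[OF c(1)])
  note y = chart_in_image[OF c(2)]
  have "Gamma u rho p = Gamma rho u p" by (rule Gamma_commute)
  also have "\<dots> = (\<Sum>j\<in>UNIV. coord_deriv (u \<circ> chart_inv c) j (snd c p) * C.V j (snd c p))"
    unfolding Gamma_chart[OF c smooth_rho u] contract_def vec_lambda_beta rho_chart C.coord_deriv_norm_sq[OF y] C.V_def
    by (subst sum.swap) (simp add: sum_distrib_left sum_divide_distrib mult_ac)
  finally show ?thesis .
qed

text \<open>The gradient of \<open>rho\<close> is the tangential part of half the position vector;
  the expander equation identifies the normal part with the mean curvature vector.\<close>

lemma Gamma_rho_rho: "Gamma rho rho p = rho p - H2 p"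
proof -
  define c where "c = chart_at A p"
  have c: "c \<in> A" "p \<in> fst c" using chart_at by (simp_all add: c_def)
  interpret C: local_immersion "chart_image c" "local_param F c" by (rule local_immersion_chart[OF c(1)])
  have "local_param F c (snd c p) = F p" by (simp add: local_param_def chart_inv_chart[OF c])
  then show ?thesis
    unfolding Gamma_rho_chart[OF c smooth_rho] rho_chart C.grad_norm_sq_quarter[OF chart_in_image[OF c(2)]]
      nu_eq_mean_curvature_vector[OF c]
    by (simp add: rho_def H2_def dot_square_norm)
qed

text \<open>The divergence of \<open>u\<close> times the gradient of \<open>rho\<close>, with the
  Laplacian of \<open>rho\<close> already evaluated.\<close>

definition div_rho :: "('m \<Rightarrow> real) \<Rightarrow> 'm \<Rightarrow> real" where
  "div_rho u p = Gamma u rho p + u p * (real CARD('n) / 2 + H2 p)"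

lemma continuous_div_rho: "smooth_map A u \<Longrightarrow> continuous_on UNIV (div_rho u)"
  unfolding div_rho_def[abs_def]
  by (intro continuous_on_add continuous_on_mult continuous_Gamma continuous_on_const continuous_H2
      smooth_map_continuous smooth_rho)

lemma div_rho_outside:
  assumes "compact K" "\<And>q. q \<notin> K \<Longrightarrow> u q = 0" "p \<notin> K"
  shows "div_rho u p = 0"
  using Gamma_local_zero[of "- K" p u rho] assms
  by (simp add: div_rho_def compact_imp_closed open_Compl)

lemma integral_div_rho_chart:
  assumes c: "c \<in> A" and u: "smooth_map A u" and K: "compact K" "K \<subseteq> fst c" and supp: "\<And>q. q \<notin> K \<Longrightarrow> u q = 0"
  shows "integral\<^sup>L \<sigma> (div_rho u) = 0"
proof -
  interpret C: local_immersion "chart_image c" "local_param F c" by (rule local_immersion_chart[OF c])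
  have "integral\<^sup>L \<sigma> (div_rho u) = (LINT y|lborel. area_density c y * div_rho u (chart_inv c y))"
    by (rule chart_integral(1)[OF c borel_measurable_continuous_onI[OF continuous_div_rho[OF u]]])
      (rule div_rho_outside[OF K(1) supp], assumption, rule contra_subsetD[OF K(2)])
  also have "\<dots> = (LINT y|lborel. indicator (chart_image c) y *
    (((\<Sum>j\<in>UNIV. coord_deriv (u \<circ> chart_inv c) j y * C.V j y)
      + (u \<circ> chart_inv c) y * (real CARD('n) / 2 + C.nu y \<bullet> C.H_vec y)) * C.W y))"
  proof (rule Bochner_Integration.integral_cong[OF refl])
    fix y
    show "area_density c y * div_rho u (chart_inv c y) = indicator (chart_image c) y *
      (((\<Sum>j\<in>UNIV. coord_deriv (u \<circ> chart_inv c) j y * C.V j y)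
        + (u \<circ> chart_inv c) y * (real CARD('n) / 2 + C.nu y \<bullet> C.H_vec y)) * C.W y)"
    proof (cases "y \<in> chart_image c")
      case True
      note p = chart_inv_in[OF c True] and y = chart_chart_inv[OF c True]
      show ?thesis
        using nu_eq_mean_curvature_vector[OF c p] mean_curvature_vector_chart[OF c p]
        by (simp add: True div_rho_def Gamma_rho_chart[OF c p u] y area_density_def C.W_def H2_def dot_square_norm)
    qed (simp add: area_density_def)
  qed
  also have "\<dots> = 0"
  proof (rule C.integral_divergence_V[OF smooth_map_chart[OF u c]])
    show "compact (snd c ` K)"
      by (rule compact_continuous_image[OF continuous_on_subset[OF continuous_chart[OF c] K(2)] K(1)])
    show "snd c ` K \<subseteq> chart_image c" using K(2) by (auto simp: chart_image_def)
    show "(u \<circ> chart_inv c) y = 0" if y: "y \<in> chart_image c - snd c ` K" for y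
    proof -
      have "chart_inv c y \<notin> K"
      proof
        assume "chart_inv c y \<in> K"
        then have "snd c (chart_inv c y) \<in> snd c ` K" by (rule imageI)
        then show False using y by (simp add: chart_chart_inv[OF c])
      qed
      then show ?thesis by (simp add: supp)
    qed
  qed
  finally show ?thesis .
qed

lemma integral_div_rho:
  assumes "test_function A u"
  shows "integral\<^sup>L \<sigma> (div_rho u) = 0"
proof -
  obtain K where u: "smooth_map A u" and K: "compact K" "\<And>q. q \<notin> K \<Longrightarrow> u q = 0"
    using test_functionE[OF assms] by blast
  obtain I :: "'m set" and b :: "'m \<Rightarrow> 'm \<Rightarrow> real" and L c where b: "finite I"
    "\<And>i. smooth_map A (b i)" "\<And>i q. b i q \<ge> 0" "\<And>i. compact (L i)" "\<And>i. c i \<in> A" "\<And>i. L i \<subseteq> fst (c i)"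
    "\<And>i q. q \<notin> L i \<Longrightarrow> b i q = 0" "\<And>q. q \<in> K \<Longrightarrow> (\<Sum>i\<in>I. b i q) > 0"
    using finite_bump_cover[OF K(1)] by blast
  define B where "B p = (\<Sum>i\<in>I. b i p)" for p
  have sB: "smooth_map A B" unfolding B_def by (rule smooth_map_sum) (rule b(2))
  \<comment> \<open>Wherever \<open>B\<close> vanishes the point lies outside \<open>K\<close>, so
    \<open>u\<close> vanishes too and the quotient is harmlessly 0. On \<open>K\<close> the sum
    \<open>B\<close> is positive, which gives smoothness there.\<close>
  define v where "v i p = u p * b i p / B p" for i p
  have sv: "smooth_map A (v i)" for i
  proof (rule smooth_map_local)
    fix p
    show "\<exists>U. open U \<and> p \<in> U \<and> (\<forall>c\<in>A. smooth_on (chart_image c \<inter> chart_inv c -` U) (v i \<circ> chart_inv c))"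
    proof (cases "p \<in> K")
      case True
      have o: "open {q. B q > 0}"
        by (rule open_Collect_less[OF continuous_on_const smooth_map_continuous[OF sB]])
      have "smooth_on (chart_image c \<inter> chart_inv c -` {q. B q > 0})
          (\<lambda>y. (u \<circ> chart_inv c) y * (b i \<circ> chart_inv c) y / (B \<circ> chart_inv c) y)" if c: "c \<in> A" for c
        by (intro smooth_on_divide smooth_on_mult open_chart_preimage[OF c o]
            smooth_on_subset[OF smooth_map_chart[OF u c]] smooth_on_subset[OF smooth_map_chart[OF b(2) c]]
            smooth_on_subset[OF smooth_map_chart[OF sB c]]) auto
      then have "\<forall>c\<in>A. smooth_on (chart_image c \<inter> chart_inv c -` {q. B q > 0}) (v i \<circ> chart_inv c)"
        by (simp add: v_def[abs_def] o_def)
      then show ?thesis using o b(8)[OF True] by (intro exI[of _ "{q. B q > 0}"]) (simp add: B_def)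
    next
      case False
      have o: "open (- K)" using K(1) by (simp add: compact_imp_closed open_Compl)
      have "smooth_on (chart_image c \<inter> chart_inv c -` (- K)) (v i \<circ> chart_inv c)" if c: "c \<in> A" for c
        by (rule smooth_on_cong[OF open_chart_preimage[OF c o] _ smooth_on_const[of _ 0]]) (simp add: v_def K(2))
      then show ?thesis using o False by (intro exI[of _ "- K"]) auto
    qed
  qed
  have v0: "v i q = 0" if "q \<notin> L i" for i q using b(7)[OF that] by (simp add: v_def)
  have u_eq: "u = (\<lambda>p. \<Sum>i\<in>I. v i p)"
  proof
    fix p
    show "u p = (\<Sum>i\<in>I. v i p)"
    proof (cases "p \<in> K")
      case True
      have "(\<Sum>i\<in>I. v i p) = u p * B p / B p"
        by (simp add: v_def B_def sum_distrib_left sum_divide_distrib)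
      then show ?thesis using b(8)[OF True] by (simp add: B_def)
    qed (simp add: v_def K(2))
  qed
  have "div_rho u = (\<lambda>p. \<Sum>i\<in>I. div_rho (v i) p)"
    using Gamma_sum[OF b(1), of v rho] sv
    by (simp add: fun_eq_iff div_rho_def u_eq sum.distrib sum_distrib_right)
  moreover have "integrable \<sigma> (div_rho (v i))" for i
    by (rule integrable_compact_support[OF continuous_div_rho[OF sv] b(4)])
      (rule div_rho_outside[OF b(4) v0])
  moreover have "integral\<^sup>L \<sigma> (div_rho (v i)) = 0" for i
    by (rule integral_div_rho_chart[OF b(5) sv b(4,6) v0])
  ultimately show ?thesis by simp
qed

text \<open>Properness enters here, and it makes every cut-off in \<open>rho\<close> a test
  function. The absolute value in the radius covers negative \<open>T\<close>.\<close>

lemma compact_sublevel_rho: "compact {p. rho p \<le> T}"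
proof -
  have "compact (F -` cball 0 (sqrt (4 * \<bar>T\<bar>)))"
    using proper by (simp add: properly_immersed_def)
  moreover have "closed {p. rho p \<le> T}"
    by (rule closed_Collect_le[OF smooth_map_continuous[OF smooth_rho] continuous_on_const])
  moreover have "{p. rho p \<le> T} \<subseteq> F -` cball 0 (sqrt (4 * \<bar>T\<bar>))"
    by (auto simp: rho_def intro!: real_le_rsqrt)
  ultimately show ?thesis
    using compact_Int_closed by (metis inf.absorb2)
qed

lemma test_function_cutoff:
  assumes g: "smooth_on UNIV g" and supp: "\<And>t. t \<ge> T \<Longrightarrow> g t = 0"
  shows "test_function A (\<lambda>p. g (rho p))"
  by (rule test_functionI[OF smooth_map_real_compose[OF smooth_rho g] compact_sublevel_rho[of T]])
    (simp add: supp)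

end


subsection \<open>The weighted spectrum\<close>

lemma ext_integral_eq:
  assumes "integrable M f"
  shows "ext_integral M f = ereal (integral\<^sup>L M f)"
proof -
  have fin: "(\<integral>\<^sup>+x. ennreal (f x) \<partial>M) < \<infinity>" "(\<integral>\<^sup>+x. ennreal (- f x) \<partial>M) < \<infinity>"
    using assms unfolding real_integrable_def by (auto simp: top.not_eq_extremum)
  then obtain x y where xy: "(\<integral>\<^sup>+x. ennreal (f x) \<partial>M) = ennreal x" "x \<ge> 0"
    "(\<integral>\<^sup>+x. ennreal (- f x) \<partial>M) = ennreal y" "y \<ge> 0"
    by (metis infinity_ennreal_def less_top_ennreal)
  then show ?thesis
    unfolding ext_integral_def real_lebesgue_integral_def[OF assms] by (simp add: enn2ereal_ennreal)
qed

lemma bounded_monotone_convergence: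
  fixes f :: "nat \<Rightarrow> 'a \<Rightarrow> real"
  assumes f: "\<And>n. integrable M (f n)" and mono: "\<And>n m x. n \<le> m \<Longrightarrow> f n x \<le> f m x"
    and lim: "\<And>x. (\<lambda>n. f n x) \<longlonglongrightarrow> g x" and bound: "\<And>n. integral\<^sup>L M (f n) \<le> B"
    and meas: "g \<in> borel_measurable M"
  shows "integrable M g"
proof -
  have "incseq (\<lambda>n. integral\<^sup>L M (f n))"
    by (intro incseq_SucI integral_mono f mono) simp
  then obtain L where "(\<lambda>n. integral\<^sup>L M (f n)) \<longlonglongrightarrow> L"
    using incseq_convergent[of "\<lambda>n. integral\<^sup>L M (f n)" B] bound by blast
  then show ?thesis
    by (intro integrable_monotone_convergence[OF f _ _ _ meas]) (auto simp: mono_def mono lim)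
qed

lemma integral_quadratic:
  fixes f g h :: "'a \<Rightarrow> real"
  assumes "integrable M f" "integrable M g" "integrable M h"
  shows "(LINT x|M. f x + 2 * t * g x + t\<^sup>2 * h x)
    = integral\<^sup>L M f + 2 * t * integral\<^sup>L M g + t\<^sup>2 * integral\<^sup>L M h"
  using assms by simp

lemma linear_coefficient_eq_0:
  fixes L b :: real
  assumes "\<And>t. 0 \<le> 2 * t * L + t\<^sup>2 * b"
  shows "L = 0"
proof (rule ccontr)
  assume "L \<noteq> 0"
  \<comment> \<open>Positive and at least \<open>b\<close>, so at \<open>t = - (L / B)\<close> the
    quadratic is at most \<open>- L\<^sup>2 / B\<close>, which is negative.\<close>
  define B where "B = \<bar>b\<bar> + 1"
  have B: "B > 0" "b \<le> B" by (simp_all add: B_def)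
  have "(L / B)\<^sup>2 * b \<le> (L / B)\<^sup>2 * B" using B(2) by (intro mult_left_mono) auto
  moreover have "2 * (- (L / B)) * L = - 2 * ((L / B)\<^sup>2 * B)"
    using B(1) by (simp add: power2_eq_square)
  moreover have "(L / B)\<^sup>2 * B > 0" using B(1) \<open>L \<noteq> 0\<close> by simp
  ultimately show False using assms[of "- (L / B)"] by simp
qed

text \<open>The inverse metric is the Gram matrix of the dual frame \<open>e\<close>. Expanding
  those inner products in the ambient basis splits the contraction into sums
  \<open>contract (inv_metric X y) (\<chi> i k. c b i * c b k)\<close>, each nonnegative.\<close>

lemma (in local_immersion) contract2_inv_metric_nonneg:
  assumes y: "y \<in> S"
  shows "contract2 (inv_metric X y) B \<ge> 0"
proof -
  define e where "e j = (\<Sum>a\<in>UNIV. gi y j a *\<^sub>R D a y)" for j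
  have e: "gi y j l = e j \<bullet> e l" for j l
  proof -
    have "e j \<bullet> e l = (\<Sum>a\<in>UNIV. gi y j a * (\<Sum>b\<in>UNIV. gi y l b * g y a b))"
      unfolding e_def inner_sum_left inner_sum_right g_eq
      by (simp add: sum_distrib_left, subst sum.swap, simp add: mult_ac)
    then show ?thesis
      by (simp add: sum_gi_g'[OF y] if_distrib[of "\<lambda>x. _ * x"] cong: if_cong)
  qed
  define c where "c b i = (\<Sum>j\<in>UNIV. (e j \<bullet> b) * B $ i $ j)" for b i
  have c: "contract (inv_metric X y) (\<chi> i k. c b i * c b k)
    = (\<Sum>i\<in>UNIV. \<Sum>j\<in>UNIV. \<Sum>k\<in>UNIV. \<Sum>l\<in>UNIV. gi y i k * ((e j \<bullet> b) * (e l \<bullet> b)) * (B $ i $ j * B $ k $ l))" for b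
  proof -
    have "contract (inv_metric X y) (\<chi> i k. c b i * c b k)
      = (\<Sum>i\<in>UNIV. \<Sum>k\<in>UNIV. \<Sum>j\<in>UNIV. \<Sum>l\<in>UNIV. gi y i k * ((e j \<bullet> b) * (e l \<bullet> b)) * (B $ i $ j * B $ k $ l))"
      unfolding contract_def vec_lambda_beta c_def sum_product
      unfolding sum_distrib_left
      by (intro sum.cong refl) (simp only: mult_ac)
    also have "\<dots> = (\<Sum>i\<in>UNIV. \<Sum>j\<in>UNIV. \<Sum>k\<in>UNIV. \<Sum>l\<in>UNIV. gi y i k * ((e j \<bullet> b) * (e l \<bullet> b)) * (B $ i $ j * B $ k $ l))"
      by (intro sum.cong refl sum.swap)
    finally show ?thesis .
  qed
  have "contract2 (inv_metric X y) B
    = (\<Sum>i\<in>UNIV. \<Sum>j\<in>UNIV. \<Sum>k\<in>UNIV. \<Sum>l\<in>UNIV. \<Sum>b\<in>Basis. gi y i k * ((e j \<bullet> b) * (e l \<bullet> b)) * (B $ i $ j * B $ k $ l))"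
    unfolding contract2_def
    by (intro sum.cong refl) (simp add: e[of _ _, symmetric] sum_distrib_left[symmetric] sum_distrib_right[symmetric] euclidean_inner[symmetric])
  also have "\<dots> = (\<Sum>b\<in>Basis. contract (inv_metric X y) (\<chi> i k. c b i * c b k))"
    unfolding c by (rule sym, (subst sum.swap, rule sum.cong[OF refl])+, rule refl)
  also have "\<dots> \<ge> 0" by (intro sum_nonneg contract_inv_metric_nonneg[OF y])
  finally show ?thesis .
qed

text \<open>In codimension one the normal space is a line. A nonzero part of \<open>w\<close>
  orthogonal to \<open>N\<close> would, together with \<open>N\<close>, give two independent normal
  vectors.\<close>

lemma (in local_immersion) inner_unit_normal_sq:
  assumes codim: "DIM('b) = CARD('n) + 1" and y: "y \<in> S"
    and w: "w \<in> (tangent_space X y)\<^sup>\<bottom>" and N: "N \<in> (tangent_space X y)\<^sup>\<bottom>" "norm N = 1"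
  shows "(w \<bullet> N)\<^sup>2 = (norm w)\<^sup>2"
proof -
  let ?T = "tangent_space X y"
  have "linear (frechet_derivative X (at y))"
    using has_derivative_linear smooth_on_differentiable[OF smooth y] frechet_derivative_works by blast
  then have "dim ?T = CARD('n)"
    using dim_image_eq[of "frechet_derivative X (at y)" UNIV] immersive[OF y]
    by (simp add: tangent_space_def inj_on_subset dim_UNIV)
  then have "dim (?T\<^sup>\<bottom>) = 1"
    using dim_subspace_orthogonal_to_vectors[OF subspace_tangent_space[OF y] subspace_UNIV subset_UNIV] codim
    by (simp add: orthogonal_comp_def dim_UNIV)
  define v where "v = w - (w \<bullet> N) *\<^sub>R N"
  have v: "v \<in> ?T\<^sup>\<bottom>"
    unfolding v_def by (intro subspace_diff subspace_scale subspace_orthogonal_comp w N)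
  have NN: "N \<bullet> N = 1" using N(2) by (simp add: dot_square_norm)
  have vN: "v \<bullet> N = 0" by (simp add: v_def inner_diff_left NN)
  have "v = 0"
  proof (rule ccontr)
    assume "v \<noteq> 0"
    have "v \<noteq> N" using vN NN by auto
    have "N \<noteq> 0" using NN by auto
    have "pairwise orthogonal {v, N}"
      using vN by (auto simp: pairwise_def orthogonal_def inner_commute)
    then have "independent {v, N}"
      using \<open>v \<noteq> 0\<close> \<open>N \<noteq> 0\<close> by (intro pairwise_orthogonal_independent) auto
    then have "card {v, N} \<le> dim (?T\<^sup>\<bottom>)"
      using v N(1) by (intro independent_card_le_dim) auto
    then show False using \<open>dim (?T\<^sup>\<bottom>) = 1\<close> \<open>v \<noteq> N\<close> by simp
  qed
  then have "w = (w \<bullet> N) *\<^sub>R N" by (simp add: v_def)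
  then have "norm w = \<bar>w \<bullet> N\<bar>" using N(2) by (metis norm_scaleR mult.right_neutral)
  then show ?thesis by simp
qed

context proper_self_expander
begin

section \<open>The Gaussian weight and the cut-offs\<close>

definition wt :: "'m \<Rightarrow> real" where
  "wt p = exp (- rho p)"

lemma wt_pos: "wt p > 0"
  by (simp add: wt_def)

lemma smooth_exp_uminus: "smooth_on UNIV (\<lambda>t::real. exp (- t))"
  by (rule smooth_on_real_compose[OF open_UNIV
        smooth_on_bounded_linear[OF bounded_linear_minus[OF bounded_linear_ident]] smooth_on_exp])

lemma smooth_wt: "smooth_map A wt"
  unfolding wt_def[abs_def] by (rule smooth_map_real_compose[OF smooth_rho smooth_exp_uminus])

lemma Gamma_wt: "Gamma wt v p = - wt p * Gamma rho v p"
proof -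
  have "((\<lambda>t. exp (- t)) has_real_derivative - exp (- rho p)) (at (rho p))"
    by (auto intro!: derivative_eq_intros)
  from Gamma_compose[OF smooth_rho this] show ?thesis by (simp add: wt_def[abs_def])
qed

lemma continuous_wt: "continuous_on UNIV wt"
  by (rule smooth_map_continuous[OF smooth_wt])

lemma continuous_rho: "continuous_on UNIV rho"
  by (rule smooth_map_continuous[OF smooth_rho])

lemma H2_le_rho: "H2 p \<le> rho p"
  using Gamma_nonneg[of rho p] Gamma_rho_rho[of p] by simp

text \<open>Supported in \<open>rho \<le> n + 1\<close>. Scaling by \<open>Suc n\<close> avoids
  division by zero and makes the slope in \<open>rho\<close> of order \<open>1 / n\<close>.\<close>

definition cutoff :: "nat \<Rightarrow> 'm \<Rightarrow> real" where
  "cutoff n p = smooth_step (1 - rho p / real (Suc n))"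

lemma smooth_cutoff_profile: "smooth_on UNIV (\<lambda>t. smooth_step (1 - t / real (Suc n)))"
proof -
  have "smooth_on UNIV (\<lambda>t::real. 1 - t * (1 / real (Suc n)))"
    by (intro smooth_on_diff smooth_on_mult smooth_on_const open_UNIV
        smooth_on_bounded_linear[OF bounded_linear_ident])
  then show ?thesis
    using smooth_on_real_compose[OF open_UNIV _ smooth_on_smooth_step] by simp
qed

lemma test_function_cutoff_n: "test_function A (cutoff n)"
  unfolding cutoff_def[abs_def]
  by (rule test_function_cutoff[OF smooth_cutoff_profile, of "real (Suc n)"])
    (simp add: smooth_step_eq_0)

lemma smooth_cutoff: "smooth_map A (cutoff n)"
  using test_function_cutoff_n by (simp add: test_function_def)

lemma continuous_cutoff: "continuous_on UNIV (cutoff n)"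
  by (rule smooth_map_continuous[OF smooth_cutoff])

text \<open>Minus the derivative of the cut-off profile with respect to \<open>rho\<close>;
  \<open>flat_exp 2\<close> is the derivative of \<open>smooth_step\<close>.\<close>

definition cutoff_slope :: "nat \<Rightarrow> 'm \<Rightarrow> real" where
  "cutoff_slope n p = flat_exp 2 (1 - rho p / real (Suc n)) / real (Suc n)"

lemma cutoff_slope_bounds: "0 \<le> cutoff_slope n p" "cutoff_slope n p \<le> 256 / real (Suc n)"
  using flat_exp_nonneg flat_exp_2_bounded[of "1 - rho p / real (Suc n)"] rho_nonneg[of p]
  by (simp_all add: cutoff_slope_def divide_right_mono)

lemma Gamma_cutoff: "Gamma (cutoff n) v p = - cutoff_slope n p * Gamma rho v p"
proof -
  have "((\<lambda>t. 1 - t / real (Suc n)) has_real_derivative - (1 / real (Suc n))) (at (rho p))"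
    by (auto intro!: derivative_eq_intros)
  from DERIV_chain2[OF smooth_step_deriv this]
  have "((\<lambda>t. smooth_step (1 - t / real (Suc n))) has_real_derivative - cutoff_slope n p) (at (rho p))"
    by (simp add: cutoff_slope_def)
  from Gamma_compose[OF smooth_rho this] show ?thesis by (simp add: cutoff_def[abs_def])
qed

abbreviation "s1 \<equiv> smooth_step 1"

lemma s1_pos: "s1 > 0" by (simp add: smooth_step_pos_iff)

lemma cutoff_nonneg: "cutoff n p \<ge> 0"
  by (simp add: cutoff_def smooth_step_nonneg)

lemma cutoff_le: "cutoff n p \<le> s1"
  unfolding cutoff_def by (rule smooth_step_mono) (simp add: rho_nonneg)

lemma cutoff_mono: "n \<le> m \<Longrightarrow> cutoff n p \<le> cutoff m p"
  unfolding cutoff_def by (rule smooth_step_mono) (simp add: rho_nonneg divide_left_mono)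

lemma cutoff_tendsto: "(\<lambda>n. cutoff n p) \<longlonglongrightarrow> s1"
proof -
  have "(\<lambda>n. 1 - rho p * inverse (real (Suc n))) \<longlonglongrightarrow> 1 - rho p * 0"
    by (intro tendsto_diff tendsto_const tendsto_mult LIMSEQ_inverse_real_of_nat)
  then have "(\<lambda>n. 1 - rho p / real (Suc n)) \<longlonglongrightarrow> 1" by (simp add: divide_inverse)
  from isCont_tendsto_compose[OF DERIV_isCont[OF smooth_step_deriv] this]
  show ?thesis by (simp add: cutoff_def)
qed

lemma integrable_test:
  assumes u: "test_function A u" and r: "continuous_on UNIV r"
  shows "integrable \<sigma> (\<lambda>p. u p * r p)"
proof -
  obtain K where K: "smooth_map A u" "compact K" "\<And>q. q \<notin> K \<Longrightarrow> u q = 0"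
    using test_functionE[OF u] by blast
  show ?thesis
    by (rule integrable_compact_support[OF continuous_on_mult[OF smooth_map_continuous[OF K(1)] r] K(2)])
      (simp add: K(3))
qed

lemma integrable_test_sq:
  assumes u: "test_function A u" and r: "continuous_on UNIV r"
  shows "integrable \<sigma> (\<lambda>p. (u p)\<^sup>2 * r p)"
proof -
  have "continuous_on UNIV u" using u by (simp add: test_function_def smooth_map_continuous)
  from integrable_test[OF u continuous_on_mult[OF this r]] show ?thesis
    by (simp add: power2_eq_square mult.assoc)
qed

lemma integrable_Gamma_test:
  assumes u: "test_function A u" and v: "smooth_map A v" and r: "continuous_on UNIV r"
  shows "integrable \<sigma> (\<lambda>p. Gamma u v p * r p)"
proof -
  obtain K where K: "smooth_map A u" "compact K" "\<And>q. q \<notin> K \<Longrightarrow> u q = 0"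
    using test_functionE[OF u] by blast
  show ?thesis
  proof (rule integrable_compact_support[OF continuous_on_mult[OF continuous_Gamma[OF K(1) v] r] K(2)])
    fix p assume "p \<notin> K"
    then have "Gamma u v p = 0"
      using Gamma_local_zero[of "- K" p u v] K by (simp add: compact_imp_closed open_Compl)
    then show "Gamma u v p * r p = 0" by simp
  qed
qed

lemma test_function_mult:
  assumes u: "test_function A u" and v: "smooth_map A (v :: 'm \<Rightarrow> real)"
  shows "test_function A (\<lambda>p. u p * v p)"
proof -
  obtain K where K: "smooth_map A u" "compact K" "\<And>q. q \<notin> K \<Longrightarrow> u q = 0"
    using test_functionE[OF u] by blast
  show ?thesis by (rule test_functionI[OF smooth_map_mult[OF K(1) v] K(2)]) (simp add: K(3))
qed

lemma test_function_add:
  assumes u: "test_function A u" and v: "test_function A v"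
  shows "test_function A (\<lambda>p. u p + v p)"
proof -
  obtain K where K: "smooth_map A u" "compact K" "\<And>q. q \<notin> K \<Longrightarrow> u q = 0"
    using test_functionE[OF u] by blast
  obtain L where L: "smooth_map A v" "compact L" "\<And>q. q \<notin> L \<Longrightarrow> v q = 0"
    using test_functionE[OF v] by blast
  show ?thesis
    by (rule test_functionI[OF smooth_map_add[OF K(1) L(1)] compact_Un[OF K(2) L(2)]]) (simp add: K(3) L(3))
qed

text \<open>Differentiating the weight contributes \<open>- (rho p - H2 p)\<close>, which turns
  \<open>H2 p\<close> from the Laplacian of \<open>rho\<close> into
  \<open>2 * H2 p - rho p\<close>.\<close>

lemma div_rho_cutoff_wt:
  "div_rho (\<lambda>p. cutoff n p * wt p) p
    = cutoff n p * wt p * (real CARD('n) / 2 + 2 * H2 p - rho p) - wt p * cutoff_slope n p * (rho p - H2 p)"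
  unfolding div_rho_def Gamma_mult[OF smooth_cutoff smooth_wt] Gamma_wt Gamma_cutoff Gamma_rho_rho
  by (simp add: algebra_simps)

section \<open>The transformed Rayleigh quotient\<close>

text \<open>The quotient of \<open>- L wt\<close> by \<open>wt\<close>; \<open>H2 - A2\<close> is
  the scalar curvature.\<close>

definition energy :: "'m \<Rightarrow> real" where
  "energy p = (real CARD('n) + 1) / 2 + (H2 p - A2 p)"

lemma continuous_energy: "continuous_on UNIV energy"
  unfolding energy_def[abs_def]
  by (intro continuous_on_add continuous_on_diff continuous_on_const continuous_H2 continuous_second_ff_norm_sq)

text \<open>Bilinear rather than quadratic, because the equality case perturbs the cut-offs by a
  test function.\<close>

definition form :: "('m \<Rightarrow> real) \<Rightarrow> ('m \<Rightarrow> real) \<Rightarrow> real" where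
  "form u v = (LINT p|\<sigma>. Gamma u v p * wt p) + (LINT p|\<sigma>. u p * (v p * (wt p * energy p)))"

definition mass :: "('m \<Rightarrow> real) \<Rightarrow> ('m \<Rightarrow> real) \<Rightarrow> real" where
  "mass u v = (LINT p|\<sigma>. u p * (v p * wt p))"

text \<open>
  The ground state substitution \<open>\<phi> = u e\<^sup>-\<^sup>\<rho>\<close> with \<open>\<rho> = |x|\<^sup>2 / 4\<close>: the two integrands differ by the
  divergence of \<open>u\<^sup>2 e\<^sup>-\<^sup>\<rho> \<nabla>\<rho>\<close>.
\<close>

lemma rayleigh_substitution:
  assumes u: "test_function A u"
  defines "\<phi> \<equiv> \<lambda>p. u p * wt p"
  shows "(LINT p|\<sigma>. (grad_norm_sq A F \<phi> p - (A2 p - 1 / 2) * (\<phi> p)\<^sup>2) * exp ((norm (F p))\<^sup>2 / 4)) = form u u"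
    and "(LINT p|\<sigma>. (\<phi> p)\<^sup>2 * exp ((norm (F p))\<^sup>2 / 4)) = mass u u"
proof -
  have su: "smooth_map A u" using u by (simp add: test_function_def)
  have cu: "continuous_on UNIV u" by (rule smooth_map_continuous[OF su])
  have e: "exp ((norm (F p))\<^sup>2 / 4) = inverse (wt p)" for p
    by (simp add: wt_def rho_def exp_minus)
  have w: "wt p \<noteq> 0" for p using wt_pos[of p] by simp
  have t: "test_function A (\<lambda>p. u p * (u p * wt p))"
    by (rule test_function_mult[OF u smooth_map_mult[OF su smooth_wt]])
  have G: "grad_norm_sq A F \<phi> p
      = (wt p)\<^sup>2 * Gamma u u p - 2 * u p * (wt p)\<^sup>2 * Gamma u rho p + (u p)\<^sup>2 * (wt p)\<^sup>2 * Gamma rho rho p" for p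
  proof -
    have l: "Gamma \<phi> v p = wt p * Gamma u v p - u p * wt p * Gamma rho v p" for v
      unfolding \<phi>_def by (simp add: Gamma_mult[OF su smooth_wt] Gamma_wt)
    have a: "Gamma u \<phi> p = wt p * Gamma u u p - u p * wt p * Gamma u rho p"
      unfolding Gamma_commute[of u \<phi>] l by (simp add: Gamma_commute[of rho u])
    have b: "Gamma rho \<phi> p = wt p * Gamma u rho p - u p * wt p * Gamma rho rho p"
      unfolding Gamma_commute[of rho \<phi>] l by simp
    show ?thesis
      unfolding grad_norm_sq_eq l a b by (simp add: power2_eq_square algebra_simps)
  qed
  have D: "div_rho (\<lambda>p. u p * (u p * wt p)) p
      = 2 * u p * wt p * Gamma u rho p - (u p)\<^sup>2 * wt p * Gamma rho rho p
        + (u p)\<^sup>2 * wt p * (real CARD('n) / 2 + H2 p)" for p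
    by (simp add: div_rho_def Gamma_mult[OF su smooth_map_mult[OF su smooth_wt]] Gamma_mult[OF su smooth_wt]
        Gamma_wt power2_eq_square algebra_simps)
  have pt: "(grad_norm_sq A F \<phi> p - (A2 p - 1 / 2) * (\<phi> p)\<^sup>2) * exp ((norm (F p))\<^sup>2 / 4)
      = Gamma u u p * wt p + u p * (u p * (wt p * energy p)) - div_rho (\<lambda>p. u p * (u p * wt p)) p" for p
    unfolding e G D unfolding \<phi>_def energy_def using w[of p] by (simp add: field_simps power2_eq_square)
  have i1: "integrable \<sigma> (\<lambda>p. Gamma u u p * wt p)"
    by (rule integrable_Gamma_test[OF u su continuous_wt])
  have i2: "integrable \<sigma> (\<lambda>p. u p * (u p * (wt p * energy p)))"
    by (rule integrable_test[OF u]) (intro continuous_on_mult cu continuous_wt continuous_energy)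
  have i3: "integrable \<sigma> (div_rho (\<lambda>p. u p * (u p * wt p)))"
    unfolding div_rho_def[abs_def]
    by (intro Bochner_Integration.integrable_add integrable_Gamma_test[OF t smooth_rho continuous_on_const[of _ 1], simplified]
        integrable_test[OF t] continuous_on_add continuous_on_const continuous_H2)
  show "(LINT p|\<sigma>. (grad_norm_sq A F \<phi> p - (A2 p - 1 / 2) * (\<phi> p)\<^sup>2) * exp ((norm (F p))\<^sup>2 / 4)) = form u u"
    unfolding pt form_def using i1 i2 i3 integral_div_rho[OF t] by simp
  show "(LINT p|\<sigma>. (\<phi> p)\<^sup>2 * exp ((norm (F p))\<^sup>2 / 4)) = mass u u"
    unfolding mass_def e \<phi>_def using w by (simp add: power2_eq_square field_simps)
qed

lemma smooth_inverse_wt: "smooth_map A (\<lambda>p. inverse (wt p))"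
  using smooth_map_real_compose[OF smooth_rho smooth_on_exp] by (simp add: wt_def exp_minus)

text \<open>Multiplication by \<open>wt\<close> permutes the test functions, since the inverse of
  \<open>wt\<close> is smooth; the two infima thus range over the same values.\<close>

lemma bottom_spectrum_eq:
  "bottom_spectrum A F \<sigma> = Inf {ereal (form u u / mass u u) |u. test_function A u \<and> mass u u \<noteq> 0}"
proof -
  let ?num = "\<lambda>\<phi>. LINT p|\<sigma>. (grad_norm_sq A F \<phi> p - (A2 p - 1 / 2) * (\<phi> p)\<^sup>2) * exp ((norm (F p))\<^sup>2 / 4)"
    and ?den = "\<lambda>\<phi>. LINT p|\<sigma>. (\<phi> p)\<^sup>2 * exp ((norm (F p))\<^sup>2 / 4)"
  have "\<exists>u. test_function A u \<and> \<phi> = (\<lambda>p. u p * wt p)" if "test_function A \<phi>" for \<phi>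
  proof (intro exI conjI)
    show "test_function A (\<lambda>p. \<phi> p * inverse (wt p))"
      by (rule test_function_mult[OF that smooth_inverse_wt])
    show "\<phi> = (\<lambda>p. \<phi> p * inverse (wt p) * wt p)"
      using wt_pos by (simp add: fun_eq_iff less_imp_neq[symmetric])
  qed
  then have "{ereal (?num \<phi> / ?den \<phi>) |\<phi>. test_function A \<phi> \<and> ?den \<phi> \<noteq> 0}
      = {ereal (?num (\<lambda>p. u p * wt p) / ?den (\<lambda>p. u p * wt p)) |u.
          test_function A u \<and> ?den (\<lambda>p. u p * wt p) \<noteq> 0}"
    using test_function_mult[OF _ smooth_wt] by blast
  also have "\<dots> = {ereal (form u u / mass u u) |u. test_function A u \<and> mass u u \<noteq> 0}"
    by (intro Collect_cong ex_cong1) (auto simp: rayleigh_substitution)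
  finally show ?thesis unfolding bottom_spectrum_def by (rule arg_cong)
qed

section \<open>Integrability against the weight\<close>

text \<open>The bound \<open>1 / 2\<close> keeps the coefficient \<open>1 - 2 * \<theta>\<close> of
  \<open>rho\<close> in \<open>rho - 2 * H2\<close> positive.\<close>

definition growth_bound :: "real \<Rightarrow> real \<Rightarrow> bool" where
  "growth_bound \<theta> C \<longleftrightarrow> \<theta> < 1 / 2 \<and> C \<ge> 0 \<and> (\<forall>p. H2 p \<le> \<theta> * rho p + C)"

lemma integrable_rho_cutoff:
  assumes "continuous_on UNIV g" "\<And>t. t > T \<Longrightarrow> g t = (0::real)"
  shows "integrable \<sigma> (\<lambda>p. g (rho p) * wt p)"
  by (rule integrable_compact_support[OF _ compact_sublevel_rho[of T]])
    (auto intro!: continuous_on_mult continuous_wt continuous_on_compose2[OF assms(1) continuous_rho] simp: assms(2))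

text \<open>
  Testing the divergence identity with \<open>\<eta>(\<rho>) e\<^sup>-\<^sup>\<rho>\<close>, \<open>\<eta>\<close> decreasing: the term with \<open>\<eta>'\<close> has a sign because
  \<open>|\<nabla>\<rho>|\<^sup>2 = \<rho> - H\<^sup>2 \<ge> 0\<close>, and what remains is \<open>\<integral> \<eta> (\<rho> - 2 H\<^sup>2 - n/2) e\<^sup>-\<^sup>\<rho> \<le> 0\<close>. The hypothesis on \<open>H\<close> makes
  \<open>\<rho> - 2 H\<^sup>2\<close> grow linearly in \<open>\<rho>\<close>.
\<close>

lemma integrable_rho_wt:
  assumes "growth_bound \<theta> C"
  shows "integrable \<sigma> wt" "integrable \<sigma> (\<lambda>p. rho p * wt p)"
proof -
  define C1 where "C1 = real CARD('n) / 2 + 2 * C"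
  define \<delta> where "\<delta> = 1 - 2 * \<theta>"
  have C1: "C1 \<ge> 0" and \<delta>: "\<delta> > 0" using assms by (simp_all add: growth_bound_def C1_def \<delta>_def)
  have lower: "\<delta> * rho p - C1 \<le> rho p - 2 * H2 p - real CARD('n) / 2" for p
  proof -
    have "H2 p \<le> \<theta> * rho p + C" using assms by (simp add: growth_bound_def)
    then show ?thesis by (simp add: C1_def \<delta>_def left_diff_distrib)
  qed
  \<comment> \<open>\<open>P\<close> and \<open>N\<close> are the positive and negative parts of the
    lower bound \<open>\<delta> * rho p - C1\<close>. As \<open>N\<close> vanishes for
    \<open>rho\<close> above \<open>C1 / \<delta>\<close>, it is integrable against the weight, and
    the divergence identity bounds \<open>P\<close> by \<open>N\<close>.\<close>
  define P where "P p = max 0 (\<delta> * rho p - C1)" for p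
  define N where "N p = max 0 (C1 - \<delta> * rho p)" for p
  have contP: "continuous_on UNIV P" and contN: "continuous_on UNIV N"
    unfolding P_def[abs_def] N_def[abs_def]
    by (intro continuous_on_max continuous_on_diff continuous_on_mult continuous_on_const continuous_rho)+
  have intN: "integrable \<sigma> (\<lambda>p. N p * wt p)"
    unfolding N_def[abs_def]
  proof (rule integrable_rho_cutoff[of "\<lambda>t. max 0 (C1 - \<delta> * t)" "C1 / \<delta>"])
    show "continuous_on UNIV (\<lambda>t. max 0 (C1 - \<delta> * t))" by (intro continuous_intros)
    show "max 0 (C1 - \<delta> * t) = 0" if "t > C1 / \<delta>" for t
      using that \<delta> by (simp add: pos_divide_less_eq mult.commute)
  qed
  note t = test_function_mult[OF test_function_cutoff_n smooth_wt]
  have intP: "integrable \<sigma> (\<lambda>p. cutoff n p * (P p * wt p))" for n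
    by (rule integrable_test[OF test_function_cutoff_n]) (intro continuous_on_mult contP continuous_wt)
  have intN': "integrable \<sigma> (\<lambda>p. cutoff n p * (N p * wt p))" for n
    by (rule integrable_test[OF test_function_cutoff_n]) (intro continuous_on_mult contN continuous_wt)
  have int_div: "integrable \<sigma> (div_rho (\<lambda>p. cutoff n p * wt p))" for n
  proof -
    obtain K where K: "smooth_map A (\<lambda>p. cutoff n p * wt p)" "compact K"
      "\<And>q. q \<notin> K \<Longrightarrow> cutoff n q * wt q = 0"
      using test_functionE[OF t] by blast
    show ?thesis
      by (rule integrable_compact_support[OF continuous_div_rho[OF K(1)] K(2)])
        (rule div_rho_outside[OF K(2) K(3)])
  qed
  have bound: "(LINT p|\<sigma>. cutoff n p * (P p * wt p)) \<le> s1 * (LINT p|\<sigma>. N p * wt p)" for n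
  proof -
    have "cutoff n p * (P p * wt p) - cutoff n p * (N p * wt p) \<le> - div_rho (\<lambda>p. cutoff n p * wt p) p" for p
    proof -
      have "wt p * cutoff_slope n p * (rho p - H2 p) \<ge> 0"
        using cutoff_slope_bounds(1) wt_pos[of p] H2_le_rho[of p]
        by (intro mult_nonneg_nonneg) (auto intro: less_imp_le)
      moreover have "cutoff n p * wt p * (\<delta> * rho p - C1) \<le> cutoff n p * wt p * (rho p - 2 * H2 p - real CARD('n) / 2)"
        using lower cutoff_nonneg wt_pos[of p] by (intro mult_left_mono mult_nonneg_nonneg) (auto intro: less_imp_le)
      moreover have PN: "P p - N p = \<delta> * rho p - C1" by (simp add: P_def N_def max_def)
      have "cutoff n p * (P p * wt p) - cutoff n p * (N p * wt p) = cutoff n p * wt p * (P p - N p)"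
        by (simp add: algebra_simps)
      ultimately show ?thesis unfolding div_rho_cutoff_wt PN by (simp add: algebra_simps)
    qed
    then have "(LINT p|\<sigma>. cutoff n p * (P p * wt p) - cutoff n p * (N p * wt p))
        \<le> (LINT p|\<sigma>. - div_rho (\<lambda>p. cutoff n p * wt p) p)"
      using intP intN' int_div by (intro integral_mono) auto
    then have "(LINT p|\<sigma>. cutoff n p * (P p * wt p)) \<le> (LINT p|\<sigma>. cutoff n p * (N p * wt p))"
      using intP intN' int_div integral_div_rho[OF t] by simp
    also have "\<dots> \<le> (LINT p|\<sigma>. s1 * (N p * wt p))"
    proof (intro integral_mono mult_right_mono intN' cutoff_le)
      show "0 \<le> N p * wt p" for p using wt_pos[of p] by (simp add: N_def)
      show "integrable \<sigma> (\<lambda>p. s1 * (N p * wt p))" using intN by simp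
    qed
    finally show ?thesis by simp
  qed
  have "integrable \<sigma> (\<lambda>p. s1 * (P p * wt p))"
  proof (rule bounded_monotone_convergence[OF intP _ _ bound])
    show "cutoff n p * (P p * wt p) \<le> cutoff m p * (P p * wt p)" if "n \<le> m" for n m p
      using cutoff_mono[OF that] wt_pos[of p] by (intro mult_right_mono) (auto simp: P_def)
    show "(\<lambda>n. cutoff n p * (P p * wt p)) \<longlonglongrightarrow> s1 * (P p * wt p)" for p
      by (intro tendsto_mult cutoff_tendsto tendsto_const)
    show "(\<lambda>p. s1 * (P p * wt p)) \<in> borel_measurable \<sigma>"
      by (intro borel_measurable_sigma borel_measurable_continuous_onI continuous_on_mult continuous_on_const contP continuous_wt)
  qed
  then have intP: "integrable \<sigma> (\<lambda>p. P p * wt p)" using s1_pos by simp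
  \<comment> \<open>Chosen so that \<open>\<delta> * T - C1 = 1\<close>: beyond \<open>T\<close> one
    has \<open>P \<ge> 1\<close>, and up to \<open>T\<close> the compactly supported
    \<open>max 0 (T + 1 - rho p)\<close> is at least 1. Their sum dominates the constant 1.\<close>
  define T where "T = (C1 + 1) / \<delta>"
  have intM: "integrable \<sigma> (\<lambda>p. max 0 (T + 1 - rho p) * wt p)"
    by (rule integrable_rho_cutoff[of "\<lambda>t. max 0 (T + 1 - t)" "T + 1"])
      (auto intro!: continuous_intros)
  have one: "1 \<le> P p + max 0 (T + 1 - rho p)" for p
  proof (cases "rho p \<le> T")
    case False
    then have "\<delta> * T \<le> \<delta> * rho p" using \<delta> by simp
    then have "1 \<le> P p" using \<delta> by (simp add: P_def T_def)
    then show ?thesis by simp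
  qed (simp add: P_def)
  have meas: "wt \<in> borel_measurable \<sigma>" "(\<lambda>p. rho p * wt p) \<in> borel_measurable \<sigma>"
    by (intro borel_measurable_sigma borel_measurable_continuous_onI continuous_on_mult continuous_rho continuous_wt)+
  show w: "integrable \<sigma> wt"
  proof (rule Bochner_Integration.integrable_bound[OF Bochner_Integration.integrable_add[OF intP intM] meas(1)], rule AE_I2)
    fix p
    have "1 * wt p \<le> (P p + max 0 (T + 1 - rho p)) * wt p"
      using one wt_pos[of p] by (intro mult_right_mono) auto
    then show "norm (wt p) \<le> norm (P p * wt p + max 0 (T + 1 - rho p) * wt p)"
      using wt_pos[of p] by (simp add: distrib_right)
  qed
  show "integrable \<sigma> (\<lambda>p. rho p * wt p)"
  proof (rule Bochner_Integration.integrable_bound[OF _ meas(2)])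
    show "integrable \<sigma> (\<lambda>p. (P p * wt p + C1 * wt p) / \<delta>)" using intP w by simp
    show "AE p in \<sigma>. norm (rho p * wt p) \<le> norm ((P p * wt p + C1 * wt p) / \<delta>)"
    proof (rule AE_I2)
      fix p
      have "\<delta> * rho p \<le> P p + C1" by (simp add: P_def)
      then have "rho p \<le> (P p + C1) / \<delta>" using \<delta> by (simp add: field_simps)
      then have "rho p * wt p \<le> (P p + C1) / \<delta> * wt p" using wt_pos[of p] by (intro mult_right_mono) auto
      moreover have "rho p * wt p \<ge> 0" using rho_nonneg wt_pos[of p] by (intro mult_nonneg_nonneg) (auto intro: less_imp_le)
      ultimately have "norm (rho p * wt p) \<le> (P p * wt p + C1 * wt p) / \<delta>"
        by (simp add: distrib_right)
      then show "norm (rho p * wt p) \<le> norm ((P p * wt p + C1 * wt p) / \<delta>)"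
        unfolding real_norm_def by (rule order_trans[OF _ abs_ge_self])
    qed
  qed
qed

lemma H2_wt_integrable:
  assumes "growth_bound \<theta> C"
  shows "integrable \<sigma> (\<lambda>p. H2 p * wt p)"
proof (rule Bochner_Integration.integrable_bound[OF integrable_rho_wt(2)[OF assms]])
  show "(\<lambda>p. H2 p * wt p) \<in> borel_measurable \<sigma>"
    by (intro borel_measurable_sigma borel_measurable_continuous_onI continuous_on_mult continuous_H2 continuous_wt)
  show "AE p in \<sigma>. norm (H2 p * wt p) \<le> norm (rho p * wt p)"
    using H2_nonneg H2_le_rho rho_nonneg wt_pos by (intro AE_I2) (simp add: abs_mult mult_right_mono)
qed

lemma integral_wt_pos:
  assumes "growth_bound \<theta> C"
  shows "(LINT p|\<sigma>. wt p) > 0"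
proof -
  have "(LINT p|\<sigma>. wt p) \<noteq> 0"
    using continuous_nonneg_integral_eq_0[OF continuous_wt integrable_rho_wt(1)[OF assms]] wt_pos
    by (metis less_imp_le less_irrefl)
  moreover have "(LINT p|\<sigma>. wt p) \<ge> 0" using wt_pos by (intro integral_nonneg_AE AE_I2) (auto intro: less_imp_le)
  ultimately show ?thesis by simp
qed

lemma test_functionD: "test_function A u \<Longrightarrow> smooth_map A u"
  by (simp add: test_function_def)

lemma integrable_form_terms:
  assumes u: "test_function A u" and v: "smooth_map A v"
  shows "integrable \<sigma> (\<lambda>p. Gamma u v p * wt p)" "integrable \<sigma> (\<lambda>p. u p * (v p * (wt p * energy p)))"
    "integrable \<sigma> (\<lambda>p. u p * (v p * wt p))"
  using integrable_Gamma_test[OF u v continuous_wt]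
    integrable_test[OF u continuous_on_mult[OF smooth_map_continuous[OF v] continuous_on_mult[OF continuous_wt continuous_energy]]]
    integrable_test[OF u continuous_on_mult[OF smooth_map_continuous[OF v] continuous_wt]]
  by simp_all

lemma Gamma_scale: "smooth_map A v \<Longrightarrow> Gamma (\<lambda>p. t * v p) w p = t * Gamma v w p"
  using Gamma_compose[of v "\<lambda>x. t * x" t p w] by (simp add: DERIV_cmult_Id)

lemma form_mass_expand:
  assumes u: "test_function A u" and v: "test_function A v"
  shows "form (\<lambda>p. u p + t * v p) (\<lambda>p. u p + t * v p) = form u u + 2 * t * form u v + t\<^sup>2 * form v v"
    and "mass (\<lambda>p. u p + t * v p) (\<lambda>p. u p + t * v p) = mass u u + 2 * t * mass u v + t\<^sup>2 * mass v v"
proof -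
  note su = test_functionD[OF u] and sv = test_functionD[OF v]
  have stv: "smooth_map A (\<lambda>p. t * v p)" by (rule smooth_map_mult[OF smooth_map_const sv])
  have l: "Gamma (\<lambda>p. u p + t * v p) w p = Gamma u w p + t * Gamma v w p" for w p
    unfolding Gamma_add[OF su stv] Gamma_scale[OF sv] ..
  have G: "Gamma (\<lambda>p. u p + t * v p) (\<lambda>p. u p + t * v p) p * wt p
    = Gamma u u p * wt p + 2 * t * (Gamma u v p * wt p) + t\<^sup>2 * (Gamma v v p * wt p)" for p
  proof -
    have 1: "Gamma u (\<lambda>p. u p + t * v p) p = Gamma u u p + t * Gamma u v p"
      unfolding Gamma_commute[of u "\<lambda>p. u p + t * v p"] l Gamma_commute[of v u] ..
    have 2: "Gamma v (\<lambda>p. u p + t * v p) p = Gamma u v p + t * Gamma v v p"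
      unfolding Gamma_commute[of v "\<lambda>p. u p + t * v p"] l ..
    show ?thesis unfolding l 1 2 by (simp add: power2_eq_square algebra_simps)
  qed
  have E: "(u p + t * v p) * ((u p + t * v p) * r)
    = u p * (u p * r) + 2 * t * (u p * (v p * r)) + t\<^sup>2 * (v p * (v p * r))" for p r
    by (simp add: power2_eq_square algebra_simps)
  note i = integrable_form_terms[OF u su] integrable_form_terms[OF u sv] integrable_form_terms[OF v sv]
  show "form (\<lambda>p. u p + t * v p) (\<lambda>p. u p + t * v p) = form u u + 2 * t * form u v + t\<^sup>2 * form v v"
    unfolding form_def G E integral_quadratic[OF i(1,4,7)] integral_quadratic[OF i(2,5,8)]
    by (simp add: algebra_simps)
  show "mass (\<lambda>p. u p + t * v p) (\<lambda>p. u p + t * v p) = mass u u + 2 * t * mass u v + t\<^sup>2 * mass v v"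
    unfolding mass_def E by (rule integral_quadratic[OF i(3,6,9)])
qed

lemma mass_nonneg: "mass u u \<ge> 0"
proof -
  have "u p * (u p * wt p) \<ge> 0" for p
    using wt_pos[of p] by (simp add: mult.assoc[symmetric])
  then show ?thesis unfolding mass_def by (intro integral_nonneg_AE AE_I2)
qed

text \<open>By continuity zero mass forces \<open>u\<close> to vanish everywhere. This extends the
  spectral inequality to the test functions that the quotient excludes.\<close>

lemma mass_eq_0_imp_form_eq_0:
  assumes u: "test_function A u" and "mass u u = 0"
  shows "form u u = 0"
proof -
  have cont: "continuous_on UNIV (\<lambda>p. u p * (u p * wt p))"
    by (intro continuous_on_mult smooth_map_continuous test_functionD[OF u] smooth_wt)
  have "u p * (u p * wt p) = 0" for p
    by (rule continuous_nonneg_integral_eq_0[OF cont integrable_form_terms(3)[OF u test_functionD[OF u]]])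
      (use wt_pos assms(2) in \<open>auto simp: mass_def mult.assoc[symmetric] less_imp_le\<close>)
  then have "u p = 0" for p using wt_pos[of p] by (metis less_irrefl mult_eq_0_iff)
  then have "u = (\<lambda>_. 0)" by auto
  moreover have "Gamma (\<lambda>_. 0) v p = 0" for v p by (rule Gamma_local_zero[of UNIV]) auto
  ultimately show ?thesis by (simp add: form_def)
qed

lemma form_ge_spectrum_mass:
  assumes "bottom_spectrum A F \<sigma> \<ge> ereal m" and u: "test_function A u"
  shows "m * mass u u \<le> form u u"
proof (cases "mass u u = 0")
  case True
  then show ?thesis using mass_eq_0_imp_form_eq_0[OF u] by simp
next
  case False
  have "bottom_spectrum A F \<sigma> \<le> ereal (form u u / mass u u)"
    unfolding bottom_spectrum_eq by (rule Inf_lower) (use u False in blast)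
  then have "m \<le> form u u / mass u u" using assms(1) order_trans ereal_less_eq(3) by blast
  then show ?thesis using False mass_nonneg[of u] by (simp add: pos_le_divide_eq)
qed

section \<open>Limits along the cut-offs and the upper bound\<close>

lemma cutoff_sq_le: "(cutoff n p)\<^sup>2 \<le> s1\<^sup>2"
  by (rule power_mono[OF cutoff_le cutoff_nonneg])

text \<open>Power 2 serves the diagonal terms of \<open>form\<close> and \<open>mass\<close>, power
  1 their pairing with a fixed test function.\<close>

lemma cutoff_power_integral_tendsto:
  assumes f: "integrable \<sigma> f"
  shows "(\<lambda>n. LINT p|\<sigma>. (cutoff n p) ^ k * f p) \<longlonglongrightarrow> s1 ^ k * integral\<^sup>L \<sigma> f"
proof -
  have "(\<lambda>n. LINT p|\<sigma>. (cutoff n p) ^ k * f p) \<longlonglongrightarrow> (LINT p|\<sigma>. s1 ^ k * f p)"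
  proof (rule integral_dominated_convergence[where w = "\<lambda>p. s1 ^ k * norm (f p)"])
    show "(\<lambda>p. (cutoff n p) ^ k * f p) \<in> borel_measurable \<sigma>" for n
      by (intro borel_measurable_times borel_measurable_power borel_measurable_sigma
          borel_measurable_continuous_onI continuous_cutoff borel_measurable_integrable f)
    show "(\<lambda>p. s1 ^ k * f p) \<in> borel_measurable \<sigma>" "integrable \<sigma> (\<lambda>p. s1 ^ k * norm (f p))"
      using f by auto
    show "AE p in \<sigma>. (\<lambda>n. (cutoff n p) ^ k * f p) \<longlonglongrightarrow> s1 ^ k * f p"
      by (intro AE_I2 tendsto_mult tendsto_power cutoff_tendsto tendsto_const)
    have "\<bar>cutoff n p\<bar> ^ k \<le> s1 ^ k" for n p
      using cutoff_nonneg[of n p] cutoff_le[of n p] by (intro power_mono) auto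
    then show "AE p in \<sigma>. norm ((cutoff n p) ^ k * f p) \<le> s1 ^ k * norm (f p)" for n
      by (intro AE_I2) (simp add: abs_mult power_abs mult_right_mono)
  qed
  then show ?thesis by simp
qed

lemma Gamma_cutoff_cutoff: "Gamma (cutoff n) (cutoff n) p = (cutoff_slope n p)\<^sup>2 * (rho p - H2 p)"
  unfolding Gamma_cutoff[of n "cutoff n"] Gamma_commute[of rho "cutoff n"] Gamma_cutoff Gamma_rho_rho
  by (simp add: power2_eq_square)

text \<open>The slope is at most \<open>256 / real (Suc n)\<close> and the squared gradient of
  \<open>rho\<close> at most \<open>rho\<close>, whose weighted integral is finite.\<close>

lemma dirichlet_cutoff_bound:
  assumes "growth_bound \<theta> C"
  shows "(LINT p|\<sigma>. Gamma (cutoff n) (cutoff n) p * wt p) \<le> (256 / real (Suc n))\<^sup>2 * (LINT p|\<sigma>. rho p * wt p)"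
proof -
  have "(LINT p|\<sigma>. Gamma (cutoff n) (cutoff n) p * wt p) \<le> (LINT p|\<sigma>. (256 / real (Suc n))\<^sup>2 * (rho p * wt p))"
  proof (rule integral_mono)
    show "integrable \<sigma> (\<lambda>p. Gamma (cutoff n) (cutoff n) p * wt p)"
      by (rule integrable_form_terms(1)[OF test_function_cutoff_n smooth_cutoff])
    show "integrable \<sigma> (\<lambda>p. (256 / real (Suc n))\<^sup>2 * (rho p * wt p))"
      using integrable_rho_wt(2)[OF assms] by simp
    fix p
    have "(cutoff_slope n p)\<^sup>2 * (rho p - H2 p) \<le> (256 / real (Suc n))\<^sup>2 * rho p"
      using cutoff_slope_bounds[of n p] H2_le_rho[of p] H2_nonneg[of p]
      by (intro mult_mono power_mono) auto
    then have "(cutoff_slope n p)\<^sup>2 * (rho p - H2 p) * wt p \<le> (256 / real (Suc n))\<^sup>2 * rho p * wt p"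
      using wt_pos[of p] by (intro mult_right_mono) auto
    then show "Gamma (cutoff n) (cutoff n) p * wt p \<le> (256 / real (Suc n))\<^sup>2 * (rho p * wt p)"
      by (simp add: Gamma_cutoff_cutoff mult.assoc)
  qed
  then show ?thesis by simp
qed

lemma dirichlet_cutoff_tendsto:
  assumes "growth_bound \<theta> C"
  shows "(\<lambda>n. LINT p|\<sigma>. Gamma (cutoff n) (cutoff n) p * wt p) \<longlonglongrightarrow> 0"
proof (rule tendsto_sandwich[OF _ _ tendsto_const])
  have "(\<lambda>n. (256 * inverse (real (Suc n)))\<^sup>2 * (LINT p|\<sigma>. rho p * wt p)) \<longlonglongrightarrow> (256 * 0)\<^sup>2 * (LINT p|\<sigma>. rho p * wt p)"
    by (intro tendsto_mult tendsto_power tendsto_const LIMSEQ_inverse_real_of_nat)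
  then show "(\<lambda>n. (256 / real (Suc n))\<^sup>2 * (LINT p|\<sigma>. rho p * wt p)) \<longlonglongrightarrow> 0"
    by (simp add: divide_inverse)
  show "\<forall>\<^sub>F n in sequentially. 0 \<le> (LINT p|\<sigma>. Gamma (cutoff n) (cutoff n) p * wt p)"
    using Gamma_nonneg wt_pos
    by (intro always_eventually allI integral_nonneg_AE AE_I2 mult_nonneg_nonneg) (auto intro: less_imp_le)
  show "\<forall>\<^sub>F n in sequentially. (LINT p|\<sigma>. Gamma (cutoff n) (cutoff n) p * wt p)
      \<le> (256 / real (Suc n))\<^sup>2 * (LINT p|\<sigma>. rho p * wt p)"
    by (intro always_eventually allI dirichlet_cutoff_bound[OF assms])
qed

lemma mass_cutoff_tendsto:
  assumes "growth_bound \<theta> C"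
  shows "(\<lambda>n. mass (cutoff n) (cutoff n)) \<longlonglongrightarrow> s1\<^sup>2 * integral\<^sup>L \<sigma> wt"
  using cutoff_power_integral_tendsto[OF integrable_rho_wt(1)[OF assms], of 2]
  by (simp add: mass_def power2_eq_square mult.assoc)

text \<open>Some cut-off has positive mass, so the infimum is not over the empty set; a spectrum
  above \<open>- \<infinity>\<close> is then a real number.\<close>

lemma bottom_spectrum_less_top:
  assumes "growth_bound \<theta> C"
  shows "bottom_spectrum A F \<sigma> < \<infinity>"
proof -
  have "s1\<^sup>2 * integral\<^sup>L \<sigma> wt > 0" using s1_pos integral_wt_pos[OF assms] by simp
  from order_tendstoD(1)[OF mass_cutoff_tendsto[OF assms] this]
  obtain n where "mass (cutoff n) (cutoff n) > 0"
    by (auto simp: eventually_sequentially)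
  then have "bottom_spectrum A F \<sigma> \<le> ereal (form (cutoff n) (cutoff n) / mass (cutoff n) (cutoff n))"
    unfolding bottom_spectrum_eq using test_function_cutoff_n[of n] by (intro Inf_lower) force
  also have "\<dots> < \<infinity>" by simp
  finally show ?thesis .
qed

lemma A2_nonneg: "A2 p \<ge> 0"
  unfolding second_ff_norm_sq_eq second_ff_norm_sq_local_def
  by (intro sum_nonneg local_immersion.contract2_inv_metric_nonneg[OF local_immersion_chart[OF chart_at(1)]]
      chart_in_image[OF chart_at(2)])

text \<open>Solving the definition of \<open>form\<close> for the \<open>A2\<close> term expresses
  its cut-off integral by a Dirichlet term, a curvature term without \<open>A2\<close> and
  \<open>- form\<close>. The spectral bound controls the last by \<open>\<bar>m\<bar>\<close> times
  the mass, so monotone convergence applies.\<close>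

lemma A2_wt_integrable:
  assumes g: "growth_bound \<theta> C" and m: "bottom_spectrum A F \<sigma> \<ge> ereal m"
  shows "integrable \<sigma> (\<lambda>p. A2 p * wt p)"
proof -
  \<comment> \<open>The weighted energy without its \<open>A2\<close> part: nonnegative and already
    known to be integrable.\<close>
  define E1 where "E1 p = ((real CARD('n) + 1) / 2 + H2 p) * wt p" for p
  have E1: "integrable \<sigma> E1"
    unfolding E1_def[abs_def] distrib_right
    using H2_wt_integrable[OF g] integrable_rho_wt(1)[OF g] by simp
  have E1_nonneg: "E1 p \<ge> 0" for p
    using H2_nonneg[of p] wt_pos[of p] by (simp add: E1_def)
  have i: "integrable \<sigma> (\<lambda>p. (cutoff n p)\<^sup>2 * (A2 p * wt p))" for n
    by (rule integrable_test_sq[OF test_function_cutoff_n])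
      (intro continuous_on_mult continuous_second_ff_norm_sq continuous_wt)
  have i1: "integrable \<sigma> (\<lambda>p. (cutoff n p)\<^sup>2 * E1 p)" for n
    unfolding E1_def
    by (rule integrable_test_sq[OF test_function_cutoff_n])
      (intro continuous_on_mult continuous_on_add continuous_on_const continuous_H2 continuous_wt)
  \<comment> \<open>One summand for each of the three terms; \<open>256\<^sup>2\<close> is the
    Dirichlet bound at \<open>n = 0\<close>, the largest one.\<close>
  define B where "B = 256\<^sup>2 * (LINT p|\<sigma>. rho p * wt p) + s1\<^sup>2 * integral\<^sup>L \<sigma> E1 + \<bar>m\<bar> * (s1\<^sup>2 * integral\<^sup>L \<sigma> wt)"
  have "integrable \<sigma> (\<lambda>p. s1\<^sup>2 * (A2 p * wt p))"
  proof (rule bounded_monotone_convergence[OF i])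
    show "(cutoff n p)\<^sup>2 * (A2 p * wt p) \<le> (cutoff k p)\<^sup>2 * (A2 p * wt p)" if "n \<le> k" for n k p
      using cutoff_mono[OF that] cutoff_nonneg A2_nonneg wt_pos[of p]
      by (intro mult_right_mono power_mono mult_nonneg_nonneg) (auto intro: less_imp_le)
    show "(\<lambda>n. (cutoff n p)\<^sup>2 * (A2 p * wt p)) \<longlonglongrightarrow> s1\<^sup>2 * (A2 p * wt p)" for p
      by (intro tendsto_mult tendsto_power cutoff_tendsto tendsto_const)
    show "(\<lambda>p. s1\<^sup>2 * (A2 p * wt p)) \<in> borel_measurable \<sigma>"
      by (intro borel_measurable_sigma borel_measurable_continuous_onI continuous_on_mult
          continuous_on_const continuous_second_ff_norm_sq continuous_wt)
    fix n
    have "form (cutoff n) (cutoff n) = (LINT p|\<sigma>. Gamma (cutoff n) (cutoff n) p * wt p)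
        + (LINT p|\<sigma>. (cutoff n p)\<^sup>2 * E1 p - (cutoff n p)\<^sup>2 * (A2 p * wt p))"
      by (simp add: form_def E1_def energy_def power2_eq_square algebra_simps)
    then have "(LINT p|\<sigma>. (cutoff n p)\<^sup>2 * (A2 p * wt p)) = (LINT p|\<sigma>. Gamma (cutoff n) (cutoff n) p * wt p)
        + (LINT p|\<sigma>. (cutoff n p)\<^sup>2 * E1 p) - form (cutoff n) (cutoff n)"
      using i i1 by simp
    moreover have "(LINT p|\<sigma>. Gamma (cutoff n) (cutoff n) p * wt p) \<le> 256\<^sup>2 * (LINT p|\<sigma>. rho p * wt p)"
    proof -
      have "(256 / real (Suc n))\<^sup>2 \<le> 256\<^sup>2" by (intro power_mono) (auto simp: field_simps)
      moreover have "(LINT p|\<sigma>. rho p * wt p) \<ge> 0"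
        using rho_nonneg wt_pos by (intro integral_nonneg_AE AE_I2 mult_nonneg_nonneg) (auto intro: less_imp_le)
      ultimately show ?thesis
        using dirichlet_cutoff_bound[OF g, of n] mult_right_mono by fastforce
    qed
    moreover have "(LINT p|\<sigma>. (cutoff n p)\<^sup>2 * E1 p) \<le> (LINT p|\<sigma>. s1\<^sup>2 * E1 p)"
      using i1 E1 by (intro integral_mono mult_right_mono cutoff_sq_le E1_nonneg) auto
    moreover have "- form (cutoff n) (cutoff n) \<le> \<bar>m\<bar> * (s1\<^sup>2 * integral\<^sup>L \<sigma> wt)"
    proof -
      have "mass (cutoff n) (cutoff n) = (LINT p|\<sigma>. (cutoff n p)\<^sup>2 * wt p)"
        by (simp add: mass_def power2_eq_square mult.assoc)
      also have "\<dots> \<le> (LINT p|\<sigma>. s1\<^sup>2 * wt p)"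
        using integrable_test_sq[OF test_function_cutoff_n continuous_wt] integrable_rho_wt(1)[OF g] wt_pos
        by (intro integral_mono mult_right_mono cutoff_sq_le) (auto intro: less_imp_le)
      finally have "\<bar>m\<bar> * mass (cutoff n) (cutoff n) \<le> \<bar>m\<bar> * (s1\<^sup>2 * integral\<^sup>L \<sigma> wt)"
        by (intro mult_left_mono) auto
      moreover have "- m * mass (cutoff n) (cutoff n) \<le> \<bar>m\<bar> * mass (cutoff n) (cutoff n)"
        by (intro mult_right_mono mass_nonneg) auto
      ultimately show ?thesis using form_ge_spectrum_mass[OF m test_function_cutoff_n, of n] by linarith
    qed
    ultimately show "(LINT p|\<sigma>. (cutoff n p)\<^sup>2 * (A2 p * wt p)) \<le> B" by (simp add: B_def)
  qed
  then show ?thesis using s1_pos by simp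
qed

lemma energy_wt_integrable:
  assumes g: "growth_bound \<theta> C" and m: "bottom_spectrum A F \<sigma> \<ge> ereal m"
  shows "integrable \<sigma> (\<lambda>p. wt p * energy p)"
proof -
  have "integrable \<sigma> (\<lambda>p. (real CARD('n) + 1) / 2 * wt p + (H2 p * wt p - A2 p * wt p))"
    using integrable_rho_wt(1)[OF g] H2_wt_integrable[OF g] A2_wt_integrable[OF g m] by simp
  then show ?thesis by (simp add: energy_def algebra_simps)
qed

lemma form_cutoff_tendsto:
  assumes g: "growth_bound \<theta> C" and m: "bottom_spectrum A F \<sigma> \<ge> ereal m"
  shows "(\<lambda>n. form (cutoff n) (cutoff n)) \<longlonglongrightarrow> s1\<^sup>2 * (LINT p|\<sigma>. wt p * energy p)"
  using tendsto_add[OF dirichlet_cutoff_tendsto[OF g] cutoff_power_integral_tendsto[OF energy_wt_integrable[OF g m], of 2]]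
  by (simp add: form_def power2_eq_square mult.assoc)

text \<open>The spectral inequality on the cut-offs passes to the limit, and the common factor
  \<open>s1\<^sup>2\<close> cancels.\<close>

lemma spectrum_upper_bound:
  assumes g: "growth_bound \<theta> C" and m: "bottom_spectrum A F \<sigma> \<ge> ereal m"
  shows "m * integral\<^sup>L \<sigma> wt \<le> (LINT p|\<sigma>. wt p * energy p)"
proof -
  have "m * (s1\<^sup>2 * integral\<^sup>L \<sigma> wt) \<le> s1\<^sup>2 * (LINT p|\<sigma>. wt p * energy p)"
    by (rule LIMSEQ_le[OF tendsto_mult[OF tendsto_const mass_cutoff_tendsto[OF g]] form_cutoff_tendsto[OF g m]])
      (use form_ge_spectrum_mass[OF m test_function_cutoff_n] in blast)
  then have "s1\<^sup>2 * (m * integral\<^sup>L \<sigma> wt) \<le> s1\<^sup>2 * (LINT p|\<sigma>. wt p * energy p)" by (simp add: mult_ac)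
  then show ?thesis using s1_pos by simp
qed

section \<open>The Euler-Lagrange equation and the equality case\<close>

text \<open>The gradient of a cut-off is the gradient of \<open>rho\<close> times a factor of order
  \<open>1 / n\<close>, and its product with the gradient of the fixed \<open>v\<close> is
  integrable, so the mixed Dirichlet term disappears.\<close>

lemma form_cutoff_test_tendsto:
  assumes v: "test_function A v"
  shows "(\<lambda>n. form (cutoff n) v) \<longlonglongrightarrow> s1 * (LINT p|\<sigma>. v p * (wt p * energy p))"
    and "(\<lambda>n. mass (cutoff n) v) \<longlonglongrightarrow> s1 * (LINT p|\<sigma>. v p * wt p)"
proof -
  note sv = test_functionD[OF v]
  have iG: "integrable \<sigma> (\<lambda>p. Gamma v rho p * wt p)"
    by (rule integrable_form_terms(1)[OF v smooth_rho])
  have iE: "integrable \<sigma> (\<lambda>p. v p * (wt p * energy p))"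
    by (rule integrable_test[OF v continuous_on_mult[OF continuous_wt continuous_energy]])
  have "(\<lambda>n. LINT p|\<sigma>. Gamma (cutoff n) v p * wt p) \<longlonglongrightarrow> 0"
  proof (rule Lim_null_comparison)
    have "norm (LINT p|\<sigma>. Gamma (cutoff n) v p * wt p) \<le> (LINT p|\<sigma>. 256 * inverse (real (Suc n)) * norm (Gamma v rho p * wt p))" for n
    proof (rule order_trans[OF integral_norm_bound integral_mono])
      show "integrable \<sigma> (\<lambda>p. norm (Gamma (cutoff n) v p * wt p))"
        by (rule integrable_norm, rule integrable_form_terms(1)[OF test_function_cutoff_n sv])
      show "integrable \<sigma> (\<lambda>p. 256 * inverse (real (Suc n)) * norm (Gamma v rho p * wt p))" using iG by simp
      show "norm (Gamma (cutoff n) v p * wt p) \<le> 256 * inverse (real (Suc n)) * norm (Gamma v rho p * wt p)" for p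
      proof -
        have "norm (Gamma (cutoff n) v p * wt p) = cutoff_slope n p * norm (Gamma v rho p * wt p)"
          unfolding Gamma_cutoff Gamma_commute[of rho v] using cutoff_slope_bounds(1)[of n p] by (simp add: abs_mult)
        also have "\<dots> \<le> 256 * inverse (real (Suc n)) * norm (Gamma v rho p * wt p)"
          using cutoff_slope_bounds(2)[of n p] by (intro mult_right_mono) (auto simp: divide_inverse)
        finally show ?thesis .
      qed
    qed
    then show "\<forall>\<^sub>F n in sequentially. norm (LINT p|\<sigma>. Gamma (cutoff n) v p * wt p)
        \<le> 256 * inverse (real (Suc n)) * (LINT p|\<sigma>. norm (Gamma v rho p * wt p))"
      by (intro always_eventually allI) simp
    show "(\<lambda>n. 256 * inverse (real (Suc n)) * (LINT p|\<sigma>. norm (Gamma v rho p * wt p))) \<longlonglongrightarrow> 0"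
      by (intro tendsto_mult_left_zero tendsto_mult_right_zero LIMSEQ_inverse_real_of_nat)
  qed
  from tendsto_add[OF this cutoff_power_integral_tendsto[OF iE, of 1]]
  show "(\<lambda>n. form (cutoff n) v) \<longlonglongrightarrow> s1 * (LINT p|\<sigma>. v p * (wt p * energy p))"
    by (simp add: form_def)
  from cutoff_power_integral_tendsto[OF integrable_test[OF v continuous_wt], of 1]
  show "(\<lambda>n. mass (cutoff n) v) \<longlonglongrightarrow> s1 * (LINT p|\<sigma>. v p * wt p)"
    by (simp add: mass_def)
qed

text \<open>
  In the equality case the nonnegative quadratic form \<open>form - m mass\<close> tends to \<open>0\<close> along the cut-offs, so
  its polarisation with any test function does too. This is the Euler-Lagrange equation of the constant.
\<close>

lemma energy_constant:
  assumes g: "growth_bound \<theta> C" and m: "bottom_spectrum A F \<sigma> \<ge> ereal m"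
    and eq: "m * integral\<^sup>L \<sigma> wt = (LINT p|\<sigma>. wt p * energy p)"
  shows "energy p = m"
proof -
  have orth: "(LINT p|\<sigma>. v p * (wt p * (energy p - m))) = 0" if v: "test_function A v" for v
  proof -
    let ?I = "LINT p|\<sigma>. v p * (wt p * energy p)" and ?J = "LINT p|\<sigma>. v p * wt p"
    let ?b = "form v v - m * mass v v"
    \<comment> \<open>The value of \<open>form - m * mass\<close> at
      \<open>cutoff n + t * v\<close>, hence nonnegative. In the limit its constant term vanishes by
      \<open>eq\<close>, leaving a quadratic in \<open>t\<close> whose linear coefficient must be
      zero.\<close>
    let ?q = "\<lambda>t n. (form (cutoff n) (cutoff n) - m * mass (cutoff n) (cutoff n))
      + 2 * t * (form (cutoff n) v - m * mass (cutoff n) v) + t\<^sup>2 * ?b"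
    have "0 \<le> 2 * t * (s1 * (?I - m * ?J)) + t\<^sup>2 * ?b" for t
    proof (rule LIMSEQ_le[OF tendsto_const])
      have lim: "?q t
        \<longlonglongrightarrow> (s1\<^sup>2 * (LINT p|\<sigma>. wt p * energy p) - m * (s1\<^sup>2 * integral\<^sup>L \<sigma> wt))
          + 2 * t * (s1 * ?I - m * (s1 * ?J)) + t\<^sup>2 * ?b"
        by (intro tendsto_add tendsto_diff tendsto_mult tendsto_const form_cutoff_tendsto[OF g m]
            mass_cutoff_tendsto[OF g] form_cutoff_test_tendsto[OF v])
      have "(s1\<^sup>2 * (LINT p|\<sigma>. wt p * energy p) - m * (s1\<^sup>2 * integral\<^sup>L \<sigma> wt))
          + 2 * t * (s1 * ?I - m * (s1 * ?J)) + t\<^sup>2 * ?b = 2 * t * (s1 * (?I - m * ?J)) + t\<^sup>2 * ?b"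
        unfolding eq[symmetric] by (simp add: algebra_simps)
      with lim show "?q t
        \<longlonglongrightarrow> 2 * t * (s1 * (?I - m * ?J)) + t\<^sup>2 * ?b"
        by (simp only:)
      have "0 \<le> ?q t n" for n
      proof -
        have "test_function A (\<lambda>p. cutoff n p + t * v p)"
          using test_function_add[OF test_function_cutoff_n test_function_mult[OF v smooth_map_const[of t]], of n]
          by (simp add: mult.commute)
        from form_ge_spectrum_mass[OF m this] show ?thesis
          unfolding form_mass_expand[OF test_function_cutoff_n v] by (simp add: algebra_simps)
      qed
      then show "\<exists>N. \<forall>n\<ge>N. 0 \<le> ?q t n" by blast
    qed
    then have "s1 * (?I - m * ?J) = 0" by (rule linear_coefficient_eq_0)
    then have "?I - m * ?J = 0" using s1_pos by simp
    moreover have "(LINT p|\<sigma>. v p * (wt p * (energy p - m))) = ?I - m * ?J"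
    proof -
      have "(LINT p|\<sigma>. v p * (wt p * energy p) - m * (v p * wt p)) = ?I - m * ?J"
        using integrable_test[OF v continuous_on_mult[OF continuous_wt continuous_energy]]
          integrable_test[OF v continuous_wt] by simp
      then show ?thesis by (simp add: algebra_simps)
    qed
    ultimately show ?thesis by simp
  qed
  have "wt p * (energy p - m) = 0"
    by (rule test_functions_dense[OF _ orth])
      (intro continuous_on_mult continuous_on_diff continuous_wt continuous_energy continuous_on_const)
  then show ?thesis using wt_pos[of p] by simp
qed

lemma spectrum_ge_constant_energy:
  assumes "\<And>p. energy p = l"
  shows "bottom_spectrum A F \<sigma> \<ge> ereal l"
  unfolding bottom_spectrum_eq
proof (rule Inf_greatest)
  fix x assume "x \<in> {ereal (form u u / mass u u) |u. test_function A u \<and> mass u u \<noteq> 0}"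
  then obtain u where u: "x = ereal (form u u / mass u u)" "test_function A u" "mass u u \<noteq> 0" by blast
  have "form u u = (LINT p|\<sigma>. Gamma u u p * wt p) + l * mass u u"
    by (simp add: form_def mass_def assms mult_ac flip: Bochner_Integration.integral_mult_right_zero)
  moreover have "(LINT p|\<sigma>. Gamma u u p * wt p) \<ge> 0"
    using Gamma_nonneg wt_pos by (intro integral_nonneg_AE AE_I2 mult_nonneg_nonneg) (auto intro: less_imp_le)
  ultimately show "ereal l \<le> x"
    using u mass_nonneg[of u] by (simp add: pos_le_divide_eq)
qed

end


section \<open>From the bound on the mean curvature to the theorem\<close>

lemma ext_integral_div:
  assumes "integrable M f" "d > 0"
  shows "ext_integral M f / ereal d = ereal (integral\<^sup>L M f / d)"
  using assms by (simp add: ext_integral_eq)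

text \<open>Young's inequality absorbs the cross term \<open>2 * a * b * r\<close> into a small
  multiple of \<open>r\<^sup>2\<close>; there is room because
  \<open>a\<^sup>2 < 1 / 8\<close>.\<close>

lemma quadratic_growth_bound:
  fixes a b r h :: real
  assumes a: "0 \<le> a" "a < 1 / (2 * sqrt 2)"
  obtains \<theta> C where "\<theta> < 1 / 2" "C \<ge> 0" "\<And>r. (a * r + b)\<^sup>2 \<le> \<theta> * (r\<^sup>2 / 4) + C"
proof -
  have "a\<^sup>2 < (1 / (2 * sqrt 2))\<^sup>2" using a by (intro power_strict_mono) auto
  then have a2: "a\<^sup>2 < 1 / 8" by (simp add: power_divide power_mult_distrib)
  \<comment> \<open>Half the gap below \<open>1 / 8\<close>. The witness
    \<open>4 * (a\<^sup>2 + e)\<close> then stays below \<open>1 / 2\<close>; its factor 4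
    compensates for \<open>r\<^sup>2 / 4\<close>.\<close>
  define e where "e = (1 / 8 - a\<^sup>2) / 2"
  have e: "e > 0" using a2 by (simp add: e_def)
  show thesis
  proof (rule that)
    show "4 * (a\<^sup>2 + e) < 1 / 2" using a2 by (simp add: e_def field_simps)
    show "a\<^sup>2 * b\<^sup>2 / e + b\<^sup>2 \<ge> 0" using e by simp
    fix r :: real
    have "0 \<le> e * (r - a * b / e)\<^sup>2" using e by simp
    also have "\<dots> = e * r\<^sup>2 - 2 * a * b * r + a\<^sup>2 * b\<^sup>2 / e"
      using e by (simp add: power2_eq_square field_simps)
    finally have "2 * a * b * r \<le> e * r\<^sup>2 + a\<^sup>2 * b\<^sup>2 / e" by simp
    then show "(a * r + b)\<^sup>2 \<le> 4 * (a\<^sup>2 + e) * (r\<^sup>2 / 4) + (a\<^sup>2 * b\<^sup>2 / e + b\<^sup>2)"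
      by (simp add: power2_eq_square algebra_simps)
  qed
qed

theorem theorem1p7:
  fixes A :: "('m::{t2_space, second_countable_topology}, 'n::finite) chart set"
    and F :: "'m \<Rightarrow> real ^ 'k::finite"
    and N :: "'m \<Rightarrow> real ^ 'k"
    and \<sigma> :: "'m measure"
    and a b :: real
  defines "\<mu>\<^sub>1 \<equiv> bottom_spectrum A F \<sigma>"
    and "Scal \<equiv> scal A F N"
    and "w \<equiv> \<lambda>p. exp (- (norm (F p))\<^sup>2 / 4)"
  assumes "immersed_hypersurface A F"
    and "complete_induced_metric F"
    and "properly_immersed F"
    and "self_expander A F"
    and "unit_normal A F N"
    and "volume_measure A F \<sigma>"
    and "0 \<le> a" and "a < 1 / (2 * sqrt 2)" and "b > 0"
    and "\<And>p. \<bar>mean_curvature A F N p\<bar> \<le> a * norm (F p) + b"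
  shows
    \<comment> \<open>the integrals on the right-hand side make sense, the numerator possibly being \<open>-\<infinity>\<close>\<close>
    "integrable \<sigma> w \<and>
     Scal \<in> borel_measurable \<sigma> \<and> (\<integral>\<^sup>+p. ennreal (Scal p * w p) \<partial>\<sigma>) < \<infinity> \<and>
     \<mu>\<^sub>1 \<le> ereal ((real CARD('n) + 1) / 2)
            + ext_integral \<sigma> (\<lambda>p. Scal p * w p) / ereal (LINT p|\<sigma>. w p) \<and>
     (\<mu>\<^sub>1 > - \<infinity> \<longrightarrow>
        integrable \<sigma> (\<lambda>p. Scal p * w p) \<and>
        (\<mu>\<^sub>1 = ereal ((real CARD('n) + 1) / 2)
                + ext_integral \<sigma> (\<lambda>p. Scal p * w p) / ereal (LINT p|\<sigma>. w p)
         \<longleftrightarrow> (\<exists>C. \<forall>p. Scal p = C)))"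
proof -
  interpret proper_self_expander A F \<sigma>
    using assms(4,6,7,9) unfolding immersed_hypersurface_def by unfold_locales auto
  have codim: "DIM(real ^ 'k) = CARD('n) + 1"
    using assms(4) by (simp add: immersed_hypersurface_def)
  have H_sq: "(mean_curvature A F N p)\<^sup>2 = H2 p" for p
  proof -
    define c where "c = chart_at A p"
    have c: "c \<in> A" "p \<in> fst c" using chart_at by (simp_all add: c_def)
    interpret C: local_immersion "chart_image c" "local_param F c" by (rule local_immersion_chart[OF c(1)])
    note y = chart_in_image[OF c(2)]
    \<comment> \<open>The expander equation makes this vector equal to \<open>nu\<close>, which is
      normal by construction.\<close>
    have "mean_curvature_vector A F p \<in> (tangent_space (local_param F c) (snd c p))\<^sup>\<bottom>"
      unfolding C.mem_orthogonal_iff[OF y] nu_eq_mean_curvature_vector[OF c, symmetric]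
      using C.nu_orthogonal[OF y] by blast
    moreover have "N p \<in> (tangent_space (local_param F c) (snd c p))\<^sup>\<bottom>" "norm (N p) = 1"
      using assms(8)[unfolded unit_normal_def, rule_format, of p] tangent_at_chart[OF c] by simp_all
    ultimately have "(mean_curvature_vector A F p \<bullet> N p)\<^sup>2 = (norm (mean_curvature_vector A F p))\<^sup>2"
      by (rule C.inner_unit_normal_sq[OF codim y])
    then show ?thesis by (simp add: mean_curvature_def H2_def)
  qed
  have Scal_eq: "Scal p = H2 p - A2 p" for p by (simp add: Scal_def scal_def H_sq)
  have w_eq: "w = wt" by (simp add: fun_eq_iff w_def wt_def rho_def)
  obtain \<theta> C where tC: "\<theta> < 1 / 2" "C \<ge> 0" "\<And>r. (a * r + b)\<^sup>2 \<le> \<theta> * (r\<^sup>2 / 4) + C"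
    using quadratic_growth_bound[OF assms(10,11), of b] by blast
  have g: "growth_bound \<theta> C"
    unfolding growth_bound_def
  proof (intro conjI allI tC)
    fix p
    have "H2 p = \<bar>mean_curvature A F N p\<bar>\<^sup>2" by (simp add: H_sq)
    also have "\<dots> \<le> (a * norm (F p) + b)\<^sup>2" using assms(13) by (intro power_mono) auto
    also have "\<dots> \<le> \<theta> * rho p + C" unfolding rho_def by (rule tC)
    finally show "H2 p \<le> \<theta> * rho p + C" .
  qed
  let ?I = "integral\<^sup>L \<sigma> wt" and ?S = "LINT p|\<sigma>. Scal p * wt p" and ?c = "(real CARD('n) + 1) / 2"
  note int_w = integrable_rho_wt(1)[OF g] and I_pos = integral_wt_pos[OF g]
  have meas: "Scal \<in> borel_measurable \<sigma>"
    unfolding Scal_eq[abs_def]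
    by (intro borel_measurable_sigma borel_measurable_continuous_onI continuous_on_diff
        continuous_H2 continuous_second_ff_norm_sq)
  \<comment> \<open>Since \<open>A2\<close> is nonnegative, the integrable \<open>H2 * wt\<close>
    dominates the positive part, whatever the value of \<open>\<mu>\<^sub>1\<close>.\<close>
  have pos_part: "(\<integral>\<^sup>+p. ennreal (Scal p * wt p) \<partial>\<sigma>) < \<infinity>"
  proof -
    have "(\<integral>\<^sup>+p. ennreal (Scal p * wt p) \<partial>\<sigma>) \<le> (\<integral>\<^sup>+p. ennreal (norm (H2 p * wt p)) \<partial>\<sigma>)"
    proof (rule nn_integral_mono, rule ennreal_leI)
      fix p
      have "Scal p * wt p \<le> H2 p * wt p"
        using A2_nonneg[of p] wt_pos[of p] by (intro mult_right_mono) (auto simp: Scal_eq)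
      then show "Scal p * wt p \<le> norm (H2 p * wt p)"
        unfolding real_norm_def by (rule order_trans[OF _ abs_ge_self])
    qed
    also have "\<dots> < \<infinity>"
      using H2_wt_integrable[OF g] by (simp add: integrable_iff_bounded)
    finally show ?thesis .
  qed
  \<comment> \<open>For finite \<open>\<mu>\<^sub>1\<close> the scalar curvature is integrable
    against the weight, so \<open>ext_integral\<close> is an ordinary integral and the claim is one
    about real numbers.\<close>
  have finite_case: "integrable \<sigma> (\<lambda>p. Scal p * wt p) \<and>
      \<mu>\<^sub>1 \<le> ereal ?c + ext_integral \<sigma> (\<lambda>p. Scal p * wt p) / ereal ?I \<and>
      (\<mu>\<^sub>1 = ereal ?c + ext_integral \<sigma> (\<lambda>p. Scal p * wt p) / ereal ?I \<longleftrightarrow> (\<exists>C. \<forall>p. Scal p = C))"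
    if finite: "\<mu>\<^sub>1 > - \<infinity>"
  proof -
    obtain m where m: "\<mu>\<^sub>1 = ereal m"
      using finite bottom_spectrum_less_top[OF g] unfolding \<mu>\<^sub>1_def by (cases "bottom_spectrum A F \<sigma>") auto
    then have ge: "bottom_spectrum A F \<sigma> \<ge> ereal m" by (simp add: \<mu>\<^sub>1_def)
    have int_S: "integrable \<sigma> (\<lambda>p. Scal p * wt p)"
      using H2_wt_integrable[OF g] A2_wt_integrable[OF g ge] by (simp add: Scal_eq left_diff_distrib)
    have rhs: "ereal ?c + ext_integral \<sigma> (\<lambda>p. Scal p * wt p) / ereal ?I = ereal (?c + ?S / ?I)"
      by (simp add: ext_integral_div[OF int_S I_pos])
    have E: "(LINT p|\<sigma>. wt p * energy p) = ?c * ?I + ?S"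
    proof -
      have "(LINT p|\<sigma>. wt p * energy p) = (LINT p|\<sigma>. ?c * wt p + Scal p * wt p)"
        by (simp add: energy_def Scal_eq algebra_simps)
      also have "\<dots> = ?c * ?I + ?S" using int_w int_S by simp
      finally show ?thesis .
    qed
    have le: "m \<le> ?c + ?S / ?I"
      using spectrum_upper_bound[OF g ge] I_pos unfolding E by (simp add: field_simps)
    have "m = ?c + ?S / ?I \<longleftrightarrow> (\<exists>C. \<forall>p. Scal p = C)"
    proof
      assume "m = ?c + ?S / ?I"
      then have "m * ?I = (LINT p|\<sigma>. wt p * energy p)"
        unfolding E using I_pos by (simp add: field_simps)
      from energy_constant[OF g ge this] have "Scal p = m - ?c" for p
        by (simp add: energy_def Scal_eq algebra_simps)
      then show "\<exists>C. \<forall>p. Scal p = C" by blast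
    next
      assume "\<exists>C. \<forall>p. Scal p = C"
      then obtain s where s: "\<And>p. Scal p = s" by blast
      then have "energy p = ?c + s" for p by (simp add: energy_def Scal_eq[symmetric])
      from spectrum_ge_constant_energy[OF this] have "?c + s \<le> m" using m by (simp add: \<mu>\<^sub>1_def)
      moreover have "?S / ?I = s" using I_pos by (simp add: s)
      ultimately show "m = ?c + ?S / ?I" using le by simp
    qed
    then show ?thesis unfolding rhs m using int_S le by simp
  qed
  show ?thesis
  \<comment> \<open>At \<open>- \<infinity>\<close> the inequality is immediate and the equality
    statement is vacuous.\<close>
  proof (cases "\<mu>\<^sub>1 = - \<infinity>")
    case True
    then show ?thesis unfolding w_eq using int_w meas pos_part by simp
  next
    case False
    then have "\<mu>\<^sub>1 > - \<infinity>" by simp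
    from finite_case[OF this] show ?thesis unfolding w_eq using int_w meas pos_part by blast
  qed
qed

end
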